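(* Let $n\ge2$, $0<q<\infty$, $1<p,\tilde p,\tilde p_1,\tilde p_2<\infty$, $1<r<p$, $\frac1{\tilde p}=\frac1{\tilde p_1}+\frac1{\tilde p_2}$, $\alpha\in\mathbb{R}$, let $b\in CMOL^{\max(p,\frac{pr}{p-r})}_{\rm rad}L^{\tilde p_1}_{\rm ang}(\mathbb{R}^n)$, and let $\Phi$ be a radial function on $\mathbb{R}^n$. Put $$\mathcal{A}=\Big(\int_0^\infty|\Phi(t)|^{r'}\frac{dt}{t^{1-n(r'-1)}}\Big)^{1/r'},\qquad \mathcal{B}=\Big(\int_0^\infty|\Phi(t)|^{r'}\frac{dt}{t^{1-n}}\Big)^{1/r'},$$ where $r'$ is the conjugate exponent of $r$. Then: (a) if $\alpha<n(1/r-1/p)$ and $\mathcal{A}<\infty$, then $H^b_{\Phi,1}$ is bounded from $\dot K^{\alpha,q}_{L^{p}_{\rm rad}L^{\tilde p_2}_{\rm ang}}(\mathbb{R}^n)$ to $\dot K^{\alpha,q}_{L^{p}_{\rm rad}L^{\tilde p}_{\rm ang}}(\mathbb{R}^n)$; (b) if $\alpha>-n(1/p-1/r')$ and $\mathcal{B}<\infty$, then $H^b_{\Phi,2}$ is bounded from $\dot K^{\alpha,q}_{L^{p}_{\rm rad}L^{\tilde p_2}_{\rm ang}}(\mathbb{R}^n)$ to $\dot K^{\alpha,q}_{L^{p}_{\rm rad}L^{\tilde p}_{\rm ang}}(\mathbb{R}^n)$; (c) if $-n(1/p-1/r')<\alpha<n(1/r-1/p)$, $\mathcal{A}<\infty$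 and $\mathcal{B}<\infty$, then $H^b_{\Phi}$ is bounded from $\dot K^{\alpha,q}_{L^{p}_{\rm rad}L^{\tilde p_2}_{\rm ang}}(\mathbb{R}^n)$ to $\dot K^{\alpha,q}_{L^{p}_{\rm rad}L^{\tilde p}_{\rm ang}}(\mathbb{R}^n)$.
   Context: $S^{n-1}$ is the unit sphere of $\mathbb{R}^n$ with surface Lebesgue measure $d\sigma$, and $\nu_n$ is the volume of the unit ball of $\mathbb{R}^n$. For exponents $p,\tilde p$, $$\|f\|_{L^{p}_{\rm rad}L^{\tilde p}_{\rm ang}(\mathbb{R}^n)}=\Big(\int_0^\infty\Big(\int_{S^{n-1}}|f(\rho\theta)|^{\tilde p}d\sigma(\theta)\Big)^{p/\tilde p}\rho^{n-1}d\rho\Big)^{1/p}.$$ For $k\in\mathbb{Z}$, $\chi_k$ is the characteristic function of $\{x\in\mathbb{R}^n:2^{k-1}<|x|\le2^k\}$. The mixed radial-angular homogeneous Herz space $\dot K^{\alpha,q}_{L^{p}_{\rm rad}L^{\tilde p}_{\rm ang}}(\mathbb{R}^n)$ consists of the functions $f$, locally in $L^{p}_{\rm rad}L^{\tilde p}_{\rm ang}$ away from the origin, with $$\|f\|_{\dot K^{\alpha,q}_{L^{p}_{\rm rad}L^{\tilde p}_{\rm ang}}(\mathbb{R}^n)}=\Big\{\sum_{k=-\infty}^\infty2^{k\alpha q}\|f\chi_k\|^q_{L^{p}_{\rm rad}L^{\tilde p}_{\rm ang}(\mathbb{R}^n)}\Big\}^{1/q}<\infty.$$ For $1<s,\tilde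 s<\infty$, the mixed radial-angular CMO space $CMOL^{s}_{\rm rad}L^{\tilde s}_{\rm ang}(\mathbb{R}^n)$ consists of the functions $b$ with $$\|b\|_{CMOL^{s}_{\rm rad}L^{\tilde s}_{\rm ang}(\mathbb{R}^n)}=\sup_{R>0}\Big(\frac1{\nu_nR^n}\int_0^R\Big(\int_{S^{n-1}}|b(\rho\theta)-b_B|^{\tilde s}d\sigma(\theta)\Big)^{s/\tilde s}\rho^{n-1}d\rho\Big)^{1/s}<\infty,$$ where $B=B(0,R)$ and $b_B=\frac1{|B|}\int_Bb(x)\,dx$. The commutators are $$H^b_\Phi f(x)=\int_{\mathbb{R}^n}\frac{\Phi(x|y|^{-1})}{|y|^n}f(y)(b(x)-b(y))\,dy=H^b_{\Phi,1}f(x)+H^b_{\Phi,2}f(x),$$ $$H^b_{\Phi,1}f(x)=\int_{|y|<|x|}\frac{\Phi(x|y|^{-1})}{|y|^n}f(y)(b(x)-b(y))\,dy,\qquad H^b_{\Phi,2}f(x)=\int_{|y|\ge|x|}\frac{\Phi(x|y|^{-1})}{|y|^n}f(y)(b(x)-b(y))\,dy.$$ $\Phi$ is measurable; radial means $\Phi(x)$ depends only on $|x|$, and one writes $\Phi(t)$, $t>0$, for its value at points with $|x|=t$. "Bounded from $X$ to $Y$" means $\|Tf\|_Y\le C\|f\|_X$ for all $f\in X$ with $C$ independent of $f$. *)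

theory Defs
  imports "HOL-Analysis.Analysis"
begin

(* Surface measure of the unit sphere, by the cone construction:
   sigma(A) = n * |{r a : 0 < r < 1, a in A}|, the normalisation for which integration in polar
   coordinates reads dx = rho^(n-1) d(rho) d(sigma). *)
definition surface_measure :: "'a::euclidean_space measure" where
  "surface_measure =
     scale_measure (of_nat DIM('a))
       (distr (restrict_space lborel (ball 0 1 - {0})) (restrict_space borel (sphere 0 1))
          (\<lambda>x. x /\<^sub>R norm x))"

(* Power of an extended nonnegative real, used for positive exponents only. *)
definition ennpowr :: "ennreal \<Rightarrow> real \<Rightarrow> ennreal" (infixr \<open>ennpowr\<close> 80) where
  "x ennpowr a = (if x = \<infinity> then \<infinity> else ennreal (enn2real x powr a))"

(* For Lebesgue measurable f the inner integral is that of a function measurable for the completion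
   of the surface measure (for almost every \<rho>); nn_integral is the same for a measure and for its
   completion, so Borel measures suffice here. *)
definition mixed_norm :: "real \<Rightarrow> real \<Rightarrow> ('a::euclidean_space \<Rightarrow> complex) \<Rightarrow> ennreal" where
  "mixed_norm p pt f =
     (\<integral>\<^sup>+\<rho>\<in>{0<..}. (\<integral>\<^sup>+\<theta>. ennreal (norm (f (\<rho> *\<^sub>R \<theta>)) powr pt) \<partial>surface_measure) ennpowr (p / pt)
        * ennreal (\<rho> ^ (DIM('a) - 1)) \<partial>lborel) ennpowr (1 / p)"

definition shell :: "int \<Rightarrow> 'a::euclidean_space set" where
  "shell k = {x. 2 powr (real_of_int k - 1) < norm x \<and> norm x \<le> 2 powr real_of_int k}"

definition herz_norm ::
    "real \<Rightarrow> real \<Rightarrow> real \<Rightarrow> real \<Rightarrow> ('a::euclidean_space \<Rightarrow> complex) \<Rightarrow> ennreal" where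
  "herz_norm \<alpha> q p pt f =
     (\<Sum>\<^sub>\<infinity>k\<in>(UNIV::int set). ennreal (2 powr (real_of_int k * \<alpha> * q))
        * mixed_norm p pt (\<lambda>x. indicator (shell k) x *\<^sub>R f x) ennpowr q) ennpowr (1 / q)"

definition herz_space ::
    "real \<Rightarrow> real \<Rightarrow> real \<Rightarrow> real \<Rightarrow> ('a::euclidean_space \<Rightarrow> complex) set" where
  "herz_space \<alpha> q p pt =
     {f. f \<in> borel_measurable lebesgue
       \<and> (\<forall>K. compact K \<and> 0 \<notin> K \<longrightarrow> mixed_norm p pt (\<lambda>x. indicator K x *\<^sub>R f x) < \<infinity>)
       \<and> herz_norm \<alpha> q p pt f < \<infinity>}"

definition ball_mean :: "('a::euclidean_space \<Rightarrow> complex) \<Rightarrow> real \<Rightarrow> complex" where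
  "ball_mean b R = (LINT x:ball 0 R|lebesgue. b x) /\<^sub>R measure lebesgue (ball (0::'a) R)"

definition cmo_norm :: "real \<Rightarrow> real \<Rightarrow> ('a::euclidean_space \<Rightarrow> complex) \<Rightarrow> ennreal" where
  "cmo_norm s st b =
     (SUP R\<in>{0<..}. (ennreal (1 / (unit_ball_vol (real DIM('a)) * R ^ DIM('a)))
        * (\<integral>\<^sup>+\<rho>\<in>{0<..<R}.
             (\<integral>\<^sup>+\<theta>. ennreal (norm (b (\<rho> *\<^sub>R \<theta>) - ball_mean b R) powr st) \<partial>surface_measure)
               ennpowr (s / st) * ennreal (\<rho> ^ (DIM('a) - 1)) \<partial>lborel)) ennpowr (1 / s))"

(* Integrability on balls makes the means in the norm meaningful; for measurable b and
   s, st > 1 it is implied by finiteness of the norm. *)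
definition cmo_space :: "real \<Rightarrow> real \<Rightarrow> ('a::euclidean_space \<Rightarrow> complex) set" where
  "cmo_space s st =
     {b. b \<in> borel_measurable lebesgue
       \<and> (\<forall>R>0. set_integrable lebesgue (ball 0 R) b)
       \<and> cmo_norm s st b < \<infinity>}"

definition radial :: "('a::real_normed_vector \<Rightarrow> 'b) \<Rightarrow> bool" where
  "radial \<Phi> \<longleftrightarrow> (\<forall>x y. norm x = norm y \<longrightarrow> \<Phi> x = \<Phi> y)"

(* For radial \<Phi> and t > 0 the value does not depend on the chosen point. *)
definition radial_value :: "('a::real_normed_vector \<Rightarrow> 'b) \<Rightarrow> real \<Rightarrow> 'b" where
  "radial_value \<Phi> t = \<Phi> (SOME x. norm x = t)"

definition comm_integrand ::
    "('a::euclidean_space \<Rightarrow> complex) \<Rightarrow> ('a \<Rightarrow> complex) \<Rightarrow> ('a \<Rightarrow> complex) \<Rightarrow> 'a \<Rightarrow> 'a \<Rightarrow> complex" where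
  "comm_integrand \<Phi> b f x y =
     \<Phi> (x /\<^sub>R norm y) / of_real (norm y ^ DIM('a)) * f y * (b x - b y)"

definition hausdorff_comm ::
    "('a::euclidean_space \<Rightarrow> complex) \<Rightarrow> ('a \<Rightarrow> complex) \<Rightarrow> ('a \<Rightarrow> complex) \<Rightarrow> 'a \<Rightarrow> complex" where
  "hausdorff_comm \<Phi> b f x = (LINT y|lebesgue. comm_integrand \<Phi> b f x y)"

definition hausdorff_comm1 ::
    "('a::euclidean_space \<Rightarrow> complex) \<Rightarrow> ('a \<Rightarrow> complex) \<Rightarrow> ('a \<Rightarrow> complex) \<Rightarrow> 'a \<Rightarrow> complex" where
  "hausdorff_comm1 \<Phi> b f x = (LINT y:{y. norm y < norm x}|lebesgue. comm_integrand \<Phi> b f x y)"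

definition hausdorff_comm2 ::
    "('a::euclidean_space \<Rightarrow> complex) \<Rightarrow> ('a \<Rightarrow> complex) \<Rightarrow> ('a \<Rightarrow> complex) \<Rightarrow> 'a \<Rightarrow> complex" where
  "hausdorff_comm2 \<Phi> b f x = (LINT y:{y. norm x \<le> norm y}|lebesgue. comm_integrand \<Phi> b f x y)"

definition bounded_operator ::
    "'f set \<Rightarrow> ('f \<Rightarrow> ennreal) \<Rightarrow> 'g set \<Rightarrow> ('g \<Rightarrow> ennreal) \<Rightarrow> ('f \<Rightarrow> 'g) \<Rightarrow> bool" where
  "bounded_operator X normX Y normY T \<longleftrightarrow>
     (\<forall>f\<in>X. T f \<in> Y) \<and> (\<exists>C::real. \<forall>f\<in>X. normY (T f) \<le> ennreal C * normX f)"

end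

theory Submission
  imports Defs
begin

text \<open>On the dyadic shell with index \<open>k\<close> the commutator is estimated pointwise. Split \<open>f\<close> over
  the shells with index \<open>l\<close>; in polar coordinates, Hoelder's inequality on the sphere with exponents
  \<open>pt1\<close>, \<open>pt2\<close> and on the half-line with exponents \<open>r'\<close>, \<open>p\<close>, \<open>m = p r / (p - r)\<close> bounds the
  contribution of the shell \<open>l\<close> at \<open>x\<close> by the norm of \<open>\<Phi>\<close> times the mixed norm of \<open>f\<close> on the
  shell times \<open>|b x - b\<^sub>k|\<close> plus a multiple of \<open>1 + |k - l|\<close>, where \<open>b\<^sub>k\<close> is the mean of \<open>b\<close> over the
  ball of radius \<open>2 ^ (k + 1)\<close>. The substitution \<open>t = |x| / |y|\<close> turns the norm of the kernel into
  \<open>A\<close> (for \<open>l \<le> k\<close>) or \<open>B\<close> (for \<open>l \<ge> k\<close>), and the condition on \<open>\<alpha>\<close> leaves a factor that decays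
  geometrically in \<open>|k - l|\<close> and absorbs \<open>1 + |k - l|\<close>. Summation over \<open>l\<close> is then a discrete convolution
  on weighted sequence spaces.\<close>

section \<open>Lebesgue norms with values in the extended nonnegative reals\<close>

text \<open>The main estimates are inequalities in \<open>ennreal\<close>, valid before anything is
  known to converge; absolute convergence of the commutator integral is then read off from the
  finiteness of the bound. The exponent \<open>max p m\<close> in the hypothesis on \<open>b\<close>
  has two sources: inside the integral \<open>b y\<close> is measured radially with exponent
  \<open>m\<close>, and after integration in \<open>y\<close> the factor \<open>b x\<close> is
  measured with exponent \<open>p\<close>. With \<gamma> = n (r' - 1) for \<open>A\<close> and
  \<gamma> = n for \<open>B\<close>, the sign of \<gamma> / r' - n / p - \<alpha> decides on which
  side of the diagonal k = l the kernel decays, and the hypotheses on \<alpha> are exactly these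
  sign conditions. The obstacle is measurability: slices of a Lebesgue measurable function over
  spheres are under control for almost every radius only, and the kernel evaluates \<Phi> at radius
  |x| / |y|. So the bounds are proved for Borel versions, and null sets are carried through polar
  coordinates and inversion. The three operators differ only by a condition on |x| and |y|, which is
  kept as a predicate \<open>D\<close>.\<close>

lemma ennpowr_ennreal [simp]: "0 \<le> x \<Longrightarrow> ennreal x ennpowr a = ennreal (x powr a)"
  by (simp add: ennpowr_def)

lemma ennpowr_top [simp]: "top ennpowr a = top"
  by (simp add: ennpowr_def)

lemma ennpowr_zero [simp]: "0 ennpowr a = 0"
  by (simp add: ennpowr_def)

lemma ennpowr_one_left [simp]: "1 ennpowr a = 1"
  by (simp add: ennpowr_def)

lemma ennpowr_one_right [simp]: "x ennpowr 1 = x"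
  by (cases x) auto

lemma ennpowr_mono: "0 \<le> a \<Longrightarrow> x \<le> y \<Longrightarrow> x ennpowr a \<le> y ennpowr a"
  by (cases x; cases y) (auto simp: powr_mono2 top_unique)

text \<open>The exponent may have any sign, since \<open>ennpowr\<close> fixes both 0 and
  \<open>top\<close>; the product 0 * \<open>top\<close> = 0 respects these conventions.\<close>

lemma ennpowr_mult: "(x * y) ennpowr a = x ennpowr a * y ennpowr a"
proof (cases "x = 0 \<or> y = 0")
  case False
  then have "ennreal (c powr a) \<noteq> 0" if "c > 0" for c
    using that by simp
  with False show ?thesis
    by (cases x; cases y)
      (auto simp: ennreal_mult_top ennreal_top_mult powr_mult simp flip: ennreal_mult)
qed auto

lemma ennpowr_ennpowr: "(x ennpowr a) ennpowr b = x ennpowr (a * b)"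
  by (cases x) (auto simp: powr_powr)

lemma ennpowr_inverse_cancel: "a \<noteq> 0 \<Longrightarrow> (x ennpowr a) ennpowr (1 / a) = x"
  "a \<noteq> 0 \<Longrightarrow> (x ennpowr (1 / a)) ennpowr a = x"
  by (simp_all add: ennpowr_ennpowr)

lemma ennpowr_eq_0_iff [simp]: "x ennpowr a = 0 \<longleftrightarrow> x = 0"
  by (cases x) auto

lemma ennpowr_eq_top_iff [simp]: "x ennpowr a = top \<longleftrightarrow> x = top"
  by (cases x) auto

lemma ennpowr_less_top_iff [simp]: "x ennpowr a < top \<longleftrightarrow> x < top"
  by (cases x) auto

text \<open>A sum is at most twice the maximum. This single argument covers exponents on both sides
  of 1.\<close>

lemma ennpowr_add_le:
  assumes "0 \<le> a"
  shows "(x + y) ennpowr a \<le> ennreal (2 powr a) * (x ennpowr a + y ennpowr a)"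
proof -
  have le: "u + v \<le> ennreal 2 * max u v" for u v :: ennreal
  proof -
    have "u + v \<le> max u v + max u v"
      by (intro add_mono) auto
    then show ?thesis
      by (simp add: mult_2)
  qed
  have "(x + y) ennpowr a \<le> (ennreal 2 * max x y) ennpowr a"
    by (intro ennpowr_mono le assms)
  also have "\<dots> = ennreal (2 powr a) * (max x y) ennpowr a"
    using ennpowr_ennreal[of 2 a] by (simp only: ennpowr_mult)
  also have "(max x y) ennpowr a \<le> x ennpowr a + y ennpowr a"
    by (auto simp: max_def)
  finally show ?thesis
    by (simp add: mult_left_mono)
qed

lemma borel_measurable_ennpowr [measurable]:
  assumes [measurable]: "f \<in> borel_measurable M"
  shows "(\<lambda>x. f x ennpowr a) \<in> borel_measurable M"
  unfolding ennpowr_def by measurable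

lemma Youngs_inequality_ennreal:
  assumes "1 < p" "1 < q" "1 / p + 1 / q = 1"
  shows "x * y \<le> ennreal (1 / p) * x ennpowr p + ennreal (1 / q) * y ennpowr q"
  using assms Youngs_inequality[OF assms, of "enn2real x" "enn2real y"]
  by (cases x; cases y)
    (auto simp: ennreal_mult_top ennreal_top_mult mult.commute field_simps
      simp flip: ennreal_mult ennreal_plus)

text \<open>One functional for three measures: the surface measure in the angle, the weighted
  half-line in the radius, and counting measure on the integers for the Herz sum. For p < 1, which
  occurs in the last case, it is only a quasi-norm.\<close>

definition lp_norm :: "'a measure \<Rightarrow> real \<Rightarrow> ('a \<Rightarrow> ennreal) \<Rightarrow> ennreal" where
  "lp_norm M p f = (\<integral>\<^sup>+x. f x ennpowr p \<partial>M) ennpowr (1 / p)"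

lemma lp_norm_ennpowr: "p \<noteq> 0 \<Longrightarrow> lp_norm M p f ennpowr p = (\<integral>\<^sup>+x. f x ennpowr p \<partial>M)"
  by (simp add: lp_norm_def ennpowr_ennpowr)

lemma lp_norm_mono_AE:
  assumes "0 < p" "AE x in M. f x \<le> g x"
  shows "lp_norm M p f \<le> lp_norm M p g"
  unfolding lp_norm_def using assms
  by (auto intro!: ennpowr_mono nn_integral_mono_AE elim!: eventually_mono)

lemma lp_norm_mono:
  assumes "0 < p" "\<And>x. x \<in> space M \<Longrightarrow> f x \<le> g x"
  shows "lp_norm M p f \<le> lp_norm M p g"
  using assms by (intro lp_norm_mono_AE AE_I2) auto

lemma lp_norm_cong_AE:
  assumes "AE x in M. f x = g x"
  shows "lp_norm M p f = lp_norm M p g"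
  unfolding lp_norm_def using assms
  by (auto intro!: arg_cong[of _ _ "\<lambda>t. t ennpowr (1/p)"] nn_integral_cong_AE elim!: eventually_mono)

lemma lp_norm_cong:
  assumes "\<And>x. x \<in> space M \<Longrightarrow> f x = g x"
  shows "lp_norm M p f = lp_norm M p g"
  using assms by (intro lp_norm_cong_AE AE_I2) auto

lemma lp_norm_cmult:
  assumes "p \<noteq> 0" "f \<in> borel_measurable M"
  shows "lp_norm M p (\<lambda>x. c * f x) = c * lp_norm M p f"
  using assms by (simp add: lp_norm_def ennpowr_mult nn_integral_cmult ennpowr_ennpowr)

lemma lp_norm_multc:
  assumes "p \<noteq> 0" "f \<in> borel_measurable M"
  shows "lp_norm M p (\<lambda>x. f x * c) = lp_norm M p f * c"
  using lp_norm_cmult[OF assms, of c] by (simp add: mult.commute)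

lemma lp_norm_indicator:
  assumes "A \<in> sets M"
  shows "lp_norm M p (indicator A) = emeasure M A ennpowr (1 / p)"
proof -
  have "(indicator A x :: ennreal) ennpowr p = indicator A x" for x
    by (simp add: indicator_def)
  then show ?thesis
    using assms by (simp add: lp_norm_def)
qed

text \<open>\<open>ennpowr_add_le\<close> is used twice: under the integral with exponent p, where
  the constant 2^p becomes 2 after taking the root, and outside with exponent 1 / p.\<close>

lemma lp_norm_add_le:
  assumes "0 < p" and [measurable]: "f \<in> borel_measurable M" "g \<in> borel_measurable M"
  shows "lp_norm M p (\<lambda>x. f x + g x)
    \<le> ennreal (2 powr (1 + 1 / p)) * (lp_norm M p f + lp_norm M p g)"
proof -
  have "(\<integral>\<^sup>+x. (f x + g x) ennpowr p \<partial>M)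
    \<le> (\<integral>\<^sup>+x. ennreal (2 powr p) * (f x ennpowr p + g x ennpowr p) \<partial>M)"
    using assms by (intro nn_integral_mono ennpowr_add_le) auto
  also have "\<dots> = ennreal (2 powr p) * ((\<integral>\<^sup>+x. f x ennpowr p \<partial>M) + (\<integral>\<^sup>+x. g x ennpowr p \<partial>M))"
    by (simp add: nn_integral_cmult nn_integral_add)
  finally have "lp_norm M p (\<lambda>x. f x + g x)
    \<le> (ennreal (2 powr p) * ((\<integral>\<^sup>+x. f x ennpowr p \<partial>M) + (\<integral>\<^sup>+x. g x ennpowr p \<partial>M))) ennpowr (1 / p)"
    unfolding lp_norm_def using assms by (intro ennpowr_mono) auto
  also have "\<dots> = ennreal 2 * ((\<integral>\<^sup>+x. f x ennpowr p \<partial>M) + (\<integral>\<^sup>+x. g x ennpowr p \<partial>M)) ennpowr (1 / p)"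
    using assms by (simp add: ennpowr_mult powr_powr)
  also have "\<dots> \<le> ennreal 2 * (ennreal (2 powr (1 / p)) * (lp_norm M p f + lp_norm M p g))"
    unfolding lp_norm_def using assms by (intro mult_left_mono ennpowr_add_le) auto
  also have "\<dots> = ennreal (2 powr (1 + 1 / p)) * (lp_norm M p f + lp_norm M p g)"
    by (simp add: powr_add ennreal_mult mult.assoc)
  finally show ?thesis .
qed

text \<open>The usual normalisation followed by Young's inequality works only if both norms are
  positive and finite. A vanishing norm has to be treated before an infinite one: it makes the
  product zero almost everywhere, even when the other norm is \<open>top\<close>.\<close>

theorem nn_integral_Holder:
  assumes pq: "1 < p" "1 < q" "1 / p + 1 / q = 1"
    and [measurable]: "f \<in> borel_measurable M" "g \<in> borel_measurable M"
  shows "(\<integral>\<^sup>+x. f x * g x \<partial>M) \<le> lp_norm M p f * lp_norm M q g"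
proof -
  have zero: "AE x in M. h x = 0" if "lp_norm M s h = 0" "h \<in> borel_measurable M" for s h
    using that by (simp add: lp_norm_def nn_integral_0_iff_AE)
  consider "lp_norm M p f = 0 \<or> lp_norm M q g = 0"
    | "lp_norm M p f * lp_norm M q g = top"
    | "lp_norm M p f \<noteq> 0" "lp_norm M q g \<noteq> 0" "lp_norm M p f \<noteq> top" "lp_norm M q g \<noteq> top"
    by (auto simp: ennreal_mult_eq_top_iff)
  then show ?thesis
  proof cases
    case 1
    then have "AE x in M. f x * g x = 0"
      using zero[of p f] zero[of q g] by (auto elim!: eventually_mono)
    then have "(\<integral>\<^sup>+x. f x * g x \<partial>M) = 0"
      by (subst nn_integral_0_iff_AE) auto
    then show ?thesis by simp
  next
    case 2
    then show ?thesis by simp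
  next
    case 3
    define a b where "a = enn2real (lp_norm M p f)" and "b = enn2real (lp_norm M q g)"
    have a: "lp_norm M p f = ennreal a" "0 < a" and b: "lp_norm M q g = ennreal b" "0 < b"
      using 3 unfolding a_def b_def by (auto simp: enn2real_positive_iff less_top zero_less_iff_neq_zero)
    have young: "f x * g x \<le> ennreal (a * b) *
        (ennreal (1 / p) * (ennreal (1 / a powr p) * f x ennpowr p)
          + ennreal (1 / q) * (ennreal (1 / b powr q) * g x ennpowr q))" for x
    proof -
      have "f x * g x = ennreal (a * b) * ((ennreal (1 / a) * f x) * (ennreal (1 / b) * g x))"
      proof -
        have "ennreal (a * b) * (ennreal (1 / a) * ennreal (1 / b)) = 1"
          using a b by (simp flip: ennreal_mult ennreal_1)
        then show ?thesis
          by (metis (no_types, lifting) mult.assoc mult.left_commute mult_1)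
      qed
      also have "\<dots> \<le> ennreal (a * b) * (ennreal (1 / p) * (ennreal (1 / a) * f x) ennpowr p
          + ennreal (1 / q) * (ennreal (1 / b) * g x) ennpowr q)"
        by (intro mult_left_mono Youngs_inequality_ennreal pq) auto
      also have "\<dots> = ennreal (a * b) *
        (ennreal (1 / p) * (ennreal (1 / a powr p) * f x ennpowr p)
          + ennreal (1 / q) * (ennreal (1 / b powr q) * g x ennpowr q))"
        using a b by (simp add: ennpowr_mult powr_divide)
      finally show ?thesis .
    qed
    have 1: "(\<integral>\<^sup>+x. f x ennpowr p \<partial>M) = ennreal (a powr p)"
      using lp_norm_ennpowr[of p M f] pq a by simp
    have 2: "(\<integral>\<^sup>+x. g x ennpowr q \<partial>M) = ennreal (b powr q)"
      using lp_norm_ennpowr[of q M g] pq b by simp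
    have "(\<integral>\<^sup>+x. f x * g x \<partial>M) \<le> (\<integral>\<^sup>+x. ennreal (a * b) *
        (ennreal (1 / p) * (ennreal (1 / a powr p) * f x ennpowr p)
          + ennreal (1 / q) * (ennreal (1 / b powr q) * g x ennpowr q)) \<partial>M)"
      by (intro nn_integral_mono young)
    also have "\<dots> = ennreal (a * b) * (ennreal (1 / p) * (ennreal (1 / a powr p) * ennreal (a powr p))
          + ennreal (1 / q) * (ennreal (1 / b powr q) * ennreal (b powr q)))"
      by (simp add: nn_integral_cmult nn_integral_add 1 2)
    also have "\<dots> = ennreal (a * b) * (ennreal (1 / p + 1 / q))"
      using a b pq by (simp flip: ennreal_mult ennreal_plus)
    also have "\<dots> = lp_norm M p f * lp_norm M q g"
      using a b by (simp add: pq ennreal_mult)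
    finally show ?thesis .
  qed
qed

text \<open>Hoelder's inequality for the powers f^r and g^r; the exponents p / r and q / r are
  conjugate because 1 / r = 1 / p + 1 / q.\<close>

lemma lp_norm_Holder:
  assumes r: "0 < r" and pq: "0 < p" "0 < q" "1 / r = 1 / p + 1 / q"
    and [measurable]: "f \<in> borel_measurable M" "g \<in> borel_measurable M"
  shows "lp_norm M r (\<lambda>x. f x * g x) \<le> lp_norm M p f * lp_norm M q g"
proof -
  have "1 / p < 1 / r" "1 / q < 1 / r"
    using pq by auto
  then have *: "1 < p / r" "1 < q / r"
    using r pq(1,2) by (simp_all add: field_simps)
  have "1 / (p / r) + 1 / (q / r) = r * (1 / p + 1 / q)"
    by (simp add: algebra_simps)
  also have "\<dots> = 1"
    using r pq by (metis nonzero_mult_div_cancel_left less_irrefl times_divide_eq_right mult_1_right)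
  finally have **: "1 / (p / r) + 1 / (q / r) = 1" .
  have lp: "lp_norm M (s / r) (\<lambda>x. h x ennpowr r) = lp_norm M s h ennpowr r" for s h
    using r by (simp add: lp_norm_def ennpowr_ennpowr)
  have "(\<integral>\<^sup>+x. (f x * g x) ennpowr r \<partial>M) \<le> lp_norm M p f ennpowr r * lp_norm M q g ennpowr r"
    using nn_integral_Holder[OF * **, of "\<lambda>x. f x ennpowr r" M "\<lambda>x. g x ennpowr r"]
    by (simp add: ennpowr_mult lp)
  then have "lp_norm M r (\<lambda>x. f x * g x) \<le> (lp_norm M p f ennpowr r * lp_norm M q g ennpowr r) ennpowr (1 / r)"
    unfolding lp_norm_def[of M r] using r by (intro ennpowr_mono) auto
  also have "\<dots> = lp_norm M p f * lp_norm M q g"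
    using r by (simp add: ennpowr_mult ennpowr_ennpowr)
  finally show ?thesis .
qed

text \<open>Hoelder against the indicator of \<open>A\<close>, with 1 / m = 1 / e - 1 / s. The case
  e = s stands apart because 1 / m would vanish.\<close>

lemma lp_norm_le_exponent:
  assumes e: "0 < e" "e \<le> s" and [measurable]: "f \<in> borel_measurable M" and A[measurable]: "A \<in> sets M"
    and supp: "\<And>x. x \<in> space M \<Longrightarrow> x \<notin> A \<Longrightarrow> f x = 0"
    and V: "emeasure M A \<le> ennreal V" "0 < V"
  shows "lp_norm M e f \<le> ennreal (V powr (1 / e - 1 / s)) * lp_norm M s f"
proof (cases "e = s")
  case True
  then show ?thesis using V by simp
next
  case False
  define m where "m = 1 / (1 / e - 1 / s)"
  have "1 / s < 1 / e" using e False by (simp add: field_simps)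
  then have m: "0 < m" "1 / e = 1 / s + 1 / m" "1 / m = 1 / e - 1 / s"
    by (auto simp: m_def)
  have "lp_norm M e f = lp_norm M e (\<lambda>x. f x * indicator A x)"
    using supp by (intro lp_norm_cong) (auto simp: indicator_def)
  also have "\<dots> \<le> lp_norm M s f * lp_norm M m (indicator A)"
    using e m by (intro lp_norm_Holder) auto
  also have "lp_norm M m (indicator A) \<le> ennreal (V powr (1 / m))"
  proof -
    have "emeasure M A ennpowr (1 / m) \<le> ennreal V ennpowr (1 / m)"
      using V(1) m(1) by (intro ennpowr_mono) auto
    then show ?thesis
      using V(2) by (simp only: lp_norm_indicator[OF A] ennpowr_ennreal less_imp_le)
  qed
  finally show ?thesis
    by (metis (no_types, lifting) m(3) mult.commute mult_right_mono zero_le)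
qed

section \<open>Polar coordinates\<close>

text \<open>Absorbing the Jacobian of polar coordinates into the measure makes the mixed norm a pair
  of nested \<open>lp_norm\<close>s. Nonpositive radii get measure zero, so facts about radii are
  used as almost-everywhere facts.\<close>

definition radial_measure :: "nat \<Rightarrow> real measure" where
  "radial_measure n = density lborel (\<lambda>\<rho>. ennreal (\<rho> ^ (n - 1)) * indicator {0<..} \<rho>)"

lemma sets_radial_measure [simp, measurable_cong]: "sets (radial_measure n) = sets borel"
  by (simp add: radial_measure_def)

lemma space_radial_measure [simp]: "space (radial_measure n) = UNIV"
  by (simp add: radial_measure_def)

lemma nn_integral_radial_measure:
  "f \<in> borel_measurable borel \<Longrightarrow> (\<integral>\<^sup>+\<rho>. f \<rho> \<partial>radial_measure n)
    = (\<integral>\<^sup>+\<rho>\<in>{0<..}. f \<rho> * ennreal (\<rho> ^ (n - 1)) \<partial>lborel)"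
  by (simp add: radial_measure_def nn_integral_density mult_ac)

lemma AE_radial_measure:
  "(AE \<rho> in radial_measure n. P \<rho>) \<longleftrightarrow> (AE \<rho> in lborel. 0 < \<rho> \<longrightarrow> P \<rho>)"
  unfolding radial_measure_def
  by (subst AE_density) (auto intro!: AE_cong simp: indicator_def zero_less_mult_iff)

lemma AE_radial_measure_pos: "AE \<rho> in radial_measure n. 0 < \<rho>"
  by (simp add: AE_radial_measure)

lemma emeasure_radial_measure_atMost:
  assumes "0 < n" "0 \<le> a"
  shows "emeasure (radial_measure n) {..a} = ennreal (a ^ n / real n)"
proof -
  have "emeasure (radial_measure n) {..a}
    = (\<integral>\<^sup>+\<rho>. ennreal (\<rho> ^ (n - 1)) * indicator {0<..} \<rho> * indicator {..a} \<rho> \<partial>lborel)"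
    by (simp add: radial_measure_def emeasure_density)
  also have "\<dots> = (\<integral>\<^sup>+\<rho>. ennreal (\<rho> ^ (n - 1)) * indicator {0..a} \<rho> \<partial>lborel)"
    using AE_lborel_singleton[of 0]
    by (intro nn_integral_cong_AE) (auto elim!: eventually_mono simp: indicator_def)
  also have "\<dots> = ennreal (a ^ n / n - 0 ^ n / n)"
  proof (intro nn_integral_FTC_Icc)
    show "((\<lambda>x. x ^ n / real n) has_real_derivative x ^ (n - 1)) (at x)" for x
      using assms by (auto intro!: derivative_eq_intros)
  qed (use assms in auto)
  finally show ?thesis using assms by (simp add: zero_power)
qed

lemma emeasure_radial_measure_atMost_neg:
  assumes "a \<le> 0" shows "emeasure (radial_measure n) {..a} = 0"
proof -
  have "AE \<rho> in radial_measure n. \<rho> \<notin> {..a}"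
    using AE_radial_measure_pos[of n] assms by (auto elim!: eventually_mono)
  then have "emeasure (radial_measure n) {..a} = emeasure (radial_measure n) {}"
    by (intro emeasure_eq_AE) auto
  then show ?thesis by simp
qed

lemma sigma_finite_radial_measure:
  assumes "0 < n" shows "sigma_finite_measure (radial_measure n)"
proof
  show "\<exists>A. countable A \<and> A \<subseteq> sets (radial_measure n) \<and> \<Union>A = space (radial_measure n) \<and>
    (\<forall>a\<in>A. emeasure (radial_measure n) a \<noteq> \<infinity>)"
  proof (intro exI[of _ "range (\<lambda>i::nat. {..real i})"] conjI ballI)
    show "\<Union> (range (\<lambda>i::nat. {..real i})) = space (radial_measure n)"
      using real_arch_simple by auto
  qed (use assms in \<open>auto simp: emeasure_radial_measure_atMost\<close>)
qed

section \<open>Surface measure and integration in polar coordinates\<close>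

lemma sets_surface_measure [simp, measurable_cong]:
  "sets (surface_measure :: 'a::euclidean_space measure) = sets (restrict_space borel (sphere 0 1))"
  by (simp add: surface_measure_def)

lemma space_surface_measure [simp]: "space (surface_measure :: 'a::euclidean_space measure) = sphere 0 1"
  using sets_eq_imp_space_eq[OF sets_surface_measure] by (simp add: space_restrict_space)

lemma measurable_direction:
  "(\<lambda>x. x /\<^sub>R norm x) \<in> restrict_space (borel :: 'a::euclidean_space measure) (- {0}) \<rightarrow>\<^sub>M restrict_space borel (sphere 0 1)"
  by (rule measurable_restrict_space2) (auto simp: space_restrict_space intro!: measurable_restrict_space1)

lemma sets_cone:
  assumes "B \<in> sets (restrict_space (borel :: 'a::euclidean_space measure) (sphere 0 1))"
  shows "{x. x \<noteq> 0 \<and> x /\<^sub>R norm x \<in> B} \<in> sets borel"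
proof -
  have "(\<lambda>x. x /\<^sub>R norm x) -` B \<inter> space (restrict_space borel (- {0})) \<in> sets (restrict_space borel (- {0}))"
    using measurable_direction assms by (rule measurable_sets)
  then have "(\<lambda>x. x /\<^sub>R norm x) -` B \<inter> (- {0}) \<in> sets borel"
    by (simp add: space_restrict_space sets_restrict_space_iff)
  also have "(\<lambda>x. x /\<^sub>R norm x) -` B \<inter> (- {0}) = {x. x \<noteq> 0 \<and> x /\<^sub>R norm x \<in> B}"
    by auto
  finally show ?thesis .
qed

lemma emeasure_surface_measure:
  assumes B: "B \<in> sets (restrict_space (borel :: 'a::euclidean_space measure) (sphere 0 1))"
  shows "emeasure surface_measure B
    = of_nat DIM('a) * emeasure lborel {x. x \<noteq> 0 \<and> norm x < 1 \<and> x /\<^sub>R norm x \<in> B}"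
proof -
  have m: "(\<lambda>x. x /\<^sub>R norm x) \<in> restrict_space lborel (ball 0 1 - {0}) \<rightarrow>\<^sub>M restrict_space (borel :: 'a measure) (sphere 0 1)"
    by (rule measurable_restrict_space2) (auto simp: space_restrict_space intro!: measurable_restrict_space1)
  have "(\<lambda>x. x /\<^sub>R norm x) -` B \<inter> (ball 0 1 - {0}) = {x. x \<noteq> 0 \<and> norm x < 1 \<and> x /\<^sub>R norm x \<in> B}"
    by auto
  moreover have "emeasure (restrict_space lborel (ball 0 1 - {0})) {x. x \<noteq> 0 \<and> norm x < 1 \<and> x /\<^sub>R norm x \<in> B}
    = emeasure lborel {x. x \<noteq> 0 \<and> norm x < 1 \<and> x /\<^sub>R norm x \<in> B}"
    by (rule emeasure_restrict_space) auto
  ultimately show ?thesis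
    using B m by (simp add: surface_measure_def emeasure_distr space_restrict_space)
qed

lemma emeasure_lborel_dilation:
  fixes S :: "'a::euclidean_space set"
  assumes "0 < a" "S \<in> sets borel"
  shows "emeasure lborel S = ennreal (a ^ DIM('a)) * emeasure lborel {x. a *\<^sub>R x \<in> S}"
proof -
  have "emeasure lborel S = emeasure (density (distr lborel borel (\<lambda>x. 0 + a *\<^sub>R x)) (\<lambda>_. ennreal (\<bar>a\<bar> ^ DIM('a)))) S"
    using assms by (subst lborel_affine[of a 0]) simp_all
  also have "\<dots> = ennreal (a ^ DIM('a)) * emeasure (distr lborel borel (\<lambda>x. a *\<^sub>R x)) S"
    using assms by (simp add: emeasure_density nn_integral_cmult_indicator)
  also have "emeasure (distr lborel borel (\<lambda>x. a *\<^sub>R x)) S = emeasure lborel {x. a *\<^sub>R x \<in> S}"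
    using assms by (subst emeasure_distr) (auto simp: vimage_def)
  finally show ?thesis .
qed

lemma emeasure_cone_cball:
  fixes B :: "'a::euclidean_space set"
  assumes B: "B \<in> sets (restrict_space borel (sphere 0 1))" and a: "0 < a"
  shows "emeasure lborel {x. x \<noteq> 0 \<and> norm x \<le> a \<and> x /\<^sub>R norm x \<in> B}
    = emeasure (radial_measure DIM('a)) {..a} * emeasure surface_measure B"
proof -
  let ?C = "{x. x \<noteq> 0 \<and> x /\<^sub>R norm x \<in> B}"
  have [measurable]: "?C \<in> sets borel" by (rule sets_cone[OF B])
  have eq: "{x. x \<noteq> 0 \<and> P x \<and> x /\<^sub>R norm x \<in> B} = ?C \<inter> {x. P x}" for P by auto
  have "emeasure lborel (?C \<inter> {x. norm x \<le> a})
    = ennreal (a ^ DIM('a)) * emeasure lborel {x. a *\<^sub>R x \<in> ?C \<inter> {x. norm x \<le> a}}"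
    using a by (intro emeasure_lborel_dilation) auto
  also have "{x. a *\<^sub>R x \<in> ?C \<inter> {x. norm x \<le> a}} = ?C \<inter> {x. norm x \<le> 1}"
    using a by (auto simp: field_simps)
  \<comment> \<open>The surface measure is defined through the open unit ball, while the generator
    \<open>{..a}\<close> used later leads to closed balls; the difference lies in the unit sphere, a
    null set.\<close>
  also have "emeasure lborel (?C \<inter> {x. norm x \<le> 1}) = emeasure lborel (?C \<inter> {x. norm x < 1})"
  proof (rule emeasure_eq_AE)
    have "sphere (0::'a) 1 \<in> null_sets lebesgue"
      using negligible_sphere[of "0::'a" 1] by (simp add: negligible_iff_null_sets)
    then have "sphere (0::'a) 1 \<in> null_sets lborel"
      by (auto simp: null_sets_def)
    then show "AE x in lborel. (x \<in> ?C \<inter> {x. norm x \<le> 1}) = (x \<in> ?C \<inter> {x. norm x < 1})"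
      by (rule AE_I') auto
  qed auto
  finally have *: "emeasure lborel (?C \<inter> {x. norm x \<le> a})
    = ennreal (a ^ DIM('a)) * emeasure lborel (?C \<inter> {x. norm x < 1})" .
  have "ennreal (a ^ DIM('a)) = ennreal (a ^ DIM('a) / DIM('a)) * of_nat DIM('a)"
    unfolding ennreal_of_nat_eq_real_of_nat using a by (simp flip: ennreal_mult)
  then show ?thesis
    using a * by (simp add: eq emeasure_surface_measure[OF B] emeasure_radial_measure_atMost mult.assoc)
qed

lemma emeasure_surface_measure_space:
  "emeasure (surface_measure :: 'a::euclidean_space measure) (sphere 0 1)
    = ennreal (DIM('a) * unit_ball_vol DIM('a))"
proof -
  have "emeasure (surface_measure :: 'a measure) (sphere 0 1)
    = of_nat DIM('a) * emeasure lborel {x::'a. x \<noteq> 0 \<and> norm x < 1}"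
    by (subst emeasure_surface_measure)
      (auto simp: sets_restrict_space intro!: arg_cong[of _ _ "\<lambda>S. _ * emeasure lborel S"])
  also have "emeasure lborel {x::'a. x \<noteq> 0 \<and> norm x < 1} = emeasure lborel (ball (0::'a) 1)"
    using AE_lborel_singleton[of "0::'a"]
    by (intro emeasure_eq_AE) (auto elim!: eventually_mono)
  finally show ?thesis
    by (simp add: emeasure_ball ennreal_mult ennreal_of_nat_eq_real_of_nat)
qed

lemma emeasure_surface_measure_pos:
  "0 < emeasure (surface_measure :: 'a::euclidean_space measure) (sphere 0 1)"
  by (simp add: emeasure_surface_measure_space)

lemma finite_measure_surface_measure: "finite_measure (surface_measure :: 'a::euclidean_space measure)"
  by (rule finite_measureI) (simp add: emeasure_surface_measure_space)

interpretation surface: finite_measure "surface_measure :: 'a::euclidean_space measure"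
  by (rule finite_measure_surface_measure)

text \<open>Both factors are sigma-finite, so agreement on rectangles A x B suffices. The origin,
  which has no direction, is removed on the right.\<close>

lemma pair_radial_surface_measure:
  "radial_measure DIM('a) \<Otimes>\<^sub>M (surface_measure :: 'a::euclidean_space measure)
    = distr (restrict_space lborel (- {0})) (borel \<Otimes>\<^sub>M restrict_space borel (sphere 0 1))
        (\<lambda>x. (norm x, x /\<^sub>R norm x))" (is "?L = ?R")
proof (rule pair_measure_eqI)
  show "sigma_finite_measure (radial_measure DIM('a))"
    by (intro sigma_finite_radial_measure) simp
  show "sigma_finite_measure (surface_measure :: 'a measure)" ..
  show "sets ?L = sets ?R"
    by (simp cong: sets_pair_measure_cong)
  fix A and B :: "'a set"
  assume "A \<in> sets (radial_measure DIM('a))" and "B \<in> sets (surface_measure :: 'a measure)"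
  then have A[measurable]: "A \<in> sets borel" and B: "B \<in> sets (restrict_space borel (sphere 0 1))"
    by auto
  let ?C = "{x. x \<noteq> 0 \<and> x /\<^sub>R norm x \<in> B}"
  have [measurable]: "?C \<in> sets borel" by (rule sets_cone[OF B])
  have m: "(\<lambda>x. (norm x, x /\<^sub>R norm x)) \<in> restrict_space lborel (- {0})
      \<rightarrow>\<^sub>M borel \<Otimes>\<^sub>M restrict_space (borel :: 'a measure) (sphere 0 1)"
    using measurable_direction
    by (intro measurable_Pair) (auto intro!: measurable_restrict_space1 simp: measurable_def space_restrict_space sets_restrict_space)
  \<comment> \<open>With B fixed, both sides are measures in the radial set A, and it is enough to
    compare them on the half-lines \<open>{..a}\<close>. There the claim is the volume of the
    truncated cone over B, given by \<open>emeasure_cone_cball\<close>.\<close>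
  have "distr (restrict_space lborel ?C) borel norm
    = scale_measure (emeasure surface_measure B) (radial_measure DIM('a))" (is "?D = ?S")
  proof (rule measure_eqI_generator_eq[where E="range atMost" and A="\<lambda>i::nat. {..real i}"])
    show "Int_stable (range (atMost :: real \<Rightarrow> real set))"
      by (auto simp: Int_stable_def)
    show "sets ?D = sigma_sets UNIV (range atMost)" "sets ?S = sigma_sets UNIV (range atMost)"
      by (simp_all add: borel_eq_atMost)
    have emD: "emeasure ?D X = emeasure lborel (?C \<inter> {x. norm x \<in> X})" if "X \<in> sets borel" for X
      using that by (subst emeasure_distr)
        (auto simp: space_restrict_space emeasure_restrict_space measurable_restrict_space1
          intro!: arg_cong[of _ _ "emeasure lborel"])
    show "emeasure ?D X = emeasure ?S X" if "X \<in> range atMost" for X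
    proof -
      from that obtain a where X: "X = {..a}" by auto
      show ?thesis
      proof (cases "0 < a")
        case True
        have "?C \<inter> {x. norm x \<in> X} = {x. x \<noteq> 0 \<and> norm x \<le> a \<and> x /\<^sub>R norm x \<in> B}"
          by (auto simp: X)
        then show ?thesis
          using emeasure_cone_cball[OF B True] by (simp add: emD X mult.commute)
      next
        case False
        then have "?C \<inter> {x. norm x \<in> X} = {}"
          using norm_ge_zero[where 'a='a] by (fastforce simp: X dest: order_trans[of "norm _" a 0])
        with False show ?thesis
          by (simp only: emD X) (simp add: X emeasure_radial_measure_atMost_neg emD)
      qed
    qed
    show "\<And>i. emeasure ?D {..real i} \<noteq> \<infinity>"
    proof -
      fix i :: nat
      have "emeasure ?D {..real i} \<le> emeasure lborel (cball (0::'a) i)"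
        by (subst emD) (auto intro!: emeasure_mono)
      also have "\<dots> < \<infinity>"
        using emeasure_lborel_cball_finite by blast
      finally show "emeasure ?D {..real i} \<noteq> \<infinity>" by simp
    qed
    show "(\<Union>i. {..real i}) = UNIV"
      using real_arch_simple by auto
  qed auto
  then have "emeasure ?D A = emeasure ?S A" by simp
  moreover have "emeasure ?D A = emeasure ?R (A \<times> B)"
  proof -
    have "emeasure ?R (A \<times> B) = emeasure lborel ((\<lambda>x. (norm x, x /\<^sub>R norm x)) -` (A \<times> B) \<inter> - {0})"
      using B by (subst emeasure_distr[OF m]) (auto simp: space_restrict_space emeasure_restrict_space intro!: pair_measureI)
    also have "(\<lambda>x. (norm x, x /\<^sub>R norm x)) -` (A \<times> B) \<inter> - {0} = ?C \<inter> {x. norm x \<in> A}"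
      by auto
    also have "emeasure lborel \<dots> = emeasure ?D A"
      by (subst emeasure_distr)
        (auto simp: space_restrict_space emeasure_restrict_space measurable_restrict_space1
          intro!: arg_cong[of _ _ "emeasure lborel"])
    finally show ?thesis by simp
  qed
  ultimately show "emeasure (radial_measure DIM('a)) A * emeasure surface_measure B = emeasure ?R (A \<times> B)"
    by (simp add: mult.commute)
qed

lemma measurable_scaleR_sphere [measurable]:
  "(\<lambda>(\<rho>, \<theta>). \<rho> *\<^sub>R \<theta>) \<in> borel \<Otimes>\<^sub>M restrict_space (borel :: 'a::euclidean_space measure) (sphere 0 1) \<rightarrow>\<^sub>M borel"
proof -
  have [measurable]: "(\<lambda>x. snd x) \<in> borel \<Otimes>\<^sub>M restrict_space (borel :: 'a measure) (sphere 0 1) \<rightarrow>\<^sub>M borel"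
    by (rule measurable_compose[OF measurable_snd measurable_restrict_space1]) auto
  show ?thesis by measurable
qed

theorem nn_integral_polar:
  fixes f :: "'a::euclidean_space \<Rightarrow> ennreal"
  assumes [measurable]: "f \<in> borel_measurable borel"
  shows "(\<integral>\<^sup>+x. f x \<partial>lborel)
    = (\<integral>\<^sup>+\<rho>. (\<integral>\<^sup>+\<theta>. f (\<rho> *\<^sub>R \<theta>) \<partial>surface_measure) \<partial>radial_measure DIM('a))"
proof -
  have m: "(\<lambda>x. (norm x, x /\<^sub>R norm x)) \<in> restrict_space lborel (- {0})
      \<rightarrow>\<^sub>M borel \<Otimes>\<^sub>M restrict_space (borel :: 'a measure) (sphere 0 1)"
    using measurable_direction
    by (intro measurable_Pair) (auto intro!: measurable_restrict_space1 simp: measurable_def space_restrict_space sets_restrict_space)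
  have "(\<integral>\<^sup>+\<rho>. (\<integral>\<^sup>+\<theta>. f (\<rho> *\<^sub>R \<theta>) \<partial>surface_measure) \<partial>radial_measure DIM('a))
    = (\<integral>\<^sup>+(\<rho>, \<theta>). f (\<rho> *\<^sub>R \<theta>) \<partial>(radial_measure DIM('a) \<Otimes>\<^sub>M surface_measure))"
    by (subst surface.nn_integral_fst[symmetric]) auto
  also have "\<dots> = (\<integral>\<^sup>+x. f (norm x *\<^sub>R (x /\<^sub>R norm x)) \<partial>restrict_space lborel (- {0}))"
    unfolding pair_radial_surface_measure by (subst nn_integral_distr[OF m]) auto
  also have "\<dots> = (\<integral>\<^sup>+x. f x * indicator (- {0}) x \<partial>lborel)"
    by (subst nn_integral_restrict_space) (auto intro!: nn_integral_cong simp: indicator_def)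
  also have "\<dots> = (\<integral>\<^sup>+x. f x \<partial>lborel)"
    using AE_lborel_singleton[of "0::'a"]
    by (intro nn_integral_cong_AE) (auto elim!: eventually_mono)
  finally show ?thesis ..
qed

text \<open>A Borel null set covering the exceptions has volume zero; computed in polar coordinates,
  this says that almost every one of its spherical slices is null. Every passage from a Lebesgue
  measurable function to a Borel version inside a mixed norm rests on this.\<close>

lemma AE_polar:
  fixes P :: "'a::euclidean_space \<Rightarrow> bool"
  assumes "AE x in lborel. P x"
  shows "AE \<rho> in radial_measure DIM('a). AE \<theta> in surface_measure. P (\<rho> *\<^sub>R \<theta>)"
proof -
  obtain N where N: "{x. \<not> P x} \<subseteq> N" "emeasure lborel N = 0" "N \<in> sets borel"
    using assms by (auto elim!: AE_E)
  have [measurable]: "N \<in> sets borel" by fact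
  have "0 = (\<integral>\<^sup>+x. indicator N x \<partial>(lborel :: 'a measure))"
    using N by simp
  also have "\<dots> = (\<integral>\<^sup>+\<rho>. (\<integral>\<^sup>+\<theta>. indicator N (\<rho> *\<^sub>R \<theta>) \<partial>surface_measure) \<partial>radial_measure DIM('a))"
    by (rule nn_integral_polar) auto
  finally have "AE \<rho> in radial_measure DIM('a). (\<integral>\<^sup>+\<theta>. indicator N (\<rho> *\<^sub>R \<theta>) \<partial>(surface_measure :: 'a measure)) = 0"
    by (subst (asm) eq_commute, subst (asm) nn_integral_0_iff_AE) auto
  then show ?thesis
  proof eventually_elim
    case (elim \<rho>)
    then have "AE \<theta> in surface_measure. indicator N (\<rho> *\<^sub>R \<theta>) = (0::ennreal)"
      by (subst (asm) nn_integral_0_iff_AE) auto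
    then show ?case
      using N(1) by (auto elim!: eventually_mono simp: indicator_eq_0_iff)
  qed
qed

section \<open>Mixed radial-angular norms\<close>

definition ang_norm :: "real \<Rightarrow> ('a::euclidean_space \<Rightarrow> ennreal) \<Rightarrow> real \<Rightarrow> ennreal" where
  "ang_norm pt F \<rho> = lp_norm surface_measure pt (\<lambda>\<theta>. F (\<rho> *\<^sub>R \<theta>))"

text \<open>Counterpart of \<open>mixed_norm\<close> for functions with values in
  [0, \<open>top\<close>]. The nested form allows each fact on \<open>lp_norm\<close> to be used
  once in the angle and once in the radius; \<open>mixed_norm_eq\<close> links the two for Borel
  functions.\<close>

definition mixed_lp :: "real \<Rightarrow> real \<Rightarrow> ('a::euclidean_space \<Rightarrow> ennreal) \<Rightarrow> ennreal" where
  "mixed_lp p pt F = lp_norm (radial_measure DIM('a)) p (ang_norm pt F)"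

lemma measurable_sphere_section [measurable]:
  fixes F :: "'a::euclidean_space \<Rightarrow> 'b::topological_space"
  assumes "F \<in> borel_measurable borel"
  shows "(\<lambda>\<theta>. F (\<rho> *\<^sub>R \<theta>)) \<in> borel_measurable (surface_measure :: 'a measure)"
proof -
  have "(\<lambda>\<theta>. F (\<rho> *\<^sub>R \<theta>)) \<in> borel_measurable (restrict_space borel (sphere 0 1))"
    by (intro measurable_restrict_space1 measurable_compose[OF _ assms]) measurable
  then show ?thesis
    by (simp only: measurable_cong_sets[OF sets_surface_measure refl])
qed

lemma borel_measurable_ang_norm [measurable]:
  fixes F :: "'a::euclidean_space \<Rightarrow> ennreal"
  assumes [measurable]: "F \<in> borel_measurable borel"
  shows "ang_norm pt F \<in> borel_measurable borel"
proof -
  have "(\<lambda>(\<rho>, \<theta>). F (\<rho> *\<^sub>R \<theta>)) \<in> borel_measurable (borel \<Otimes>\<^sub>M (surface_measure :: 'a measure))"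
    using measurable_compose[OF measurable_scaleR_sphere assms] by (simp add: split_beta' cong: measurable_cong_sets sets_pair_measure_cong)
  then have "(\<lambda>(\<rho>, \<theta>). F (\<rho> *\<^sub>R \<theta>) ennpowr pt) \<in> borel_measurable (borel \<Otimes>\<^sub>M (surface_measure :: 'a measure))"
    by (simp add: split_beta')
  then show ?thesis
    unfolding ang_norm_def lp_norm_def by measurable
qed

lemma mixed_norm_eq:
  fixes f :: "'a::euclidean_space \<Rightarrow> complex"
  assumes [measurable]: "f \<in> borel_measurable borel"
  shows "mixed_norm p pt f = mixed_lp p pt (\<lambda>x. ennreal (norm (f x)))"
proof -
  have *: "ang_norm pt (\<lambda>x. ennreal (norm (f x))) \<rho> ennpowr p
    = (\<integral>\<^sup>+\<theta>. ennreal (norm (f (\<rho> *\<^sub>R \<theta>)) powr pt) \<partial>surface_measure) ennpowr (p / pt)" for \<rho>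
    by (simp add: ang_norm_def lp_norm_def ennpowr_ennpowr)
  have [measurable]: "(\<lambda>\<rho>. ang_norm pt (\<lambda>x. ennreal (norm (f x))) \<rho> ennpowr p) \<in> borel_measurable borel"
    by measurable
  show ?thesis
    unfolding mixed_norm_def mixed_lp_def lp_norm_def[of "radial_measure _"]
    by (subst nn_integral_radial_measure) (auto simp: * mult_ac)
qed

text \<open>By \<open>AE_polar\<close> almost every pair of slices agrees almost everywhere on the
  sphere, and nested integrals see no more than that. Thus a mixed norm of a Lebesgue measurable
  function is that of its Borel version.\<close>

lemma mixed_norm_cong_AE:
  fixes f :: "'a::euclidean_space \<Rightarrow> complex"
  assumes "AE x in lborel. norm (f x) = norm (g x)"
  shows "mixed_norm p pt f = mixed_norm p pt g"
proof -
  have "AE \<rho> in lborel. 0 < \<rho> \<longrightarrow> (AE \<theta> in surface_measure. norm (f (\<rho> *\<^sub>R \<theta>)) = norm (g (\<rho> *\<^sub>R \<theta>)))"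
    using AE_polar[OF assms] by (simp add: AE_radial_measure)
  then show ?thesis
    unfolding mixed_norm_def
    by (intro arg_cong[of _ _ "\<lambda>t. t ennpowr (1/p)"] nn_integral_cong_AE)
      (auto elim!: eventually_mono simp: indicator_def intro!: arg_cong[of _ _ "\<lambda>t. t ennpowr (p/pt) * _"] nn_integral_cong_AE)
qed

lemma mixed_lp_mono_AE:
  fixes F :: "'a::euclidean_space \<Rightarrow> ennreal"
  assumes "0 < p" "0 < pt" "AE x in lborel. F x \<le> G x"
  shows "mixed_lp p pt F \<le> mixed_lp p pt G"
  unfolding mixed_lp_def
proof (rule lp_norm_mono_AE)
  show "AE \<rho> in radial_measure DIM('a). ang_norm pt F \<rho> \<le> ang_norm pt G \<rho>"
    using AE_polar[OF assms(3)]
    by eventually_elim (auto simp: ang_norm_def intro!: lp_norm_mono_AE assms(2))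
qed (use assms in auto)

lemma mixed_lp_mono:
  assumes "0 < p" "0 < pt" "\<And>x. F x \<le> G x"
  shows "mixed_lp p pt F \<le> mixed_lp p pt G"
  using assms by (intro mixed_lp_mono_AE) auto

lemma mixed_lp_cmult:
  fixes F :: "'a::euclidean_space \<Rightarrow> ennreal"
  assumes "p \<noteq> 0" "pt \<noteq> 0" and [measurable]: "F \<in> borel_measurable borel"
  shows "mixed_lp p pt (\<lambda>x. c * F x) = c * mixed_lp p pt F"
proof -
  have "ang_norm pt (\<lambda>x. c * F x) = (\<lambda>\<rho>. c * ang_norm pt F \<rho>)"
    unfolding ang_norm_def using assms by (intro ext lp_norm_cmult) auto
  then show ?thesis
    unfolding mixed_lp_def using assms by (simp add: lp_norm_cmult)
qed

lemma mixed_lp_add_le: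
  fixes F G :: "'a::euclidean_space \<Rightarrow> ennreal"
  assumes p: "0 < p" "0 < pt" and [measurable]: "F \<in> borel_measurable borel" "G \<in> borel_measurable borel"
  shows "mixed_lp p pt (\<lambda>x. F x + G x)
    \<le> ennreal (2 powr (1 + 1 / p) * 2 powr (1 + 1 / pt)) * (mixed_lp p pt F + mixed_lp p pt G)"
proof -
  have "ang_norm pt (\<lambda>x. F x + G x) \<rho> \<le> ennreal (2 powr (1 + 1 / pt)) * (ang_norm pt F \<rho> + ang_norm pt G \<rho>)" for \<rho>
    unfolding ang_norm_def using p by (intro lp_norm_add_le) auto
  then have "mixed_lp p pt (\<lambda>x. F x + G x)
      \<le> lp_norm (radial_measure DIM('a)) p (\<lambda>\<rho>. ennreal (2 powr (1 + 1 / pt)) * (ang_norm pt F \<rho> + ang_norm pt G \<rho>))"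
    unfolding mixed_lp_def using p by (intro lp_norm_mono) auto
  also have "\<dots> = ennreal (2 powr (1 + 1 / pt)) * lp_norm (radial_measure DIM('a)) p (\<lambda>\<rho>. ang_norm pt F \<rho> + ang_norm pt G \<rho>)"
    using p by (intro lp_norm_cmult) auto
  also have "\<dots> \<le> ennreal (2 powr (1 + 1 / pt)) * (ennreal (2 powr (1 + 1 / p)) * (mixed_lp p pt F + mixed_lp p pt G))"
    unfolding mixed_lp_def using p by (intro mult_left_mono lp_norm_add_le) auto
  finally show ?thesis
    by (simp add: ennreal_mult mult_ac)
qed

text \<open>A weight in |x| is constant on each sphere and leaves the angular norm. The norm of
  \<rho> \<theta> is \<rho> only for \<rho> \<ge> 0, hence the almost-everywhere congruence. With w
  an indicator this is how cutting off to a ball becomes a condition on the radius.\<close>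

lemma mixed_lp_radial_mult:
  fixes F :: "'a::euclidean_space \<Rightarrow> ennreal"
  assumes "pt \<noteq> 0" and [measurable]: "F \<in> borel_measurable borel"
  shows "mixed_lp p pt (\<lambda>x. w (norm x) * F x) = lp_norm (radial_measure DIM('a)) p (\<lambda>\<rho>. w \<rho> * ang_norm pt F \<rho>)"
  unfolding mixed_lp_def
proof (rule lp_norm_cong_AE)
  show "AE \<rho> in radial_measure DIM('a). ang_norm pt (\<lambda>x. w (norm x) * F x) \<rho> = w \<rho> * ang_norm pt F \<rho>"
    using AE_radial_measure_pos
  proof eventually_elim
    case (elim \<rho>)
    then have "ang_norm pt (\<lambda>x. w (norm x) * F x) \<rho> = lp_norm surface_measure pt (\<lambda>\<theta>::'a. w \<rho> * F (\<rho> *\<^sub>R \<theta>))"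
      unfolding ang_norm_def by (intro lp_norm_cong) auto
    also have "\<dots> = w \<rho> * ang_norm pt F \<rho>"
      unfolding ang_norm_def using assms by (intro lp_norm_cmult) auto
    finally show ?case .
  qed
qed

abbreviation sphere_area :: "nat \<Rightarrow> real" where
  "sphere_area n \<equiv> real n * unit_ball_vol (real n)"

lemma ang_norm_le_exponent:
  fixes F :: "'a::euclidean_space \<Rightarrow> ennreal"
  assumes "0 < pt" "pt \<le> pt1" and [measurable]: "F \<in> borel_measurable borel"
  shows "ang_norm pt F \<rho> \<le> ennreal (sphere_area DIM('a) powr (1 / pt - 1 / pt1)) * ang_norm pt1 F \<rho>"
  unfolding ang_norm_def
proof (rule lp_norm_le_exponent)
  show "sphere (0::'a) 1 \<in> sets surface_measure"
    by (simp add: sets_restrict_space_iff)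
qed (use assms in \<open>auto simp: emeasure_surface_measure_space\<close>)

lemma mixed_lp_le_exponent:
  fixes F :: "'a::euclidean_space \<Rightarrow> ennreal"
  assumes "0 < p" "0 < pt" "pt \<le> pt1" and [measurable]: "F \<in> borel_measurable borel"
  shows "mixed_lp p pt F \<le> ennreal (sphere_area DIM('a) powr (1 / pt - 1 / pt1)) * mixed_lp p pt1 F"
proof -
  have "mixed_lp p pt F \<le> lp_norm (radial_measure DIM('a)) p
      (\<lambda>\<rho>. ennreal (sphere_area DIM('a) powr (1 / pt - 1 / pt1)) * ang_norm pt1 F \<rho>)"
    unfolding mixed_lp_def using assms by (intro lp_norm_mono ang_norm_le_exponent) auto
  also have "\<dots> = ennreal (sphere_area DIM('a) powr (1 / pt - 1 / pt1)) * mixed_lp p pt1 F"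
    unfolding mixed_lp_def using assms by (intro lp_norm_cmult) auto
  finally show ?thesis .
qed

text \<open>The exponents \<open>pt1\<close> and \<open>pt2\<close> combine to \<open>pt\<close>,
  not to 1; the finite area of the sphere bridges the gap between L^1 and L^pt.\<close>

lemma nn_integral_sphere_Holder:
  fixes F U :: "'a::euclidean_space \<Rightarrow> ennreal"
  assumes pt: "1 < pt" "0 < pt1" "0 < pt2" "1 / pt = 1 / pt1 + 1 / pt2"
    and [measurable]: "F \<in> borel_measurable borel" "U \<in> borel_measurable borel"
  shows "(\<integral>\<^sup>+\<theta>. F (\<rho> *\<^sub>R \<theta>) * U (\<rho> *\<^sub>R \<theta>) \<partial>surface_measure)
    \<le> ennreal (sphere_area DIM('a) powr (1 - 1 / pt)) * (ang_norm pt2 F \<rho> * ang_norm pt1 U \<rho>)"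
proof -
  have "(\<integral>\<^sup>+\<theta>. F (\<rho> *\<^sub>R \<theta>) * U (\<rho> *\<^sub>R \<theta>) \<partial>surface_measure) = ang_norm 1 (\<lambda>x. F x * U x) \<rho>"
    by (simp add: ang_norm_def lp_norm_def)
  also have "\<dots> \<le> ennreal (sphere_area DIM('a) powr (1 / 1 - 1 / pt)) * ang_norm pt (\<lambda>x. F x * U x) \<rho>"
    using pt by (intro ang_norm_le_exponent) auto
  also have "ang_norm pt (\<lambda>x. F x * U x) \<rho> \<le> ang_norm pt2 F \<rho> * ang_norm pt1 U \<rho>"
    unfolding ang_norm_def using pt by (intro lp_norm_Holder) auto
  finally show ?thesis
    by (simp add: mult_left_mono)
qed

theorem nn_integral_mixed_Holder:
  fixes F U :: "'a::euclidean_space \<Rightarrow> ennreal"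
  assumes pt: "1 < pt" "0 < pt1" "0 < pt2" "1 / pt = 1 / pt1 + 1 / pt2"
    and r: "1 < r" "1 < r'" "1 / r + 1 / r' = 1" "0 < p" "0 < m" "1 / r = 1 / p + 1 / m"
    and [measurable]: "F \<in> borel_measurable borel" "U \<in> borel_measurable borel" "w \<in> borel_measurable borel"
  shows "(\<integral>\<^sup>+x. w (norm x) * (F x * U x) \<partial>lborel)
    \<le> ennreal (sphere_area DIM('a) powr (1 - 1 / pt))
      * (lp_norm (radial_measure DIM('a)) r' w * (mixed_lp p pt2 F * mixed_lp m pt1 U))"
proof -
  let ?\<mu> = "radial_measure DIM('a)" and ?c = "ennreal (sphere_area DIM('a) powr (1 - 1 / pt))"
  have "(\<integral>\<^sup>+x. w (norm x) * (F x * U x) \<partial>lborel)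
    = (\<integral>\<^sup>+\<rho>. (\<integral>\<^sup>+\<theta>. w (norm (\<rho> *\<^sub>R \<theta>)) * (F (\<rho> *\<^sub>R \<theta>) * U (\<rho> *\<^sub>R \<theta>)) \<partial>surface_measure) \<partial>?\<mu>)"
    by (rule nn_integral_polar) auto
  also have "\<dots> \<le> (\<integral>\<^sup>+\<rho>. ?c * (w \<rho> * (ang_norm pt2 F \<rho> * ang_norm pt1 U \<rho>)) \<partial>?\<mu>)"
  proof (rule nn_integral_mono_AE)
    show "AE \<rho> in ?\<mu>. (\<integral>\<^sup>+\<theta>. w (norm (\<rho> *\<^sub>R \<theta>)) * (F (\<rho> *\<^sub>R \<theta>) * U (\<rho> *\<^sub>R \<theta>)) \<partial>surface_measure)
        \<le> ?c * (w \<rho> * (ang_norm pt2 F \<rho> * ang_norm pt1 U \<rho>))"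
      using AE_radial_measure_pos
    proof eventually_elim
      case (elim \<rho>)
      have "(\<integral>\<^sup>+\<theta>. w (norm (\<rho> *\<^sub>R \<theta>)) * (F (\<rho> *\<^sub>R \<theta>) * U (\<rho> *\<^sub>R \<theta>)) \<partial>surface_measure)
        = (\<integral>\<^sup>+\<theta>. w \<rho> * (F (\<rho> *\<^sub>R \<theta>) * U (\<rho> *\<^sub>R \<theta>)) \<partial>surface_measure)"
        using elim by (intro nn_integral_cong) auto
      also have "\<dots> = w \<rho> * (\<integral>\<^sup>+\<theta>. F (\<rho> *\<^sub>R \<theta>) * U (\<rho> *\<^sub>R \<theta>) \<partial>surface_measure)"
        by (intro nn_integral_cmult) measurable
      also have "\<dots> \<le> w \<rho> * (?c * (ang_norm pt2 F \<rho> * ang_norm pt1 U \<rho>))"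
        using pt by (intro mult_left_mono nn_integral_sphere_Holder) auto
      finally show ?case by (simp add: mult_ac)
    qed
  qed
  also have "\<dots> = ?c * (\<integral>\<^sup>+\<rho>. w \<rho> * (ang_norm pt2 F \<rho> * ang_norm pt1 U \<rho>) \<partial>?\<mu>)"
    by (intro nn_integral_cmult) auto
  also have "(\<integral>\<^sup>+\<rho>. w \<rho> * (ang_norm pt2 F \<rho> * ang_norm pt1 U \<rho>) \<partial>?\<mu>)
    \<le> lp_norm ?\<mu> r' w * lp_norm ?\<mu> r (\<lambda>\<rho>. ang_norm pt2 F \<rho> * ang_norm pt1 U \<rho>)"
    using r by (intro nn_integral_Holder) auto
  also have "lp_norm ?\<mu> r (\<lambda>\<rho>. ang_norm pt2 F \<rho> * ang_norm pt1 U \<rho>) \<le> mixed_lp p pt2 F * mixed_lp m pt1 U"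
    unfolding mixed_lp_def using r by (intro lp_norm_Holder) auto
  finally show ?thesis
    by (simp add: mult_left_mono)
qed

section \<open>Dyadic decomposition of the half-line\<close>

definition dyadic :: "int \<Rightarrow> real set" where
  "dyadic k = {2 powr (real_of_int k - 1)<..2 powr real_of_int k}"

lemma dyadic_pos: "s \<in> dyadic k \<Longrightarrow> 0 < s"
  by (auto simp: dyadic_def intro: less_trans[rotated])

lemma borel_dyadic [measurable]: "dyadic k \<in> sets borel"
  by (simp add: dyadic_def)

lemma dyadic_ex1:
  assumes "0 < s" shows "\<exists>!k. s \<in> dyadic k"
proof -
  have eq: "s \<in> dyadic k \<longleftrightarrow> of_int k - 1 < log 2 s \<and> log 2 s \<le> of_int k" for k
    using assms by (auto simp: dyadic_def less_log_iff log_le_iff)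
  show ?thesis
    unfolding eq
  proof (rule ex1I[of _ "\<lceil>log 2 s\<rceil>"])
    show "of_int \<lceil>log 2 s\<rceil> - 1 < log 2 s \<and> log 2 s \<le> of_int \<lceil>log 2 s\<rceil>"
      by linarith
    show "k = \<lceil>log 2 s\<rceil>" if "of_int k - 1 < log 2 s \<and> log 2 s \<le> of_int k" for k
      using that by (auto intro: ceiling_unique[symmetric])
  qed
qed

lemma dyadic_mono: "s \<in> dyadic k \<Longrightarrow> t \<in> dyadic l \<Longrightarrow> s \<le> t \<Longrightarrow> k \<le> l"
proof (rule ccontr)
  assume *: "s \<in> dyadic k" "t \<in> dyadic l" "s \<le> t" "\<not> k \<le> l"
  then have "2 powr real_of_int l \<le> 2 powr (real_of_int k - 1)"
    by (intro powr_mono) auto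
  with * show False by (auto simp: dyadic_def)
qed

text \<open>For a \<ge> 0 the right end-point is the worst case, for a < 0 the left one, which is
  half as large and costs the factor 2^|a|.\<close>

lemma powr_dyadic_le:
  assumes "s \<in> dyadic k"
  shows "s powr a \<le> 2 powr \<bar>a\<bar> * 2 powr (real_of_int k * a)"
proof (cases "0 \<le> a")
  case True
  have "s powr a \<le> (2 powr real_of_int k) powr a"
    using assms True dyadic_pos[OF assms] by (intro powr_mono2) (auto simp: dyadic_def)
  also have "\<dots> = 1 * 2 powr (real_of_int k * a)"
    by (simp add: powr_powr)
  also have "\<dots> \<le> 2 powr \<bar>a\<bar> * 2 powr (real_of_int k * a)"
    by (intro mult_right_mono) (auto simp: ge_one_powr_ge_zero)
  finally show ?thesis .
next
  case False
  have "s powr a \<le> (2 powr (real_of_int k - 1)) powr a"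
    using assms False by (intro powr_mono2') (auto simp: dyadic_def)
  also have "\<dots> = 2 powr \<bar>a\<bar> * 2 powr (real_of_int k * a)"
    using False by (simp add: powr_powr algebra_simps flip: powr_add)
  finally show ?thesis .
qed

section \<open>Inversion t = c / s and the kernel on dyadic intervals\<close>

text \<open>The map s -> c / s is decreasing, whereas the substitution rule is for increasing maps.
  So s -> - (c / s) is substituted into t -> h (- t), and a reflection undoes the sign; the
  inequality comes from enlarging [c / b, c / a] to the half-line.\<close>

lemma nn_integral_inversion_le:
  fixes h :: "real \<Rightarrow> ennreal"
  assumes [measurable]: "h \<in> borel_measurable borel" and c: "0 < c" and ab: "0 < a" "a < b"
  shows "(\<integral>\<^sup>+s\<in>{a..b}. h (c / s) * ennreal (c / s\<^sup>2) \<partial>lborel) \<le> (\<integral>\<^sup>+t\<in>{0<..}. h t \<partial>lborel)"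
proof -
  have "(\<integral>\<^sup>+x. h (- x) * indicator {(\<lambda>s. - (c / s)) a..(\<lambda>s. - (c / s)) b} x \<partial>lborel)
    = (\<integral>\<^sup>+s. h (- (- (c / s))) * ennreal (c / s\<^sup>2) * indicator {a..b} s \<partial>lborel)"
  proof (rule nn_integral_substitution_aux)
    show "((\<lambda>s. - (c / s)) has_real_derivative c / x\<^sup>2) (at x)" if "x \<in> {a..b}" for x
      using that ab by (auto intro!: derivative_eq_intros simp: power2_eq_square)
    show "continuous_on {a..b} (\<lambda>x. c / x\<^sup>2)"
      using ab by (auto intro!: continuous_intros)
  qed (use ab c in auto)
  then have "(\<integral>\<^sup>+s\<in>{a..b}. h (c / s) * ennreal (c / s\<^sup>2) \<partial>lborel)
    = (\<integral>\<^sup>+x. h (- x) * indicator {- (c / a)..- (c / b)} x \<partial>lborel)"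
    by simp
  also have "\<dots> = ennreal \<bar>-1\<bar> * (\<integral>\<^sup>+x. h (- (0 + - 1 * x)) * indicator {- (c / a)..- (c / b)} (0 + - 1 * x) \<partial>lborel)"
    by (rule nn_integral_real_affine) auto
  also have "\<dots> \<le> (\<integral>\<^sup>+t\<in>{0<..}. h t \<partial>lborel)"
  proof -
    have "0 < c / b" using c ab by simp
    then show ?thesis
      by (auto intro!: nn_integral_mono simp: indicator_def)
  qed
  finally show ?thesis .
qed

text \<open>The parameter \<gamma> is free: \<gamma> = n (r' - 1) turns K into the r'-th power of
  \<open>A\<close>, and \<gamma> = n into that of \<open>B\<close>. The price for the choice is a
  power of s and of \<rho>, which on dyadic intervals is a power of 2 up to a constant.\<close>

lemma lp_norm_kernel_le:
  fixes g :: "real \<Rightarrow> complex" and n :: nat and \<gamma> r' :: real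
  assumes [measurable]: "g \<in> borel_measurable borel" and r': "1 < r'" and n: "0 < n" and \<rho>: "\<rho> \<in> dyadic k"
  defines "K \<equiv> \<integral>\<^sup>+t\<in>{0<..}. ennreal (norm (g t) powr r' * t powr (\<gamma> - 1)) \<partial>lborel"
  shows "lp_norm (radial_measure n) r' (\<lambda>s. indicator (dyadic l) s * ennreal (norm (g (\<rho> / s)) / s ^ n))
    \<le> ennreal (2 powr ((\<bar>\<gamma> - n * (r' - 1)\<bar> + \<bar>\<gamma>\<bar>) / r')
        * 2 powr ((of_int l - of_int k) * (\<gamma> / r') - real_of_int l * real n * (1 - 1 / r'))) * K ennpowr (1 / r')"
proof -
  \<comment> \<open>Chosen so that, with t = \<rho> / s and dt = \<rho> / s^2 ds up to sign, s^(- n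
    r') s^(n - 1) ds equals s^\<beta> \<rho>^(- \<gamma>) t^(\<gamma> - 1) dt.\<close>
  define \<beta> where "\<beta> = \<gamma> - n * (r' - 1)"
  define a b :: real where "a = 2 powr (real_of_int l - 1)" and "b = 2 powr real_of_int l"
  have ab: "0 < a" "a < b" by (auto simp: a_def b_def)
  have \<rho>_pos: "0 < \<rho>" by (rule dyadic_pos[OF \<rho>])
  let ?h = "\<lambda>t. ennreal (norm (g t) powr r' * t powr (\<gamma> - 1))"
  let ?c = "2 powr \<bar>\<beta>\<bar> * 2 powr (of_int l * \<beta>) * (2 powr \<bar>- \<gamma>\<bar> * 2 powr (of_int k * (- \<gamma>)))"
  have pointwise: "(indicator (dyadic l) s * ennreal (norm (g (\<rho> / s)) / s ^ n)) ennpowr r'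
      * ennreal (s ^ (n - 1)) * indicator {0<..} s
    \<le> ennreal ?c * (?h (\<rho> / s) * ennreal (\<rho> / s\<^sup>2) * indicator {a..b} s)" for s
  proof (cases "s \<in> dyadic l")
    case True
    have s: "0 < s" by (rule dyadic_pos[OF True])
    define G where "G = norm (g (\<rho> / s)) powr r'"
    have "(norm (g (\<rho> / s)) / s ^ n) powr r' * s ^ (n - 1) = G * (s powr (- (n * r')) * s powr (n - 1))"
      using s n by (simp add: G_def powr_divide powr_powr powr_minus divide_simps flip: powr_realpow)
    also have "s powr (- (n * r')) * s powr (n - 1) = s powr \<beta> * (s powr (1 - \<gamma>) / s\<^sup>2)"
      using s n by (simp add: \<beta>_def algebra_simps of_nat_diff flip: powr_add powr_diff powr_numeral)
    also have "\<dots> = s powr \<beta> * \<rho> powr (- \<gamma>) * ((\<rho> / s) powr (\<gamma> - 1) * (\<rho> / s\<^sup>2))"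
      using s \<rho>_pos by (simp add: powr_divide powr_diff powr_minus field_simps)
    also have "G * \<dots> = (s powr \<beta> * \<rho> powr (- \<gamma>)) * (G * (\<rho> / s) powr (\<gamma> - 1) * (\<rho> / s\<^sup>2))"
      by simp
    also have "\<dots> \<le> ?c * (G * (\<rho> / s) powr (\<gamma> - 1) * (\<rho> / s\<^sup>2))"
    proof (intro mult_right_mono)
      show "s powr \<beta> * \<rho> powr (- \<gamma>) \<le> ?c"
        by (intro mult_mono powr_dyadic_le True \<rho>) auto
    qed (use \<rho>_pos in \<open>auto simp: G_def\<close>)
    finally have "ennreal ((norm (g (\<rho> / s)) / s ^ n) powr r' * s ^ (n - 1))
      \<le> ennreal (?c * (G * (\<rho> / s) powr (\<gamma> - 1) * (\<rho> / s\<^sup>2)))"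
      by (rule ennreal_leI)
    moreover have "s \<in> {a..b}" using True by (auto simp: dyadic_def a_def b_def)
    moreover have "(indicator (dyadic l) s * ennreal (norm (g (\<rho> / s)) / s ^ n)) ennpowr r'
        * ennreal (s ^ (n - 1)) * indicator {0<..} s
      = ennreal ((norm (g (\<rho> / s)) / s ^ n) powr r' * s ^ (n - 1))"
      using True s by (simp flip: ennreal_mult)
    moreover have "ennreal (?c * (G * (\<rho> / s) powr (\<gamma> - 1) * (\<rho> / s\<^sup>2)))
      = ennreal ?c * (ennreal (G * (\<rho> / s) powr (\<gamma> - 1)) * ennreal (\<rho> / s\<^sup>2))"
      using s \<rho>_pos by (subst ennreal_mult[symmetric], simp_all add: G_def, subst ennreal_mult[symmetric], simp_all)
    ultimately show ?thesis
      by (simp only: G_def indicator_simps mult_1_right)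
  qed auto
  have "(\<integral>\<^sup>+s. (indicator (dyadic l) s * ennreal (norm (g (\<rho> / s)) / s ^ n)) ennpowr r' \<partial>radial_measure n)
    = (\<integral>\<^sup>+s\<in>{0<..}. (indicator (dyadic l) s * ennreal (norm (g (\<rho> / s)) / s ^ n)) ennpowr r' * ennreal (s ^ (n - 1)) \<partial>lborel)"
    by (rule nn_integral_radial_measure) measurable
  also have "\<dots> \<le> (\<integral>\<^sup>+s. ennreal ?c * (?h (\<rho> / s) * ennreal (\<rho> / s\<^sup>2) * indicator {a..b} s) \<partial>lborel)"
    by (intro nn_integral_mono pointwise)
  also have "\<dots> = ennreal ?c * (\<integral>\<^sup>+s\<in>{a..b}. ?h (\<rho> / s) * ennreal (\<rho> / s\<^sup>2) \<partial>lborel)"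
    by (intro nn_integral_cmult) measurable
  also have "\<dots> \<le> ennreal ?c * K"
    unfolding K_def by (intro mult_left_mono nn_integral_inversion_le \<rho>_pos ab) auto
  finally have "lp_norm (radial_measure n) r' (\<lambda>s. indicator (dyadic l) s * ennreal (norm (g (\<rho> / s)) / s ^ n))
    \<le> (ennreal ?c * K) ennpowr (1 / r')"
    unfolding lp_norm_def using r' by (intro ennpowr_mono) auto
  also have "\<dots> = ennreal (?c powr (1 / r')) * K ennpowr (1 / r')"
    by (simp add: ennpowr_mult)
  also have "?c powr (1 / r') = 2 powr ((\<bar>\<beta>\<bar> + \<bar>\<gamma>\<bar>) / r')
      * 2 powr ((of_int l - of_int k) * (\<gamma> / r') - real_of_int l * real n * (1 - 1 / r'))"
  proof -
    have c_eq: "?c = 2 powr (\<bar>\<beta>\<bar> + \<bar>\<gamma>\<bar> + (of_int l * \<beta> - of_int k * \<gamma>))"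
      by (simp add: powr_add powr_diff powr_minus field_simps)
    have "(\<bar>\<beta>\<bar> + \<bar>\<gamma>\<bar> + (of_int l * \<beta> - of_int k * \<gamma>)) * (1 / r')
      = (\<bar>\<beta>\<bar> + \<bar>\<gamma>\<bar>) / r' + ((of_int l - of_int k) * (\<gamma> / r') - real_of_int l * real n * (1 - 1 / r'))"
      using r' by (simp add: \<beta>_def field_simps)
    then show ?thesis
      unfolding c_eq powr_powr by (simp only: powr_add[symmetric])
  qed
  finally show ?thesis by (simp add: \<beta>_def)
qed

text \<open>On the positive half-line inversion is its own inverse, so the preimage is contained in
  the image of a null set under a differentiable map between spaces of equal dimension.\<close>

lemma negligible_inversion:
  assumes N: "negligible N" and c: "0 < (c::real)"
  shows "negligible {s. 0 < s \<and> c / s \<in> N}"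
proof -
  have "negligible ((\<lambda>t. c / t) ` (N \<inter> {0<..}))"
  proof (rule negligible_differentiable_image_negligible)
    show "negligible (N \<inter> {0<..})"
      using N by (rule negligible_subset) auto
    show "(\<lambda>t. c / t) differentiable_on N \<inter> {0<..}"
      by (auto simp: differentiable_on_def intro!: derivative_intros)
  qed simp
  moreover have "{s. 0 < s \<and> c / s \<in> N} \<subseteq> (\<lambda>t. c / t) ` (N \<inter> {0<..})"
    using c by (auto intro!: image_eqI[where x="c / _"] simp: field_simps)
  ultimately show ?thesis by (rule negligible_subset)
qed

text \<open>For fixed x the kernel evaluates the profile of \<Phi> at |x| / |y|. This lemma, with c
  = |x|, turns an identity for almost every t into one for almost every y; inversion handles the
  radius and polar coordinates the direction.\<close>

lemma AE_inversion_norm: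
  fixes P :: "real \<Rightarrow> bool"
  assumes "AE t in lborel. 0 < t \<longrightarrow> P t" and c: "0 < c"
  shows "AE y::'a::euclidean_space in lborel. P (c / norm y)"
proof -
  obtain N where N: "{t. \<not> (0 < t \<longrightarrow> P t)} \<subseteq> N" "emeasure lborel N = 0" "N \<in> sets borel"
    using assms(1) by (auto elim!: AE_E)
  have [measurable]: "N \<in> sets borel" by fact
  have "N \<in> null_sets lborel" using N by auto
  then have "negligible N"
    by (simp add: negligible_iff_null_sets null_sets_completionI)
  then have "negligible {s. 0 < s \<and> c / s \<in> N}"
    using c by (rule negligible_inversion)
  moreover have "{s. 0 < s \<and> c / s \<in> N} \<in> sets borel"
    by measurable
  ultimately have "{s. 0 < s \<and> c / s \<in> N} \<in> null_sets lborel"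
    by (auto simp: negligible_iff_null_sets null_sets_def)
  then have "AE s in lborel. 0 < s \<longrightarrow> c / s \<notin> N"
    by (auto dest!: AE_not_in elim!: eventually_mono)
  then have *: "AE s in radial_measure DIM('a). c / s \<notin> N"
    by (simp add: AE_radial_measure)
  have "(\<integral>\<^sup>+y. indicator N (c / norm y) \<partial>(lborel :: 'a measure))
    = (\<integral>\<^sup>+s. (\<integral>\<^sup>+\<theta>. indicator N (c / norm (s *\<^sub>R \<theta>)) \<partial>(surface_measure :: 'a measure)) \<partial>radial_measure DIM('a))"
    by (rule nn_integral_polar) measurable
  also have "\<dots> = (\<integral>\<^sup>+s. 0 \<partial>radial_measure DIM('a))"
  proof (rule nn_integral_cong_AE)
    show "AE s in radial_measure DIM('a).
      (\<integral>\<^sup>+\<theta>. indicator N (c / norm (s *\<^sub>R \<theta>)) \<partial>(surface_measure :: 'a measure)) = 0"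
      using * AE_radial_measure_pos
    proof eventually_elim
      case (elim s)
      then have "(\<integral>\<^sup>+\<theta>. indicator N (c / norm (s *\<^sub>R \<theta>)) \<partial>(surface_measure :: 'a measure))
        = (\<integral>\<^sup>+\<theta>. 0 \<partial>(surface_measure :: 'a measure))"
        by (intro nn_integral_cong) auto
      then show ?case by simp
    qed
  qed
  finally have "(\<integral>\<^sup>+y. indicator N (c / norm y) \<partial>(lborel :: 'a measure)) = 0"
    by simp
  then have "AE y in (lborel :: 'a measure). indicator N (c / norm y) = (0::ennreal)"
    by (subst (asm) nn_integral_0_iff_AE) measurable
  then show ?thesis
    using AE_lborel_singleton[of "0::'a"]
  proof eventually_elim
    case (elim y)
    then have "c / norm y \<notin> N" "0 < c / norm y"
      using c by (auto simp: indicator_eq_0_iff)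
    with N(1) show ?case by blast
  qed
qed

section \<open>Sums over the integers and discrete convolution\<close>

text \<open>As an integral against counting measure the Herz sum becomes an \<open>lp_norm\<close>,
  and exchange of sums and monotonicity come from integration theory.\<close>

lemma infsum_int_eq_nn_integral:
  fixes f :: "int \<Rightarrow> ennreal"
  shows "infsum f UNIV = (\<integral>\<^sup>+k. f k \<partial>count_space UNIV)"
proof -
  have "infsum f UNIV = infsum (\<lambda>i. f (int_decode i)) UNIV"
    using infsum_reindex_bij_betw[OF bij_int_decode, of f] by simp
  also have "\<dots> = (\<Sum>i. f (int_decode i))"
  proof -
    have "((\<lambda>i. f (int_decode i)) has_sum infsum (\<lambda>i. f (int_decode i)) UNIV) UNIV"
      by (intro has_sum_infsum nonneg_summable_on_complete) simp
    then show ?thesis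
      by (rule sums_unique[OF has_sum_imp_sums])
  qed
  also have "\<dots> = (\<integral>\<^sup>+k. f k \<partial>count_space UNIV)"
    by (simp add: nn_integral_bij_count_space[OF bij_int_decode, symmetric] nn_integral_count_space_nat)
  finally show ?thesis .
qed

lemma nn_integral_count_space_shift:
  fixes f :: "int \<Rightarrow> ennreal"
  shows "(\<integral>\<^sup>+l. f (k - l) \<partial>count_space UNIV) = (\<integral>\<^sup>+j. f j \<partial>count_space UNIV)"
    "(\<integral>\<^sup>+l. f (l - k) \<partial>count_space UNIV) = (\<integral>\<^sup>+j. f j \<partial>count_space UNIV)"
proof -
  have "bij (\<lambda>l. k - l)"
    by (rule bij_betw_byWitness[where f'="\<lambda>l. k - l"]) auto
  then show "(\<integral>\<^sup>+l. f (k - l) \<partial>count_space UNIV) = (\<integral>\<^sup>+j. f j \<partial>count_space UNIV)"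
    by (rule nn_integral_bij_count_space)
  have "bij (\<lambda>l. l - k)"
    by (rule bij_betw_byWitness[where f'="\<lambda>l. l + k"]) auto
  then show "(\<integral>\<^sup>+l. f (l - k) \<partial>count_space UNIV) = (\<integral>\<^sup>+j. f j \<partial>count_space UNIV)"
    by (rule nn_integral_bij_count_space)
qed

lemma nn_integral_count_space_swap:
  fixes f :: "int \<Rightarrow> int \<Rightarrow> ennreal"
  shows "(\<integral>\<^sup>+k. (\<integral>\<^sup>+l. f k l \<partial>count_space UNIV) \<partial>count_space UNIV)
    = (\<integral>\<^sup>+l. (\<integral>\<^sup>+k. f k l \<partial>count_space UNIV) \<partial>count_space UNIV)"
  by (rule nn_integral_count_space_nn_integral) auto

lemma nn_integral_int_geometric_finite:
  assumes "0 < c"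
  shows "(\<integral>\<^sup>+j. ennreal (2 powr (- c * \<bar>real_of_int j\<bar>)) \<partial>count_space UNIV) < \<infinity>"
proof -
  let ?f = "\<lambda>j. ennreal (2 powr (- c * \<bar>real_of_int j\<bar>))"
  have "(\<integral>\<^sup>+j. ?f j \<partial>count_space UNIV)
      \<le> (\<integral>\<^sup>+j. ?f j * indicator {0..} j + ?f j * indicator {..0} j \<partial>count_space UNIV)"
    by (intro nn_integral_mono) (auto simp: indicator_def)
  also have "\<dots> = (\<integral>\<^sup>+j. ?f j \<partial>count_space {0..}) + (\<integral>\<^sup>+j. ?f j \<partial>count_space {..0})"
    by (subst nn_integral_add) (auto simp: nn_integral_count_space_indicator)
  also have "(\<integral>\<^sup>+j. ?f j \<partial>count_space {0..}) = (\<integral>\<^sup>+i. ?f (int i) \<partial>count_space UNIV)"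
    by (rule nn_integral_bij_count_space[symmetric]) (rule bij_betw_byWitness[where f'=nat], auto)
  also have "(\<integral>\<^sup>+j. ?f j \<partial>count_space {..0}) = (\<integral>\<^sup>+i. ?f (- int i) \<partial>count_space UNIV)"
    by (rule nn_integral_bij_count_space[symmetric]) (rule bij_betw_byWitness[where f'="\<lambda>j. nat (- j)"], auto)
  also have "(\<integral>\<^sup>+i. ?f (int i) \<partial>count_space UNIV) + (\<integral>\<^sup>+i. ?f (- int i) \<partial>count_space UNIV)
    = 2 * (\<Sum>i. ennreal ((2 powr - c) ^ i))"
    by (simp add: nn_integral_count_space_nat mult_2 powr_powr flip: powr_realpow)
  also have "\<dots> = 2 * ennreal (\<Sum>i. (2 powr - c) ^ i)"
    using powr_less_mono[of "-c" 0 2] assms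
    by (subst suminf_ennreal2) (auto intro!: summable_geometric)
  also have "\<dots> < \<infinity>"
    by (simp add: ennreal_mult_less_top)
  finally show ?thesis .
qed

text \<open>Bounding the inner sum by the largest of the \<open>w\<^sup>1\<^sup>/\<^sup>2 a\<close> times the sum of the \<open>w\<^sup>1\<^sup>/\<^sup>2\<close>
  treats all exponents \<open>q > 0\<close> at once.\<close>

lemma lp_norm_int_convolution:
  assumes \<epsilon>: "0 < \<epsilon>" and q: "0 < q"
  shows "\<exists>C::real. \<forall>a::int \<Rightarrow> ennreal.
    lp_norm (count_space UNIV) q
      (\<lambda>k. \<integral>\<^sup>+l. ennreal (2 powr (- \<epsilon> * \<bar>real_of_int (k - l)\<bar>)) * a l \<partial>count_space UNIV)
    \<le> ennreal C * lp_norm (count_space UNIV) q a"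
proof -
  define w where "w c j = ennreal (2 powr (- c * \<bar>real_of_int j\<bar>))" for c j
  define W where "W c = (\<integral>\<^sup>+j. w c j \<partial>count_space UNIV)" for c
  have W: "W c < \<infinity>" if "0 < c" for c
    using nn_integral_int_geometric_finite[OF that] by (simp add: W_def w_def)
  have w_half: "w \<epsilon> j = w (\<epsilon> / 2) j * w (\<epsilon> / 2) j" for j
    by (simp add: w_def algebra_simps flip: ennreal_mult powr_add)
  have w_powr: "w (\<epsilon> / 2) j ennpowr q = w (\<epsilon> / 2 * q) j" for j
    by (simp add: w_def powr_powr algebra_simps)
  have bound: "lp_norm (count_space UNIV) q (\<lambda>k. \<integral>\<^sup>+l. w \<epsilon> (k - l) * a l \<partial>count_space UNIV)
    \<le> (W (\<epsilon> / 2) * W (\<epsilon> / 2 * q) ennpowr (1 / q)) * lp_norm (count_space UNIV) q a" for a :: "int \<Rightarrow> ennreal"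
  proof -
    \<comment> \<open>The q-th root of \<open>S k\<close> majorises every term w^(1/2)(k - l) a(l).
      It takes the place of their supremum because its q-th power can be summed over k exactly, by
      exchanging the two sums.\<close>
    define S where "S k = (\<integral>\<^sup>+l. w (\<epsilon> / 2 * q) (k - l) * a l ennpowr q \<partial>count_space UNIV)" for k
    have le: "w (\<epsilon> / 2) (k - l) * a l \<le> S k ennpowr (1 / q)" for k l
    proof -
      have "(w (\<epsilon> / 2) (k - l) * a l) ennpowr q = (\<integral>\<^sup>+i. w (\<epsilon> / 2 * q) (k - i) * a i ennpowr q * indicator {l} i \<partial>count_space UNIV)"
        by (simp add: ennpowr_mult w_powr)
      also have "\<dots> \<le> S k"
        unfolding S_def by (intro nn_integral_mono) (auto simp: indicator_def)
      finally have "((w (\<epsilon> / 2) (k - l) * a l) ennpowr q) ennpowr (1 / q) \<le> S k ennpowr (1 / q)"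
        using q by (intro ennpowr_mono) auto
      then show ?thesis
        using q by (simp add: ennpowr_inverse_cancel)
    qed
    have "(\<integral>\<^sup>+l. w \<epsilon> (k - l) * a l \<partial>count_space UNIV) \<le> W (\<epsilon> / 2) * S k ennpowr (1 / q)" for k
    proof -
      have "(\<integral>\<^sup>+l. w \<epsilon> (k - l) * a l \<partial>count_space UNIV)
        \<le> (\<integral>\<^sup>+l. w (\<epsilon> / 2) (k - l) * S k ennpowr (1 / q) \<partial>count_space UNIV)"
        unfolding w_half mult.assoc by (intro nn_integral_mono mult_left_mono le) auto
      also have "\<dots> = W (\<epsilon> / 2) * S k ennpowr (1 / q)"
        unfolding W_def by (simp add: nn_integral_multc nn_integral_count_space_shift)
      finally show ?thesis .
    qed
    then have "lp_norm (count_space UNIV) q (\<lambda>k. \<integral>\<^sup>+l. w \<epsilon> (k - l) * a l \<partial>count_space UNIV)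
      \<le> lp_norm (count_space UNIV) q (\<lambda>k. W (\<epsilon> / 2) * S k ennpowr (1 / q))"
      using q by (intro lp_norm_mono) auto
    also have "\<dots> = W (\<epsilon> / 2) * (\<integral>\<^sup>+k. S k \<partial>count_space UNIV) ennpowr (1 / q)"
      using q by (subst lp_norm_cmult) (auto simp: lp_norm_def ennpowr_ennpowr)
    also have "(\<integral>\<^sup>+k. S k \<partial>count_space UNIV)
      = (\<integral>\<^sup>+l. (\<integral>\<^sup>+k. w (\<epsilon> / 2 * q) (k - l) * a l ennpowr q \<partial>count_space UNIV) \<partial>count_space UNIV)"
      unfolding S_def by (rule nn_integral_count_space_swap)
    also have "\<dots> = (\<integral>\<^sup>+l. W (\<epsilon> / 2 * q) * a l ennpowr q \<partial>count_space UNIV)"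
      by (simp add: nn_integral_multc nn_integral_count_space_shift W_def)
    also have "\<dots> = W (\<epsilon> / 2 * q) * (\<integral>\<^sup>+l. a l ennpowr q \<partial>count_space UNIV)"
      by (simp add: nn_integral_cmult)
    also have "W (\<epsilon> / 2) * \<dots> ennpowr (1 / q)
      = (W (\<epsilon> / 2) * W (\<epsilon> / 2 * q) ennpowr (1 / q)) * lp_norm (count_space UNIV) q a"
      by (simp add: ennpowr_mult lp_norm_def mult.assoc)
    finally show ?thesis .
  qed
  have "W (\<epsilon> / 2) * W (\<epsilon> / 2 * q) ennpowr (1 / q) < \<infinity>"
    using W[of "\<epsilon> / 2"] W[of "\<epsilon> / 2 * q"] \<epsilon> q by (simp add: ennreal_mult_less_top)
  then obtain X where X: "W (\<epsilon> / 2) * W (\<epsilon> / 2 * q) ennpowr (1 / q) = ennreal X"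
    by (cases "W (\<epsilon> / 2) * W (\<epsilon> / 2 * q) ennpowr (1 / q)") auto
  show ?thesis
    using bound[unfolded X w_def] by blast
qed

text \<open>The inequality 1 + z \<le> exp z at z = \<epsilon> j ln 2 bounds j by 2^(\<epsilon> j) /
  (\<epsilon> ln 2), so half of the decay pays for a linear factor. For this reason kernels are
  assumed to decay at rate 2 \<epsilon> and conclusions hold at rate \<epsilon>.\<close>

lemma linear_exp_le_exp:
  assumes "0 < \<epsilon>" "0 \<le> (j::real)"
  shows "(1 + j) * 2 powr (- (2 * \<epsilon>) * j) \<le> (1 + 1 / (\<epsilon> * ln 2)) * 2 powr (- \<epsilon> * j)"
proof -
  have "1 + \<epsilon> * j * ln 2 \<le> 2 powr (\<epsilon> * j)"
    using exp_ge_add_one_self[of "\<epsilon> * j * ln 2"] by (simp add: powr_def mult_ac)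
  then have "j \<le> 2 powr (\<epsilon> * j) / (\<epsilon> * ln 2)"
    using assms by (simp add: field_simps)
  moreover have "1 \<le> 2 powr (\<epsilon> * j)"
    using assms by (simp add: ge_one_powr_ge_zero)
  ultimately have "1 + j \<le> (1 + 1 / (\<epsilon> * ln 2)) * 2 powr (\<epsilon> * j)"
    by (simp add: algebra_simps)
  then have "(1 + j) * 2 powr (- (2 * \<epsilon>) * j) \<le> (1 + 1 / (\<epsilon> * ln 2)) * 2 powr (\<epsilon> * j) * 2 powr (- (2 * \<epsilon>) * j)"
    by (intro mult_right_mono) auto
  also have "\<dots> = (1 + 1 / (\<epsilon> * ln 2)) * 2 powr (- \<epsilon> * j)"
    by (simp add: mult.assoc algebra_simps flip: powr_add)
  finally show ?thesis .
qed

section \<open>Dyadic means of functions of bounded central mean oscillation\<close>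

lemma borel_ball [measurable]: "ball c r \<in> sets (borel :: 'a::metric_space measure)"
  by simp

lemma cmo_norm_ball_le:
  fixes b :: "'a::euclidean_space \<Rightarrow> complex"
  assumes [measurable]: "b \<in> borel_measurable borel" and s: "0 < s" "0 < st" and R: "0 < R"
  shows "mixed_lp s st (\<lambda>x. indicator (ball 0 R) x * ennreal (norm (b x - ball_mean b R)))
    \<le> ennreal ((unit_ball_vol DIM('a) * R ^ DIM('a)) powr (1 / s)) * cmo_norm s st b"
proof -
  let ?v = "unit_ball_vol (real DIM('a)) * R ^ DIM('a)"
  let ?F = "\<lambda>x. ennreal (norm (b x - ball_mean b R))"
  let ?X = "\<integral>\<^sup>+\<rho>\<in>{0<..<R}. (\<integral>\<^sup>+\<theta>. ennreal (norm (b (\<rho> *\<^sub>R \<theta>) - ball_mean b R) powr st) \<partial>surface_measure)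
               ennpowr (s / st) * ennreal (\<rho> ^ (DIM('a) - 1)) \<partial>lborel"
  have v: "0 < ?v" using R by simp
  have "mixed_lp s st (\<lambda>x. indicator (ball 0 R) x * ?F x)
    = mixed_lp s st (\<lambda>x. indicator {..<R} (norm x) * ?F x)"
    by (simp add: indicator_def)
  also have "\<dots> = lp_norm (radial_measure DIM('a)) s (\<lambda>\<rho>. indicator {..<R} \<rho> * ang_norm st ?F \<rho>)"
    using s by (intro mixed_lp_radial_mult) auto
  also have "\<dots> = ?X ennpowr (1 / s)"
  proof -
    have eq: "ang_norm st ?F \<rho> ennpowr s
      = (\<integral>\<^sup>+\<theta>. ennreal (norm (b (\<rho> *\<^sub>R \<theta>) - ball_mean b R) powr st) \<partial>surface_measure) ennpowr (s / st)" for \<rho>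
      by (simp add: ang_norm_def lp_norm_def ennpowr_ennpowr)
    have "(\<integral>\<^sup>+\<rho>. (indicator {..<R} \<rho> * ang_norm st ?F \<rho>) ennpowr s \<partial>radial_measure DIM('a))
      = (\<integral>\<^sup>+\<rho>\<in>{0<..}. (indicator {..<R} \<rho> * ang_norm st ?F \<rho>) ennpowr s * ennreal (\<rho> ^ (DIM('a) - 1)) \<partial>lborel)"
      by (rule nn_integral_radial_measure) measurable
    also have "\<dots> = ?X"
      by (intro nn_integral_cong) (auto simp: indicator_def eq)
    finally show ?thesis
      by (simp add: lp_norm_def)
  qed
  also have "\<dots> = (ennreal ?v * (ennreal (1 / ?v) * ?X)) ennpowr (1 / s)"
    using v by (subst mult.assoc[symmetric], subst ennreal_mult[symmetric]) auto
  also have "\<dots> = ennreal (?v powr (1 / s)) * (ennreal (1 / ?v) * ?X) ennpowr (1 / s)"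
    using v by (subst ennpowr_mult) auto
  also have "(ennreal (1 / ?v) * ?X) ennpowr (1 / s) \<le> cmo_norm s st b"
    unfolding cmo_norm_def using R by (intro SUP_upper) auto
  finally show ?thesis
    by (simp add: mult_left_mono)
qed

lemma mixed_lp_ball_le_exponent:
  fixes F :: "'a::euclidean_space \<Rightarrow> ennreal"
  assumes e: "0 < e" "e \<le> s" and "0 < st" and [measurable]: "F \<in> borel_measurable borel" and R: "0 < R"
  shows "mixed_lp e st (\<lambda>x. indicator (ball 0 R) x * F x)
    \<le> ennreal ((R ^ DIM('a) / DIM('a)) powr (1 / e - 1 / s)) * mixed_lp s st (\<lambda>x. indicator (ball 0 R) x * F x)"
proof -
  have eq: "mixed_lp t st (\<lambda>x. indicator (ball 0 R) x * F x)
    = lp_norm (radial_measure DIM('a)) t (\<lambda>\<rho>. indicator {..<R} \<rho> * ang_norm st F \<rho>)" for t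
  proof -
    have "mixed_lp t st (\<lambda>x. indicator (ball 0 R) x * F x) = mixed_lp t st (\<lambda>x. indicator {..<R} (norm x) * F x)"
      by (simp add: indicator_def)
    also have "\<dots> = lp_norm (radial_measure DIM('a)) t (\<lambda>\<rho>. indicator {..<R} \<rho> * ang_norm st F \<rho>)"
      using assms by (intro mixed_lp_radial_mult) auto
    finally show ?thesis .
  qed
  show ?thesis
    unfolding eq
  proof (rule lp_norm_le_exponent[where A="{..R}"])
    show "emeasure (radial_measure DIM('a)) {..R} \<le> ennreal (R ^ DIM('a) / real DIM('a))"
      using R by (simp add: emeasure_radial_measure_atMost)
  qed (use assms in \<open>auto simp: indicator_def\<close>)
qed

text \<open>The volume factors R^(n (1 / e - 1 / s)) and R^(n / s) multiply to R^(n / e), which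
  depends on e alone. One exponent s therefore serves e = p and e = m, and e = 1 in the comparison
  of means.\<close>

lemma cmo_norm_ball_le_exponent:
  fixes b :: "'a::euclidean_space \<Rightarrow> complex"
  assumes [measurable]: "b \<in> borel_measurable borel" and e: "0 < e" "e \<le> s" "0 < st" and R: "0 < R"
  shows "mixed_lp e st (\<lambda>x. indicator (ball 0 R) x * ennreal (norm (b x - ball_mean b R)))
    \<le> ennreal ((1 / DIM('a)) powr (1 / e - 1 / s) * unit_ball_vol DIM('a) powr (1 / s) * R powr (DIM('a) / e))
      * cmo_norm s st b"
proof -
  let ?n = "real DIM('a)"
  have "mixed_lp e st (\<lambda>x. indicator (ball 0 R) x * ennreal (norm (b x - ball_mean b R)))
    \<le> ennreal ((R ^ DIM('a) / ?n) powr (1 / e - 1 / s))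
      * mixed_lp s st (\<lambda>x. indicator (ball 0 R) x * ennreal (norm (b x - ball_mean b R)))"
    using assms by (intro mixed_lp_ball_le_exponent) auto
  also have "\<dots> \<le> ennreal ((R ^ DIM('a) / ?n) powr (1 / e - 1 / s))
      * (ennreal ((unit_ball_vol ?n * R ^ DIM('a)) powr (1 / s)) * cmo_norm s st b)"
    using assms by (intro mult_left_mono cmo_norm_ball_le) auto
  also have "\<dots> = ennreal ((R ^ DIM('a) / ?n) powr (1 / e - 1 / s) * (unit_ball_vol ?n * R ^ DIM('a)) powr (1 / s)) * cmo_norm s st b"
    by (simp add: ennreal_mult mult.assoc)
  also have "(R ^ DIM('a) / ?n) powr (1 / e - 1 / s) * (unit_ball_vol ?n * R ^ DIM('a)) powr (1 / s)
    = (1 / ?n) powr (1 / e - 1 / s) * unit_ball_vol ?n powr (1 / s) * (R powr ?n) powr (1 / e)"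
  proof -
    have R_n: "R ^ DIM('a) = R powr ?n"
      using R by (simp add: powr_realpow)
    have "(R powr ?n) powr (1 / e) = (R powr ?n) powr (1 / e - 1 / s) * (R powr ?n) powr (1 / s)"
      by (simp flip: powr_add)
    moreover have "(R ^ DIM('a) / ?n) powr (1 / e - 1 / s) = (R powr ?n) powr (1 / e - 1 / s) * (1 / ?n) powr (1 / e - 1 / s)"
      unfolding R_n by (subst powr_mult[symmetric]) auto
    moreover have "(unit_ball_vol ?n * R ^ DIM('a)) powr (1 / s) = unit_ball_vol ?n powr (1 / s) * (R powr ?n) powr (1 / s)"
      unfolding R_n by (subst powr_mult) auto
    ultimately show ?thesis by simp
  qed
  finally show ?thesis
    by (simp add: powr_powr)
qed

lemma nn_integral_eq_mixed_lp:
  "F \<in> borel_measurable borel \<Longrightarrow> (\<integral>\<^sup>+x. F x \<partial>lborel) = mixed_lp 1 1 F"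
  by (simp add: nn_integral_polar mixed_lp_def lp_norm_def ang_norm_def)

text \<open>The difference is the mean of b - c over the smaller ball; the integral of its norm is
  then extended to the larger ball. It is applied with c the mean over the larger ball.\<close>

lemma norm_ball_mean_diff_le:
  fixes b :: "'a::euclidean_space \<Rightarrow> complex"
  assumes [measurable]: "b \<in> borel_measurable borel" and int: "set_integrable lborel (ball 0 r) b"
    and r: "0 < r" "r \<le> R"
  shows "ennreal (norm (ball_mean b r - c))
    \<le> ennreal (1 / (unit_ball_vol DIM('a) * r ^ DIM('a))) * (\<integral>\<^sup>+x. indicator (ball 0 R) x * ennreal (norm (b x - c)) \<partial>lborel)"
proof -
  define V where "V = unit_ball_vol DIM('a) * r ^ DIM('a)"
  let ?f = "\<lambda>x. indicator (ball 0 r) x *\<^sub>R (b x - c)"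
  have v: "0 < V" "measure lborel (ball (0::'a) r) = V"
    using r content_ball[of r "0::'a"] by (simp_all add: V_def)
  have ind: "integrable lborel (\<lambda>x. indicator (ball (0::'a) r) x *\<^sub>R c)"
    by (intro integrable_scaleR_left integrable_real_indicator)
      (use emeasure_lborel_ball_finite[of "0::'a" r] in auto)
  have int1: "integrable lborel (\<lambda>x. indicator (ball 0 r) x *\<^sub>R b x)"
    using int by (simp add: set_integrable_def)
  then have int2: "integrable lborel ?f"
    using Bochner_Integration.integrable_diff[OF int1 ind] by (simp add: scaleR_diff_right)
  have "ball_mean b r = (LINT x:ball 0 r|lborel. b x) /\<^sub>R V"
    using v(2) by (simp add: ball_mean_def set_lebesgue_integral_def) (subst integral_completion, auto)
  also have "(LINT x:ball 0 r|lborel. b x) = (\<integral>x. ?f x \<partial>lborel) + V *\<^sub>R c"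
  proof -
    have "(\<integral>x. ?f x \<partial>lborel) = (LINT x:ball 0 r|lborel. b x) - (\<integral>x. indicator (ball (0::'a) r) x *\<^sub>R c \<partial>lborel)"
      unfolding set_lebesgue_integral_def scaleR_diff_right by (rule Bochner_Integration.integral_diff[OF int1 ind])
    also have "(\<integral>x. indicator (ball (0::'a) r) x *\<^sub>R c \<partial>lborel) = V *\<^sub>R c"
      using v(2) emeasure_lborel_ball_finite[of "0::'a" r] by (subst integral_scaleR_left) auto
    finally show ?thesis by simp
  qed
  finally have "ball_mean b r - c = (\<integral>x. ?f x \<partial>lborel) /\<^sub>R V"
    using v(1) by (simp add: scaleR_add_right)
  then have "ennreal (norm (ball_mean b r - c)) = ennreal (1 / V) * ennreal (norm (\<integral>x. ?f x \<partial>lborel))"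
    using v(1) r by (simp add: divide_inverse flip: ennreal_mult)
  also have "ennreal (norm (\<integral>x. ?f x \<partial>lborel)) \<le> (\<integral>\<^sup>+x. ennreal (norm (?f x)) \<partial>lborel)"
    using int2 by (rule integral_norm_bound_ennreal)
  also have "\<dots> \<le> (\<integral>\<^sup>+x. indicator (ball 0 R) x * ennreal (norm (b x - c)) \<partial>lborel)"
    using r by (intro nn_integral_mono) (auto simp: indicator_def)
  finally show ?thesis
    by (simp add: mult_left_mono V_def)
qed

text \<open>Doubling the radius moves the mean by at most a multiple of N, and telescoping over |k -
  l| doublings gives linear growth. In the constant, \<open>D\<close> bounds the L^1 norm of the
  oscillation on the ball of radius R relative to R^n N, and 2^n appears because the division is by
  the volume of the ball of radius R / 2.\<close>

lemma dyadic_ball_mean_diff: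
  fixes b :: "'a::euclidean_space \<Rightarrow> complex"
  assumes [measurable]: "b \<in> borel_measurable borel" and int: "\<And>R. 0 < R \<Longrightarrow> set_integrable lborel (ball 0 R) b"
    and s: "1 \<le> s" "1 \<le> st" and N: "cmo_norm s st b = ennreal N" "0 \<le> N"
  defines "m \<equiv> \<lambda>k. ball_mean b (2 powr (real_of_int k + 1))"
  shows "\<exists>C\<ge>0. \<forall>k l. norm (m k - m l) \<le> C * \<bar>real_of_int (k - l)\<bar> * N"
proof -
  let ?n = "real DIM('a)"
  define D where "D = sphere_area DIM('a) powr (1 - 1 / st) * ((1 / ?n) powr (1 - 1 / s) * unit_ball_vol ?n powr (1 / s))"
  define C where "C = 2 powr ?n / unit_ball_vol ?n * D"
  have C: "0 \<le> C" by (auto simp: C_def D_def)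
  have step: "norm (m k - m (k + 1)) \<le> C * N" for k
  proof -
    define R :: real where "R = 2 powr (real_of_int (k + 1) + 1)"
    have R: "0 < R" "2 powr (real_of_int k + 1) = R / 2"
      by (auto simp: R_def powr_add)
    let ?F = "\<lambda>x. indicator (ball 0 R) x * ennreal (norm (b x - ball_mean b R))"
    have "(\<integral>\<^sup>+x. ?F x \<partial>lborel) = mixed_lp 1 1 ?F"
      by (rule nn_integral_eq_mixed_lp) auto
    also have "\<dots> \<le> ennreal (sphere_area DIM('a) powr (1 / 1 - 1 / st)) * mixed_lp 1 st ?F"
      using s by (intro mixed_lp_le_exponent) auto
    also have "\<dots> \<le> ennreal (sphere_area DIM('a) powr (1 / 1 - 1 / st))
        * (ennreal ((1 / ?n) powr (1 / 1 - 1 / s) * unit_ball_vol ?n powr (1 / s) * R powr (?n / 1)) * ennreal N)"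
      unfolding N(1)[symmetric] using s R by (intro mult_left_mono cmo_norm_ball_le_exponent) auto
    also have "\<dots> = ennreal (D * R powr ?n * N)"
      using N by (simp add: D_def flip: ennreal_mult)
    finally have F: "(\<integral>\<^sup>+x. ?F x \<partial>lborel) \<le> ennreal (D * R powr ?n * N)" .
    have "ennreal (norm (ball_mean b (R / 2) - ball_mean b R))
      \<le> ennreal (1 / (unit_ball_vol ?n * (R / 2) ^ DIM('a))) * (\<integral>\<^sup>+x. ?F x \<partial>lborel)"
      using R int by (intro norm_ball_mean_diff_le) auto
    also have "\<dots> \<le> ennreal (1 / (unit_ball_vol ?n * (R / 2) ^ DIM('a))) * ennreal (D * R powr ?n * N)"
      by (intro mult_left_mono F) auto
    also have "\<dots> = ennreal (1 / (unit_ball_vol ?n * (R / 2) ^ DIM('a)) * (D * R powr ?n * N))"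
      using R N by (subst ennreal_mult) (auto simp: D_def)
    also have "1 / (unit_ball_vol ?n * (R / 2) ^ DIM('a)) * (D * R powr ?n * N) = C * N"
      using R by (simp add: C_def powr_realpow field_simps)
    finally have "norm (ball_mean b (R / 2) - ball_mean b R) \<le> C * N"
      using C N by simp
    moreover have "m k = ball_mean b (R / 2)" "m (k + 1) = ball_mean b R"
      by (simp_all only: m_def R(2)) (simp only: R_def)
    ultimately show ?thesis by simp
  qed
  have nat: "norm (m k - m (k + int i)) \<le> C * real i * N" for k i
  proof (induction i)
    case (Suc i)
    have "norm (m k - m (k + int (Suc i))) \<le> norm (m k - m (k + int i)) + norm (m (k + int i) - m (k + int i + 1))"
      using norm_triangle_ineq[of "m k - m (k + int i)" "m (k + int i) - m (k + int i + 1)"]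
      by (simp add: algebra_simps)
    also have "\<dots> \<le> C * real i * N + C * N"
      by (intro add_mono Suc.IH step)
    finally show ?case by (simp add: algebra_simps)
  qed simp
  have "norm (m k - m l) \<le> C * \<bar>real_of_int (k - l)\<bar> * N" for k l
  proof (cases "k \<le> l")
    case True
    then show ?thesis using nat[of k "nat (l - k)"] by simp
  next
    case False
    then show ?thesis using nat[of l "nat (k - l)"] by (simp add: norm_minus_commute)
  qed
  with C show ?thesis by blast
qed

lemma shell_iff: "x \<in> shell k \<longleftrightarrow> norm x \<in> dyadic k"
  by (simp add: shell_def dyadic_def)

lemma borel_shell [measurable]: "(shell k :: 'a::euclidean_space set) \<in> sets borel"
proof -
  have "shell k = {x \<in> space (borel :: 'a measure). norm x \<in> dyadic k}"
    by (auto simp: shell_iff)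
  also have "\<dots> \<in> sets borel" by measurable
  finally show ?thesis .
qed

text \<open>The additive constant c is kept free, with a bound linear in c + N. In the pointwise
  estimate it is the part of |b x - b y| that does not depend on y; in the estimate of the outer
  norm it is N itself. \<open>D1\<close> comes from the constant function, \<open>D2\<close> from
  the oscillation, \<open>T\<close> from the quasi-triangle inequality.\<close>

lemma mixed_lp_shell_cmo_le:
  fixes b :: "'a::euclidean_space \<Rightarrow> complex"
  assumes [measurable]: "b \<in> borel_measurable borel"
    and e: "0 < e" "e \<le> s" "0 < st" and N: "cmo_norm s st b = ennreal N" "0 \<le> N"
  shows "\<exists>C\<ge>0. \<forall>k c. 0 \<le> c \<longrightarrow>
    mixed_lp e st (\<lambda>x. indicator (shell k) x * ennreal (c + norm (b x - ball_mean b (2 powr (real_of_int k + 1)))))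
    \<le> ennreal (C * 2 powr (real_of_int k * (DIM('a) / e)) * (c + N))"
proof -
  let ?n = "real DIM('a)"
  define D1 where "D1 = (1 / ?n) powr (1 / e) * sphere_area DIM('a) powr (1 / st)"
  define D2 where "D2 = (1 / ?n) powr (1 / e - 1 / s) * unit_ball_vol ?n powr (1 / s)"
  define T where "T = 2 powr (1 + 1 / e) * 2 powr (1 + 1 / st)"
  define C where "C = T * (D1 + D2) * 2 powr (?n / e)"
  have D: "0 \<le> D1" "0 \<le> D2" "0 \<le> T" by (auto simp: D1_def D2_def T_def)
  then have "0 \<le> C" by (simp add: C_def)
  moreover have "mixed_lp e st (\<lambda>x. indicator (shell k) x * ennreal (c + norm (b x - ball_mean b (2 powr (real_of_int k + 1)))))
    \<le> ennreal (C * 2 powr (real_of_int k * (?n / e)) * (c + N))" if c: "0 \<le> c" for k c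
  proof -
    \<comment> \<open>The exponent k + 1 rather than k: a shell contains its outer sphere, which the
      open ball of radius 2^k misses.\<close>
    define R :: real where "R = 2 powr (real_of_int k + 1)"
    have R: "0 < R" by (simp add: R_def)
    have shell_ball: "shell k \<subseteq> ball (0::'a) R"
    proof
      fix x :: 'a
      assume "x \<in> shell k"
      then have "norm x \<le> 2 powr real_of_int k" by (simp add: shell_def)
      also have "\<dots> < R" by (simp add: R_def)
      finally show "x \<in> ball 0 R" by simp
    qed
    let ?I = "indicator (ball 0 R) :: 'a \<Rightarrow> ennreal"
    have one: "mixed_lp e st ?I \<le> ennreal (D1 * R powr (?n / e))"
    proof -
      have "mixed_lp e st ?I = mixed_lp e st (\<lambda>x::'a. indicator {..<R} (norm x) * 1)"
        by (intro arg_cong[of _ _ "mixed_lp e st"]) (auto simp: indicator_def)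
      also have "\<dots> = lp_norm (radial_measure DIM('a)) e (\<lambda>\<rho>. indicator {..<R} \<rho> * ang_norm st (\<lambda>_::'a. 1) \<rho>)"
        using e by (intro mixed_lp_radial_mult) auto
      also have "ang_norm st (\<lambda>_::'a. 1) = (\<lambda>_. ennreal (sphere_area DIM('a) powr (1 / st)))"
        by (simp add: ang_norm_def lp_norm_def emeasure_surface_measure_space fun_eq_iff)
      also have "lp_norm (radial_measure DIM('a)) e (\<lambda>\<rho>. indicator {..<R} \<rho> * ennreal (sphere_area DIM('a) powr (1 / st)))
        = emeasure (radial_measure DIM('a)) {..<R} ennpowr (1 / e) * ennreal (sphere_area DIM('a) powr (1 / st))"
        using e by (simp add: lp_norm_multc lp_norm_indicator)
      also have "emeasure (radial_measure DIM('a)) {..<R} \<le> emeasure (radial_measure DIM('a)) {..R}"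
        by (intro emeasure_mono) auto
      also have "\<dots> = ennreal (R ^ DIM('a) / ?n)"
        using R by (simp add: emeasure_radial_measure_atMost)
      finally have "mixed_lp e st ?I \<le> ennreal (R ^ DIM('a) / ?n) ennpowr (1 / e) * ennreal (sphere_area DIM('a) powr (1 / st))"
        using e by (simp add: mult_right_mono ennpowr_mono)
      also have "\<dots> = ennreal ((R ^ DIM('a) / ?n) powr (1 / e) * sphere_area DIM('a) powr (1 / st))"
        using R by (simp flip: ennreal_mult)
      also have "(R ^ DIM('a) / ?n) powr (1 / e) * sphere_area DIM('a) powr (1 / st) = D1 * R powr (?n / e)"
      proof -
        have "(R ^ DIM('a) / ?n) powr (1 / e) = (1 / ?n) powr (1 / e) * (R powr ?n) powr (1 / e)"
          using R by (simp add: powr_realpow flip: powr_mult)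
        then show ?thesis
          by (simp add: D1_def powr_powr)
      qed
      finally show ?thesis .
    qed
    let ?G = "\<lambda>x. ?I x * ennreal (norm (b x - ball_mean b R))"
    have two: "mixed_lp e st ?G \<le> ennreal (D2 * R powr (?n / e) * N)"
      using cmo_norm_ball_le_exponent[OF assms(1) e R] N D by (simp add: D2_def flip: ennreal_mult)
    have "mixed_lp e st (\<lambda>x. indicator (shell k) x * ennreal (c + norm (b x - ball_mean b R)))
      \<le> mixed_lp e st (\<lambda>x. ennreal c * ?I x + ?G x)"
      using e shell_ball c by (intro mixed_lp_mono) (auto simp: indicator_def)
    also have "\<dots> \<le> ennreal T * (mixed_lp e st (\<lambda>x. ennreal c * ?I x) + mixed_lp e st ?G)"
      unfolding T_def using e by (intro mixed_lp_add_le) auto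
    also have "mixed_lp e st (\<lambda>x. ennreal c * ?I x) = ennreal c * mixed_lp e st ?I"
      using e by (intro mixed_lp_cmult) auto
    also have "ennreal T * (ennreal c * mixed_lp e st ?I + mixed_lp e st ?G)
      \<le> ennreal T * (ennreal c * ennreal (D1 * R powr (?n / e)) + ennreal (D2 * R powr (?n / e) * N))"
      by (intro mult_left_mono add_mono one two) auto
    also have "\<dots> = ennreal (T * (c * (D1 * R powr (?n / e)) + D2 * R powr (?n / e) * N))"
      using D c N by (simp flip: ennreal_mult ennreal_plus)
    also have "\<dots> \<le> ennreal (T * ((D1 + D2) * R powr (?n / e) * (c + N)))"
    proof (intro ennreal_leI mult_left_mono D)
      have "c * D1 + D2 * N \<le> (D1 + D2) * (c + N)"
        using D c N by (simp add: algebra_simps)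
      then have "(c * D1 + D2 * N) * R powr (?n / e) \<le> (D1 + D2) * (c + N) * R powr (?n / e)"
        by (intro mult_right_mono) auto
      then show "c * (D1 * R powr (?n / e)) + D2 * R powr (?n / e) * N \<le> (D1 + D2) * R powr (?n / e) * (c + N)"
        by (simp add: algebra_simps)
    qed
    also have "R powr (?n / e) = 2 powr (?n / e) * 2 powr (real_of_int k * (?n / e))"
      unfolding R_def powr_powr by (simp add: distrib_right add_divide_distrib add.commute flip: powr_add)
    also have "T * ((D1 + D2) * (2 powr (?n / e) * 2 powr (real_of_int k * (?n / e))) * (c + N))
      = C * 2 powr (real_of_int k * (?n / e)) * (c + N)"
      by (simp add: C_def)
    finally show ?thesis by (simp add: R_def)
  qed
  ultimately show ?thesis by blast
qed

section \<open>Bounds for Borel kernels\<close>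

lemma nn_integral_shells:
  fixes H :: "'a::euclidean_space \<Rightarrow> ennreal"
  assumes [measurable]: "H \<in> borel_measurable borel"
  shows "(\<integral>\<^sup>+y. H y \<partial>lborel) = (\<integral>\<^sup>+l. (\<integral>\<^sup>+y. indicator (shell l) y * H y \<partial>lborel) \<partial>count_space UNIV)"
proof -
  have "(\<integral>\<^sup>+y. H y \<partial>lborel) = (\<integral>\<^sup>+y. (\<integral>\<^sup>+l. indicator (shell l) y * H y \<partial>count_space UNIV) \<partial>lborel)"
  proof (rule nn_integral_cong_AE)
    show "AE y in lborel. H y = (\<integral>\<^sup>+l. indicator (shell l) y * H y \<partial>count_space UNIV)"
      using AE_lborel_singleton[of "0::'a"]
    proof eventually_elim
      case (elim y)
      then obtain k where k: "y \<in> shell k" "\<And>l. y \<in> shell l \<Longrightarrow> l = k"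
        using dyadic_ex1[of "norm y"] by (auto simp: shell_iff)
      have "(\<integral>\<^sup>+l. indicator (shell l) y * H y \<partial>count_space UNIV) = (\<integral>\<^sup>+l. H y * indicator {k} l \<partial>count_space UNIV)"
      proof (rule nn_integral_cong)
        fix l
        show "indicator (shell l) y * H y = H y * indicator {k} l"
        proof (cases "l = k")
          case True
          then show ?thesis using k(1) by simp
        next
          case False
          then have "y \<notin> shell l" using k(2) by blast
          with False show ?thesis by simp
        qed
      qed
      then show ?case by simp
    qed
  qed
  also have "\<dots> = (\<integral>\<^sup>+l. (\<integral>\<^sup>+y. indicator (shell l) y * H y \<partial>lborel) \<partial>count_space UNIV)"
    by (intro nn_integral_count_space_nn_integral) auto
  finally show ?thesis .
qed

text \<open>Borel form of the commutator integrand, with g in the role of the radial profile of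
  \<Phi>. \<open>D\<close> is |y| < |x|, |x| \<le> |y| or always true, and selects one of the three
  operators.\<close>

definition radial_integrand ::
  "(real \<Rightarrow> real \<Rightarrow> bool) \<Rightarrow> (real \<Rightarrow> complex) \<Rightarrow> ('a::euclidean_space \<Rightarrow> complex) \<Rightarrow> ('a \<Rightarrow> complex) \<Rightarrow> 'a \<Rightarrow> 'a \<Rightarrow> complex"
  where "radial_integrand D g b f x y =
    of_bool (D (norm x) (norm y)) * (g (norm x / norm y) / of_real (norm y ^ DIM('a)) * f y * (b x - b y))"

text \<open>Since f is integrated out, only its shell norms remain, and x is left in one factor, the
  distance of b x from the mean of its shell. The exponents of 2 in \<open>kernel\<close> are
  arranged for cancellation: the factor in l n / m against the norm of b on the shell l, already
  here, and the factor in k n / p against the norm of b on the shell k, when the outer norm is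
  taken.\<close>

lemma commutator_pointwise_bound:
  fixes g :: "real \<Rightarrow> complex" and b :: "'a::euclidean_space \<Rightarrow> complex" and D :: "real \<Rightarrow> real \<Rightarrow> bool"
    and \<alpha> \<epsilon> :: real
  assumes [measurable]: "g \<in> borel_measurable borel" "b \<in> borel_measurable borel"
      "Measurable.pred (borel \<Otimes>\<^sub>M borel) (\<lambda>z. D (fst z) (snd z))"
    and pt: "1 < pt" "1 < pt1" "0 < pt2" "1 / pt = 1 / pt1 + 1 / pt2"
    and r: "1 < r" "1 < r'" "1 / r + 1 / r' = 1" "0 < p" "0 < m" "1 / r = 1 / p + 1 / m"
    and s: "1 \<le> s" "m \<le> s"
    and int: "\<And>R. 0 < R \<Longrightarrow> set_integrable lborel (ball 0 R) b"
    and N: "cmo_norm s pt1 b = ennreal N" "0 \<le> N"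
    and \<epsilon>: "0 < \<epsilon>" and M: "0 \<le> M"
    and kernel: "\<And>k l \<rho>. \<rho> \<in> dyadic k \<Longrightarrow>
      lp_norm (radial_measure DIM('a)) r' (\<lambda>s. indicator (dyadic l) s * (of_bool (D \<rho> s) * ennreal (norm (g (\<rho> / s)) / s ^ DIM('a))))
      \<le> ennreal (M * 2 powr (- (2 * \<epsilon>) * \<bar>real_of_int (k - l)\<bar>) * 2 powr (real_of_int (l - k) * \<alpha>)
          * 2 powr (- (real_of_int k * (DIM('a) / p))) * 2 powr (- (real_of_int l * (DIM('a) / m))))"
  shows "\<exists>C\<ge>0. \<forall>f\<in>borel_measurable borel. \<forall>k. \<forall>x\<in>shell k.
    (\<integral>\<^sup>+y. ennreal (norm (radial_integrand D g b f x y)) \<partial>lborel)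
    \<le> ennreal (C * 2 powr (- (real_of_int k * (DIM('a) / p))) * (N + norm (b x - ball_mean b (2 powr (real_of_int k + 1)))))
      * (\<integral>\<^sup>+l. ennreal (2 powr (- \<epsilon> * \<bar>real_of_int (k - l)\<bar>) * 2 powr (real_of_int (l - k) * \<alpha>))
          * mixed_lp p pt2 (\<lambda>y. indicator (shell l) y * ennreal (norm (f y))) \<partial>count_space UNIV)"
proof -
  let ?n = "real DIM('a)" and ?\<mu> = "radial_measure DIM('a)"
  define mean where "mean k = ball_mean b (2 powr (real_of_int k + 1))" for k :: int
  have pt1: "0 < pt1" using pt by simp
  obtain C1 where "0 \<le> C1" and "\<forall>l c. 0 \<le> c \<longrightarrow>
      mixed_lp m pt1 (\<lambda>x. indicator (shell l) x * ennreal (c + norm (b x - mean l)))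
      \<le> ennreal (C1 * 2 powr (real_of_int l * (?n / m)) * (c + N))"
    using mixed_lp_shell_cmo_le[OF assms(2) r(5) s(2) pt1 N, folded mean_def] by blast
  then have C1: "0 \<le> C1" "\<And>l c. 0 \<le> c \<Longrightarrow>
      mixed_lp m pt1 (\<lambda>x. indicator (shell l) x * ennreal (c + norm (b x - mean l)))
      \<le> ennreal (C1 * 2 powr (real_of_int l * (?n / m)) * (c + N))"
    by auto
  obtain C2 where "0 \<le> C2" and "\<forall>k l. norm (mean k - mean l) \<le> C2 * \<bar>real_of_int (k - l)\<bar> * N"
    using dyadic_ball_mean_diff[OF assms(2) int s(1) less_imp_le[OF pt(2)] N, folded mean_def] by blast
  then have C2: "0 \<le> C2" "\<And>k l. norm (mean k - mean l) \<le> C2 * \<bar>real_of_int (k - l)\<bar> * N"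
    by auto
  define V where "V = sphere_area DIM('a) powr (1 - 1 / pt)"
  define L where "L = 1 + 1 / (\<epsilon> * ln 2)"
  define C where "C = V * M * C1 * (1 + C2) * L"
  have nonneg: "0 \<le> V" "0 \<le> L" "0 \<le> C"
    using \<epsilon> M C1 C2 by (auto simp: V_def L_def C_def)
  have main: "(\<integral>\<^sup>+y. ennreal (norm (radial_integrand D g b f x y)) \<partial>lborel)
    \<le> ennreal (C * 2 powr (- (real_of_int k * (?n / p))) * (N + norm (b x - mean k)))
      * (\<integral>\<^sup>+l. ennreal (2 powr (- \<epsilon> * \<bar>real_of_int (k - l)\<bar>) * 2 powr (real_of_int (l - k) * \<alpha>))
          * mixed_lp p pt2 (\<lambda>y. indicator (shell l) y * ennreal (norm (f y))) \<partial>count_space UNIV)"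
    if f[measurable]: "f \<in> borel_measurable borel" and x: "x \<in> shell k" for f :: "'a \<Rightarrow> complex" and k x
  proof -
    define \<rho> where "\<rho> = norm x"
    have \<rho>: "\<rho> \<in> dyadic k" using x by (simp add: \<rho>_def shell_iff)
    define u where "u = norm (b x - mean k)"
    have u: "0 \<le> u" by (simp add: u_def)
    define w where "w l s = indicator (dyadic l) s * (of_bool (D \<rho> s) * ennreal (norm (g (\<rho> / s)) / s ^ DIM('a)))" for l s
    define F where "F l y = indicator (shell l) y * ennreal (norm (f y))" for l y
    \<comment> \<open>Comes from splitting b x - b y through both means: \<open>c l\<close> collects
      the two terms without y, and the oscillation of b about the mean for its own shell stays in
      the integral.\<close>
    define c where "c l = u + norm (mean k - mean l)" for l
    define U where "U l y = indicator (shell l) y * ennreal (c l + norm (b y - mean l))" for l y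
    have [measurable]: "Measurable.pred borel (\<lambda>s. D \<rho> s)"
      using measurable_compose[OF measurable_Pair1' assms(3), of \<rho>] by simp
    have meas: "w l \<in> borel_measurable borel" "F l \<in> borel_measurable borel" "U l \<in> borel_measurable borel" for l
      unfolding w_def F_def U_def by measurable
    have shell_le: "(\<integral>\<^sup>+y. indicator (shell l) y * ennreal (norm (radial_integrand D g b f x y)) \<partial>lborel)
      \<le> ennreal (C * 2 powr (- (real_of_int k * (?n / p))) * (N + u))
        * (ennreal (2 powr (- \<epsilon> * \<bar>real_of_int (k - l)\<bar>) * 2 powr (real_of_int (l - k) * \<alpha>)) * mixed_lp p pt2 (F l))" for l
    proof -
      define J where "J = \<bar>real_of_int (k - l)\<bar>"
      have J: "0 \<le> J" by (simp add: J_def)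
      define E where "E = 2 powr (real_of_int (l - k) * \<alpha>) * 2 powr (- (real_of_int k * (?n / p)))"
      have E: "0 \<le> E" by (simp add: E_def)
      have "(\<integral>\<^sup>+y. indicator (shell l) y * ennreal (norm (radial_integrand D g b f x y)) \<partial>lborel)
        \<le> (\<integral>\<^sup>+y. w l (norm y) * (F l y * U l y) \<partial>lborel)"
      proof (rule nn_integral_mono)
        fix y :: 'a
        have "norm (b x - b y) \<le> norm (b x - mean k) + norm (mean k - mean l) + norm (b y - mean l)"
          using norm_triangle_ineq4[of "(b x - mean k) + (mean k - mean l)" "b y - mean l"]
            norm_triangle_ineq[of "b x - mean k" "mean k - mean l"] by simp
        then have "norm (b x - b y) \<le> c l + norm (b y - mean l)"
          by (simp add: c_def u_def)
        then have le: "norm (g (\<rho> / norm y)) / norm y ^ DIM('a) * norm (f y) * norm (b x - b y)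
          \<le> norm (g (\<rho> / norm y)) / norm y ^ DIM('a) * norm (f y) * (c l + norm (b y - mean l))"
          by (intro mult_left_mono) auto
        have "ennreal x1 * (ennreal x2 * ennreal x3) = ennreal (x1 * x2 * x3)"
          if "0 \<le> x1" "0 \<le> x2" "0 \<le> x3" for x1 x2 x3
          using that by (simp add: mult.assoc flip: ennreal_mult)
        moreover have "0 \<le> c l" using u by (simp add: c_def)
        ultimately have "ennreal (norm (g (\<rho> / norm y)) / norm y ^ DIM('a) * norm (f y) * norm (b x - b y))
          \<le> ennreal (norm (g (\<rho> / norm y)) / norm y ^ DIM('a)) * (ennreal (norm (f y)) * ennreal (c l + norm (b y - mean l)))"
          using le by (simp only: ennreal_leI norm_ge_zero add_nonneg_nonneg divide_nonneg_nonneg zero_le_power)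
        then show "indicator (shell l) y * ennreal (norm (radial_integrand D g b f x y)) \<le> w l (norm y) * (F l y * U l y)"
          by (auto simp: w_def F_def U_def radial_integrand_def indicator_def shell_iff \<rho>_def
              norm_mult norm_divide norm_power)
      qed
      also have "\<dots> \<le> ennreal V * (lp_norm ?\<mu> r' (w l) * (mixed_lp p pt2 (F l) * mixed_lp m pt1 (U l)))"
        unfolding V_def using pt pt1 r by (intro nn_integral_mixed_Holder[where r=r] meas) auto
      also have "\<dots> \<le> ennreal V * (ennreal (M * 2 powr (- (2 * \<epsilon>) * J) * E * 2 powr (- (real_of_int l * (?n / m))))
          * (mixed_lp p pt2 (F l) * ennreal (C1 * 2 powr (real_of_int l * (?n / m)) * (c l + N))))"
      proof (intro mult_left_mono mult_mono)
        show "lp_norm ?\<mu> r' (w l) \<le> ennreal (M * 2 powr (- (2 * \<epsilon>) * J) * E * 2 powr (- (real_of_int l * (?n / m))))"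
          unfolding w_def[abs_def] using kernel[OF \<rho>, of l] by (simp add: J_def E_def mult_ac)
        show "mixed_lp m pt1 (U l) \<le> ennreal (C1 * 2 powr (real_of_int l * (?n / m)) * (c l + N))"
          unfolding U_def[abs_def] using C1(2)[of "c l" l] u by (simp add: c_def)
      qed auto
      also have "\<dots> = ennreal (V * (M * 2 powr (- (2 * \<epsilon>) * J) * E * 2 powr (- (real_of_int l * (?n / m)))
          * (C1 * 2 powr (real_of_int l * (?n / m)) * (c l + N)))) * mixed_lp p pt2 (F l)"
      proof -
        have "ennreal x1 * (ennreal x2 * (z * ennreal x3)) = ennreal (x1 * (x2 * x3)) * z"
          if "0 \<le> x1" "0 \<le> x2" "0 \<le> x3" for x1 x2 x3 z
          using that by (simp add: ennreal_mult mult_ac)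
        then show ?thesis
          using nonneg M E C1 N u by (simp add: c_def)
      qed
      also have "\<dots> \<le> ennreal (C * (2 powr (- \<epsilon> * J) * E) * (N + u)) * mixed_lp p pt2 (F l)"
      proof (intro mult_right_mono ennreal_leI)
        have "2 powr (- (real_of_int l * (?n / m))) * 2 powr (real_of_int l * (?n / m)) = (1::real)"
          by (simp flip: powr_add)
        then have "V * (M * 2 powr (- (2 * \<epsilon>) * J) * E * 2 powr (- (real_of_int l * (?n / m)))
            * (C1 * 2 powr (real_of_int l * (?n / m)) * (c l + N)))
          = V * M * C1 * E * (2 powr (- (2 * \<epsilon>) * J) * (c l + N))"
          by (simp add: mult_ac)
        also have "\<dots> \<le> V * M * C1 * E * (2 powr (- (2 * \<epsilon>) * J) * ((1 + C2) * (1 + J) * (N + u)))"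
        proof (intro mult_left_mono)
          have "c l + N \<le> u + C2 * J * N + N"
            using C2(2)[of k l] by (simp add: c_def J_def)
          also have "\<dots> \<le> (1 + C2) * (1 + J) * (N + u)"
            using J C2(1) N u by (simp add: algebra_simps)
          finally show "c l + N \<le> (1 + C2) * (1 + J) * (N + u)" .
        qed (use nonneg M E C1 in auto)
        also have "\<dots> = V * M * C1 * E * (1 + C2) * (N + u) * ((1 + J) * 2 powr (- (2 * \<epsilon>) * J))"
          by (simp add: mult_ac)
        also have "\<dots> \<le> V * M * C1 * E * (1 + C2) * (N + u) * (L * 2 powr (- \<epsilon> * J))"
          unfolding L_def using nonneg M E C1 C2 N u J by (intro mult_left_mono linear_exp_le_exp \<epsilon>) auto
        also have "\<dots> = C * (2 powr (- \<epsilon> * J) * E) * (N + u)"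
          by (simp add: C_def mult_ac)
        finally show "V * (M * 2 powr (- (2 * \<epsilon>) * J) * E * 2 powr (- (real_of_int l * (?n / m)))
            * (C1 * 2 powr (real_of_int l * (?n / m)) * (c l + N))) \<le> C * (2 powr (- \<epsilon> * J) * E) * (N + u)" .
      qed auto
      also have "\<dots> = ennreal (C * 2 powr (- (real_of_int k * (?n / p))) * (N + u))
        * (ennreal (2 powr (- \<epsilon> * J) * 2 powr (real_of_int (l - k) * \<alpha>)) * mixed_lp p pt2 (F l))"
      proof -
        have eq: "C * (2 powr (- \<epsilon> * J) * E) * (N + u)
          = (C * 2 powr (- (real_of_int k * (?n / p))) * (N + u)) * (2 powr (- \<epsilon> * J) * 2 powr (real_of_int (l - k) * \<alpha>))"
          by (simp add: E_def mult_ac)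
        then show ?thesis
          unfolding eq mult.assoc[of "ennreal _", symmetric]
          using nonneg N u by (subst ennreal_mult[symmetric]) (auto simp only: mult_nonneg_nonneg add_nonneg_nonneg powr_ge_zero)
      qed
      finally show ?thesis by (simp add: J_def)
    qed
    have [measurable]: "(\<lambda>y. ennreal (norm (radial_integrand D g b f x y))) \<in> borel_measurable borel"
      unfolding radial_integrand_def \<rho>_def[symmetric] by measurable
    have "(\<integral>\<^sup>+y. ennreal (norm (radial_integrand D g b f x y)) \<partial>lborel)
      = (\<integral>\<^sup>+l. (\<integral>\<^sup>+y. indicator (shell l) y * ennreal (norm (radial_integrand D g b f x y)) \<partial>lborel) \<partial>count_space UNIV)"
      by (rule nn_integral_shells) measurable
    also have "\<dots> \<le> (\<integral>\<^sup>+l. ennreal (C * 2 powr (- (real_of_int k * (?n / p))) * (N + u))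
        * (ennreal (2 powr (- \<epsilon> * \<bar>real_of_int (k - l)\<bar>) * 2 powr (real_of_int (l - k) * \<alpha>)) * mixed_lp p pt2 (F l)) \<partial>count_space UNIV)"
      by (intro nn_integral_mono shell_le)
    also have "\<dots> = ennreal (C * 2 powr (- (real_of_int k * (?n / p))) * (N + u))
        * (\<integral>\<^sup>+l. ennreal (2 powr (- \<epsilon> * \<bar>real_of_int (k - l)\<bar>) * 2 powr (real_of_int (l - k) * \<alpha>)) * mixed_lp p pt2 (F l) \<partial>count_space UNIV)"
      by (intro nn_integral_cmult) auto
    finally show ?thesis
      by (simp add: u_def F_def[abs_def])
  qed
  show ?thesis
    using nonneg(3) main[unfolded mean_def] by blast
qed

text \<open>The Herz weight at k times 2^((l - k) \<alpha>) is the Herz weight at l, so a pure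
  convolution kernel in k - l is left.\<close>

lemma weighted_sum_scale:
  fixes a :: "int \<Rightarrow> ennreal"
  shows "ennreal (2 powr (real_of_int k * \<alpha>)) *
      (\<integral>\<^sup>+l. ennreal (2 powr (- \<epsilon> * \<bar>real_of_int (k - l)\<bar>) * 2 powr (real_of_int (l - k) * \<alpha>)) * a l \<partial>count_space UNIV)
    = (\<integral>\<^sup>+l. ennreal (2 powr (- \<epsilon> * \<bar>real_of_int (k - l)\<bar>)) * (ennreal (2 powr (real_of_int l * \<alpha>)) * a l) \<partial>count_space UNIV)"
    (is "_ * ?S = _")
proof -
  have "ennreal (2 powr (real_of_int k * \<alpha>)) * ?S
    = (\<integral>\<^sup>+l. ennreal (2 powr (real_of_int k * \<alpha>)) * (ennreal (2 powr (- \<epsilon> * \<bar>real_of_int (k - l)\<bar>) * 2 powr (real_of_int (l - k) * \<alpha>)) * a l) \<partial>count_space UNIV)"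
    by (intro nn_integral_cmult[symmetric]) auto
  also have "\<dots> = (\<integral>\<^sup>+l. ennreal (2 powr (- \<epsilon> * \<bar>real_of_int (k - l)\<bar>)) * (ennreal (2 powr (real_of_int l * \<alpha>)) * a l) \<partial>count_space UNIV)"
  proof (rule nn_integral_cong)
    fix l
    have "2 powr (real_of_int k * \<alpha>) * (2 powr (- \<epsilon> * \<bar>real_of_int (k - l)\<bar>) * 2 powr (real_of_int (l - k) * \<alpha>))
      = 2 powr (- \<epsilon> * \<bar>real_of_int (k - l)\<bar>) * 2 powr (real_of_int l * \<alpha>)"
      by (simp add: algebra_simps flip: powr_add)
    then have "ennreal (2 powr (real_of_int k * \<alpha>)) * ennreal (2 powr (- \<epsilon> * \<bar>real_of_int (k - l)\<bar>) * 2 powr (real_of_int (l - k) * \<alpha>))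
      = ennreal (2 powr (- \<epsilon> * \<bar>real_of_int (k - l)\<bar>)) * ennreal (2 powr (real_of_int l * \<alpha>))"
      by (simp flip: ennreal_mult)
    then show "ennreal (2 powr (real_of_int k * \<alpha>)) * (ennreal (2 powr (- \<epsilon> * \<bar>real_of_int (k - l)\<bar>) * 2 powr (real_of_int (l - k) * \<alpha>)) * a l)
      = ennreal (2 powr (- \<epsilon> * \<bar>real_of_int (k - l)\<bar>)) * (ennreal (2 powr (real_of_int l * \<alpha>)) * a l)"
      by (simp only: mult.assoc[symmetric])
  qed
  finally show ?thesis .
qed

text \<open>On a shell the sum over l is a constant, so the outer norm acts on b alone. That is why
  p \<le> s and \<open>pt\<close> \<le> \<open>pt1\<close> are the conditions here: the angular
  exponent is lowered from \<open>pt1\<close> to \<open>pt\<close> on the sphere, and the exponent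
  \<open>pt2\<close> has been used up by f. Quantifying over all \<open>a\<close> and
  \<open>G\<close> makes the constant independent of f.\<close>

lemma herz_bound_of_pointwise:
  fixes b :: "'a::euclidean_space \<Rightarrow> complex" and \<alpha> \<epsilon> :: real
  assumes [measurable]: "b \<in> borel_measurable borel"
    and pt: "0 < pt" "pt \<le> pt1" and p: "0 < p" "p \<le> s" and q: "0 < q" and \<epsilon>: "0 < \<epsilon>" and C0: "0 \<le> C0"
    and N: "cmo_norm s pt1 b = ennreal N" "0 \<le> N"
  shows "\<exists>C::real. \<forall>(a :: int \<Rightarrow> ennreal) (G :: 'a \<Rightarrow> ennreal).
    (\<forall>k. \<forall>x\<in>shell k. G x
      \<le> ennreal (C0 * 2 powr (- (real_of_int k * (DIM('a) / p))) * (N + norm (b x - ball_mean b (2 powr (real_of_int k + 1)))))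
      * (\<integral>\<^sup>+l. ennreal (2 powr (- \<epsilon> * \<bar>real_of_int (k - l)\<bar>) * 2 powr (real_of_int (l - k) * \<alpha>)) * a l \<partial>count_space UNIV))
    \<longrightarrow> lp_norm (count_space UNIV) q (\<lambda>k. ennreal (2 powr (real_of_int k * \<alpha>)) * mixed_lp p pt (\<lambda>x. indicator (shell k) x * G x))
      \<le> ennreal C * lp_norm (count_space UNIV) q (\<lambda>k. ennreal (2 powr (real_of_int k * \<alpha>)) * a k)"
proof -
  let ?n = "real DIM('a)"
  define mean where "mean k = ball_mean b (2 powr (real_of_int k + 1))" for k :: int
  have pt1: "0 < pt1" using pt by simp
  obtain C1 where "0 \<le> C1" and "\<forall>l c. 0 \<le> c \<longrightarrow>
      mixed_lp p pt1 (\<lambda>x. indicator (shell l) x * ennreal (c + norm (b x - mean l)))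
      \<le> ennreal (C1 * 2 powr (real_of_int l * (?n / p)) * (c + N))"
    using mixed_lp_shell_cmo_le[OF assms(1) p pt1 N, folded mean_def] by blast
  then have C1: "0 \<le> C1" "\<And>l c. 0 \<le> c \<Longrightarrow>
      mixed_lp p pt1 (\<lambda>x. indicator (shell l) x * ennreal (c + norm (b x - mean l)))
      \<le> ennreal (C1 * 2 powr (real_of_int l * (?n / p)) * (c + N))"
    by auto
  obtain C2 where C2: "\<And>a::int \<Rightarrow> ennreal.
    lp_norm (count_space UNIV) q
      (\<lambda>k. \<integral>\<^sup>+l. ennreal (2 powr (- \<epsilon> * \<bar>real_of_int (k - l)\<bar>)) * a l \<partial>count_space UNIV)
    \<le> ennreal C2 * lp_norm (count_space UNIV) q a"
    using lp_norm_int_convolution[OF \<epsilon> q] by blast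
  define V where "V = sphere_area DIM('a) powr (1 / pt - 1 / pt1)"
  define C3 where "C3 = C0 * V * C1 * (N + N)"
  have V: "0 \<le> V" and C3: "0 \<le> C3" using C0 C1 N by (auto simp: V_def C3_def)
  have "lp_norm (count_space UNIV) q (\<lambda>k. ennreal (2 powr (real_of_int k * \<alpha>)) * mixed_lp p pt (\<lambda>x. indicator (shell k) x * G x))
      \<le> ennreal (C3 * C2) * lp_norm (count_space UNIV) q (\<lambda>k. ennreal (2 powr (real_of_int k * \<alpha>)) * a k)"
    if G: "\<And>k x. x \<in> shell k \<Longrightarrow> G x
      \<le> ennreal (C0 * 2 powr (- (real_of_int k * (?n / p))) * (N + norm (b x - mean k)))
      * (\<integral>\<^sup>+l. ennreal (2 powr (- \<epsilon> * \<bar>real_of_int (k - l)\<bar>) * 2 powr (real_of_int (l - k) * \<alpha>)) * a l \<partial>count_space UNIV)"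
    for a :: "int \<Rightarrow> ennreal" and G :: "'a \<Rightarrow> ennreal"
  proof -
    define S where "S k = (\<integral>\<^sup>+l. ennreal (2 powr (- \<epsilon> * \<bar>real_of_int (k - l)\<bar>) * 2 powr (real_of_int (l - k) * \<alpha>)) * a l \<partial>count_space UNIV)" for k
    have shell_le: "mixed_lp p pt (\<lambda>x. indicator (shell k) x * G x) \<le> ennreal C3 * S k" for k
    proof -
      let ?d = "C0 * 2 powr (- (real_of_int k * (?n / p)))"
      let ?H = "\<lambda>x. indicator (shell k) x * ennreal (N + norm (b x - mean k))"
      have "mixed_lp p pt (\<lambda>x. indicator (shell k) x * G x) \<le> mixed_lp p pt (\<lambda>x. (ennreal ?d * S k) * ?H x)"
      proof (intro mixed_lp_mono p pt)
        fix x
        show "indicator (shell k) x * G x \<le> ennreal ?d * S k * ?H x"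
        proof (cases "x \<in> shell k")
          case True
          have "ennreal (?d * (N + norm (b x - mean k))) = ennreal ?d * ennreal (N + norm (b x - mean k))"
            using C0 N by (intro ennreal_mult) auto
          then show ?thesis
            using G[OF True] True by (simp add: S_def mult_ac)
        qed simp
      qed
      also have "\<dots> = (ennreal ?d * S k) * mixed_lp p pt ?H"
        using p pt by (intro mixed_lp_cmult) auto
      also have "\<dots> \<le> (ennreal ?d * S k) * (ennreal V * ennreal (C1 * 2 powr (real_of_int k * (?n / p)) * (N + N)))"
      proof (intro mult_left_mono)
        have "mixed_lp p pt ?H \<le> ennreal V * mixed_lp p pt1 ?H"
          unfolding V_def using p pt by (intro mixed_lp_le_exponent) auto
        also have "\<dots> \<le> ennreal V * ennreal (C1 * 2 powr (real_of_int k * (?n / p)) * (N + N))"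
          by (intro mult_left_mono C1(2) N) auto
        finally show "mixed_lp p pt ?H \<le> ennreal V * ennreal (C1 * 2 powr (real_of_int k * (?n / p)) * (N + N))" .
      qed auto
      also have "\<dots> = ennreal (?d * (V * (C1 * 2 powr (real_of_int k * (?n / p)) * (N + N)))) * S k"
      proof -
        have "ennreal x1 * z * (ennreal x2 * ennreal x3) = ennreal (x1 * (x2 * x3)) * z"
          if "0 \<le> x1" "0 \<le> x2" "0 \<le> x3" for x1 x2 x3 z
          using that by (simp add: ennreal_mult mult_ac)
        then show ?thesis using C0 V C1 N by simp
      qed
      also have "?d * (V * (C1 * 2 powr (real_of_int k * (?n / p)) * (N + N)))
        = C3 * (2 powr (- (real_of_int k * (?n / p))) * 2 powr (real_of_int k * (?n / p)))"
        by (simp add: C3_def mult_ac)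
      also have "\<dots> = C3"
        by (simp flip: powr_add)
      finally show ?thesis .
    qed
    have "lp_norm (count_space UNIV) q (\<lambda>k. ennreal (2 powr (real_of_int k * \<alpha>)) * mixed_lp p pt (\<lambda>x. indicator (shell k) x * G x))
      \<le> lp_norm (count_space UNIV) q (\<lambda>k. ennreal C3 * (ennreal (2 powr (real_of_int k * \<alpha>)) * S k))"
    proof (intro lp_norm_mono q)
      fix k
      have "ennreal (2 powr (real_of_int k * \<alpha>)) * mixed_lp p pt (\<lambda>x. indicator (shell k) x * G x)
        \<le> ennreal (2 powr (real_of_int k * \<alpha>)) * (ennreal C3 * S k)"
        by (intro mult_left_mono shell_le) auto
      then show "ennreal (2 powr (real_of_int k * \<alpha>)) * mixed_lp p pt (\<lambda>x. indicator (shell k) x * G x)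
        \<le> ennreal C3 * (ennreal (2 powr (real_of_int k * \<alpha>)) * S k)"
        by (simp add: mult.left_commute)
    qed
    also have "\<dots> = ennreal C3 * lp_norm (count_space UNIV) q (\<lambda>k. ennreal (2 powr (real_of_int k * \<alpha>)) * S k)"
      using q by (intro lp_norm_cmult) auto
    also have "\<dots> \<le> ennreal C3 * (ennreal C2 * lp_norm (count_space UNIV) q (\<lambda>k. ennreal (2 powr (real_of_int k * \<alpha>)) * a k))"
      unfolding S_def weighted_sum_scale by (intro mult_left_mono C2) auto
    also have "\<dots> = ennreal (C3 * C2) * lp_norm (count_space UNIV) q (\<lambda>k. ennreal (2 powr (real_of_int k * \<alpha>)) * a k)"
      using C3 by (simp add: ennreal_mult' mult.assoc)
    finally show ?thesis .
  qed
  then show ?thesis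
    unfolding mean_def by (intro exI[of _ "C3 * C2"]) blast
qed

section \<open>Kernel decay and Borel versions\<close>

text \<open>A normal form of the kernel bound in which each exponential has a partner: |k - l| feeds
  the convolution, (l - k) \<alpha> the Herz weights, k n / p and l n / m the norms of b on the two
  shells. It is a condition on a single pair of shells, so that it can be imposed on one side of the
  diagonal only.\<close>

definition kernel_decay ::
  "(real \<Rightarrow> complex) \<Rightarrow> nat \<Rightarrow> real \<Rightarrow> real \<Rightarrow> real \<Rightarrow> real \<Rightarrow> real \<Rightarrow> real \<Rightarrow> int \<Rightarrow> int \<Rightarrow> bool" where
  "kernel_decay g n r' p m \<alpha> \<epsilon> M k l \<longleftrightarrow> (\<forall>\<rho>\<in>dyadic k.
    lp_norm (radial_measure n) r' (\<lambda>s. indicator (dyadic l) s * ennreal (norm (g (\<rho> / s)) / s ^ n))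
      \<le> ennreal (M * 2 powr (- (2 * \<epsilon>) * \<bar>real_of_int (k - l)\<bar>) * 2 powr (real_of_int (l - k) * \<alpha>)
          * 2 powr (- (real_of_int k * (n / p))) * 2 powr (- (real_of_int l * (n / m)))))"

lemma kernel_decay_mono:
  assumes "kernel_decay g n r' p m \<alpha> \<epsilon> M k l" "\<epsilon>' \<le> \<epsilon>" "0 \<le> M" "M \<le> M'"
  shows "kernel_decay g n r' p m \<alpha> \<epsilon>' M' k l"
proof -
  have "2 powr (- (2 * \<epsilon>) * \<bar>real_of_int (k - l)\<bar>) \<le> 2 powr (- (2 * \<epsilon>') * \<bar>real_of_int (k - l)\<bar>)"
    using assms(2) by (intro powr_mono) (auto intro!: mult_right_mono)
  then have "M * 2 powr (- (2 * \<epsilon>) * \<bar>real_of_int (k - l)\<bar>) * 2 powr (real_of_int (l - k) * \<alpha>)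
          * 2 powr (- (real_of_int k * (n / p))) * 2 powr (- (real_of_int l * (n / m)))
    \<le> M' * 2 powr (- (2 * \<epsilon>') * \<bar>real_of_int (k - l)\<bar>) * 2 powr (real_of_int (l - k) * \<alpha>)
          * 2 powr (- (real_of_int k * (n / p))) * 2 powr (- (real_of_int l * (n / m)))"
    using assms(3,4) by (intro mult_right_mono mult_mono) auto
  then show ?thesis
    using assms(1) unfolding kernel_decay_def by (meson ennreal_leI order_trans)
qed

text \<open>The identity 1 - 1 / r' = 1 / p + 1 / m rewrites the exponent of
  \<open>lp_norm_kernel_le\<close> in normal form with one surplus term (l - k) \<delta>, where
  \<delta> = \<gamma> / r' - n / p - \<alpha>. Where this term is nonpositive it equals - |\<delta>|
  |k - l|, hence the rate |\<delta>| / 2.\<close>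

lemma kernel_decay_of_integrable:
  fixes g :: "real \<Rightarrow> complex" and n :: nat and \<gamma> \<alpha> r r' p m :: real
  assumes g: "g \<in> borel_measurable borel" and n: "0 < n" and r: "1 < r'" "1 / r + 1 / r' = 1" "1 / r = 1 / p + 1 / m"
    and K: "(\<integral>\<^sup>+t\<in>{0<..}. ennreal (norm (g t) powr r' * t powr (\<gamma> - 1)) \<partial>lborel) < \<infinity>"
  shows "\<exists>M\<ge>0. \<forall>k l. real_of_int (l - k) * (\<gamma> / r' - n / p - \<alpha>) \<le> 0
    \<longrightarrow> kernel_decay g n r' p m \<alpha> (\<bar>\<gamma> / r' - n / p - \<alpha>\<bar> / 2) M k l"
proof -
  define \<delta> where "\<delta> = \<gamma> / r' - n / p - \<alpha>"
  define K' where "K' = enn2real ((\<integral>\<^sup>+t\<in>{0<..}. ennreal (norm (g t) powr r' * t powr (\<gamma> - 1)) \<partial>lborel) ennpowr (1 / r'))"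
  have K': "(\<integral>\<^sup>+t\<in>{0<..}. ennreal (norm (g t) powr r' * t powr (\<gamma> - 1)) \<partial>lborel) ennpowr (1 / r') = ennreal K'" "0 \<le> K'"
    unfolding K'_def using K by (simp_all add: less_top)
  define c where "c = 2 powr ((\<bar>\<gamma> - n * (r' - 1)\<bar> + \<bar>\<gamma>\<bar>) / r')"
  have "kernel_decay g n r' p m \<alpha> (\<bar>\<delta>\<bar> / 2) (c * K') k l" if kl: "real_of_int (l - k) * \<delta> \<le> 0" for k l
    unfolding kernel_decay_def
  proof
    fix \<rho> assume \<rho>: "\<rho> \<in> dyadic k"
    have "(of_int l - of_int k) * (\<gamma> / r') - real_of_int l * real n * (1 - 1 / r')
      = (of_int l - of_int k) * (\<delta> + n / p + \<alpha>) - real_of_int l * real n * (1 / p + 1 / m)"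
      using r by (simp add: \<delta>_def)
    also have "\<dots> = real_of_int (l - k) * \<delta> + real_of_int (l - k) * \<alpha> - real_of_int k * (n / p) - real_of_int l * (n / m)"
      by (simp add: algebra_simps)
    also have "real_of_int (l - k) * \<delta> = - (2 * (\<bar>\<delta>\<bar> / 2)) * \<bar>real_of_int (k - l)\<bar>"
    proof -
      have "real_of_int (l - k) * \<delta> = - \<bar>real_of_int (l - k) * \<delta>\<bar>"
        using kl by linarith
      also have "\<dots> = - (2 * (\<bar>\<delta>\<bar> / 2)) * \<bar>real_of_int (k - l)\<bar>"
        by (simp add: abs_mult abs_minus_commute)
      finally show ?thesis .
    qed
    finally have "2 powr ((of_int l - of_int k) * (\<gamma> / r') - real_of_int l * real n * (1 - 1 / r'))
      = 2 powr (- (2 * (\<bar>\<delta>\<bar> / 2)) * \<bar>real_of_int (k - l)\<bar>) * 2 powr (real_of_int (l - k) * \<alpha>)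
        * 2 powr (- (real_of_int k * (n / p))) * 2 powr (- (real_of_int l * (n / m)))"
      by (simp only: diff_conv_add_uminus powr_add)
    then show "lp_norm (radial_measure n) r' (\<lambda>s. indicator (dyadic l) s * ennreal (norm (g (\<rho> / s)) / s ^ n))
      \<le> ennreal (c * K' * 2 powr (- (2 * (\<bar>\<delta>\<bar> / 2)) * \<bar>real_of_int (k - l)\<bar>) * 2 powr (real_of_int (l - k) * \<alpha>)
          * 2 powr (- (real_of_int k * (n / p))) * 2 powr (- (real_of_int l * (n / m))))"
      using lp_norm_kernel_le[OF g r(1) n \<rho>, of l \<gamma>] K'
      by (simp add: c_def mult_ac flip: ennreal_mult)
  qed
  then show ?thesis
    using K'(2) by (intro exI[of _ "c * K'"]) (auto simp: \<delta>_def c_def)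
qed

text \<open>Decay is asked only for pairs of shells joined by \<open>D\<close>; for any other pair
  the restricted kernel vanishes on the whole dyadic interval.\<close>

lemma kernel_decay_restrict:
  fixes D :: "real \<Rightarrow> real \<Rightarrow> bool" and n :: nat
  assumes decay: "\<And>k l \<rho> s. \<rho> \<in> dyadic k \<Longrightarrow> s \<in> dyadic l \<Longrightarrow> D \<rho> s \<Longrightarrow> kernel_decay g n r' p m \<alpha> \<epsilon> M k l"
    and r': "0 < r'" and \<rho>: "\<rho> \<in> dyadic k"
  shows "lp_norm (radial_measure n) r' (\<lambda>s. indicator (dyadic l) s * (of_bool (D \<rho> s) * ennreal (norm (g (\<rho> / s)) / s ^ n)))
      \<le> ennreal (M * 2 powr (- (2 * \<epsilon>) * \<bar>real_of_int (k - l)\<bar>) * 2 powr (real_of_int (l - k) * \<alpha>)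
          * 2 powr (- (real_of_int k * (n / p))) * 2 powr (- (real_of_int l * (n / m))))"
    (is "?L \<le> ?R")
proof (cases "\<exists>s\<in>dyadic l. D \<rho> s")
  case True
  then have "kernel_decay g n r' p m \<alpha> \<epsilon> M k l"
    using decay \<rho> by blast
  then have "lp_norm (radial_measure n) r' (\<lambda>s. indicator (dyadic l) s * ennreal (norm (g (\<rho> / s)) / s ^ n)) \<le> ?R"
    using \<rho> by (simp add: kernel_decay_def)
  moreover have "?L \<le> lp_norm (radial_measure n) r' (\<lambda>s. indicator (dyadic l) s * ennreal (norm (g (\<rho> / s)) / s ^ n))"
    using r' by (intro lp_norm_mono) (auto simp: indicator_def)
  ultimately show ?thesis by (rule order_trans[rotated])
next
  case False
  then have "?L = lp_norm (radial_measure n) r' (\<lambda>s. 0)"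
    by (intro lp_norm_cong) (auto simp: indicator_def)
  then show ?thesis by (simp add: lp_norm_def)
qed

lemma lp_norm_count_space_ge:
  assumes "0 < q"
  shows "a k \<le> lp_norm (count_space UNIV) q a"
proof -
  have "a k ennpowr q = (\<integral>\<^sup>+l. a l ennpowr q * indicator {k} l \<partial>count_space UNIV)"
    by simp
  also have "\<dots> \<le> (\<integral>\<^sup>+l. a l ennpowr q \<partial>count_space UNIV)"
    by (intro nn_integral_mono) (auto simp: indicator_def)
  finally have "(a k ennpowr q) ennpowr (1 / q) \<le> lp_norm (count_space UNIV) q a"
    unfolding lp_norm_def using assms by (intro ennpowr_mono) auto
  then show ?thesis using assms by (simp add: ennpowr_inverse_cancel)
qed

lemma herz_norm_eq_lp_norm:
  assumes "0 < q"
  shows "herz_norm \<alpha> q p pt f = lp_norm (count_space UNIV) q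
    (\<lambda>k. ennreal (2 powr (real_of_int k * \<alpha>)) * mixed_norm p pt (\<lambda>x. indicator (shell k) x *\<^sub>R f x))"
  using assms by (simp add: herz_norm_def lp_norm_def infsum_int_eq_nn_integral ennpowr_mult powr_powr)

section \<open>Borel versions of Lebesgue measurable functions\<close>

lemma lebesgue_measurable_borel_version:
  fixes f :: "'a::euclidean_space \<Rightarrow> complex"
  assumes "f \<in> borel_measurable lebesgue"
  obtains f' where "f' \<in> borel_measurable borel" "AE x in lborel. f x = f' x"
proof -
  have "(\<lambda>x. Re (f x)) \<in> borel_measurable lebesgue" "(\<lambda>x. Im (f x)) \<in> borel_measurable lebesgue"
    using assms by measurable
  then obtain u v where uv: "u \<in> borel_measurable lborel" "AE x in lborel. Re (f x) = u x"
      "v \<in> borel_measurable lborel" "AE x in lborel. Im (f x) = v x"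
    by (metis completion_ex_borel_measurable_real)
  show ?thesis
  proof
    show "(\<lambda>x. Complex (u x) (v x)) \<in> borel_measurable borel"
      using uv(1,3) by (simp add: Complex_eq)
    show "AE x in lborel. f x = Complex (u x) (v x)"
      using uv(2,4) by eventually_elim (simp add: complex_eq_iff)
  qed
qed

lemma lebesgue_measurable_cong_AE:
  fixes f f' :: "'a::euclidean_space \<Rightarrow> 'b::topological_space"
  assumes f': "f' \<in> borel_measurable borel" and eq: "AE x in lborel. f x = f' x"
  shows "f \<in> borel_measurable lebesgue"
proof (rule measurableI)
  fix A :: "'b set" assume A: "A \<in> sets borel"
  show "f -` A \<inter> space lebesgue \<in> sets lebesgue"
  proof (rule completion.in_sets_AE)
    show "AE x in lebesgue. x \<in> f' -` A \<inter> space lebesgue \<longleftrightarrow> x \<in> f -` A \<inter> space lebesgue"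
      using AE_completion[OF eq] by eventually_elim auto
    show "f' -` A \<inter> space lebesgue \<in> sets lebesgue"
      using measurable_sets_borel[OF f' A] by auto
  qed auto
qed auto

lemma radial_value_norm:
  assumes "radial \<Phi>" shows "radial_value \<Phi> (norm x) = \<Phi> x"
proof -
  have "norm (SOME y::'a. norm y = norm x) = norm x"
    by (rule someI[of _ x]) simp
  with assms show ?thesis
    unfolding radial_def radial_value_def by blast
qed

text \<open>Averaging a Borel version of \<open>\<Phi>\<close> over spheres gives a Borel version of its radial profile.\<close>

lemma radial_value_borel_version:
  fixes \<Phi> :: "'a::euclidean_space \<Rightarrow> complex"
  assumes "\<Phi> \<in> borel_measurable lebesgue" and radial: "radial \<Phi>"
  obtains g where "g \<in> borel_measurable borel" "AE t in lborel. 0 < t \<longrightarrow> radial_value \<Phi> t = g t"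
proof -
  obtain \<Phi>' where \<Phi>'[measurable]: "\<Phi>' \<in> borel_measurable borel" and eq: "AE x in lborel. \<Phi> x = \<Phi>' x"
    using lebesgue_measurable_borel_version[OF assms(1)] .
  define \<sigma> where "\<sigma> = measure (surface_measure :: 'a measure) (sphere 0 1)"
  have \<sigma>: "\<sigma> \<noteq> 0"
    using emeasure_surface_measure_pos[where 'a='a] by (simp add: \<sigma>_def surface.emeasure_eq_measure)
  define g where "g t = (\<integral>\<theta>. \<Phi>' (t *\<^sub>R \<theta>) \<partial>surface_measure) /\<^sub>R \<sigma>" for t
  have "(\<lambda>(\<rho>, \<theta>). \<Phi>' (\<rho> *\<^sub>R \<theta>)) \<in> borel_measurable (borel \<Otimes>\<^sub>M (surface_measure :: 'a measure))"
    using measurable_compose[OF measurable_scaleR_sphere \<Phi>']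
    by (simp add: split_beta' cong: measurable_cong_sets sets_pair_measure_cong)
  then have "(\<lambda>t. \<integral>\<theta>. \<Phi>' (t *\<^sub>R \<theta>) \<partial>(surface_measure :: 'a measure)) \<in> borel_measurable borel"
    by (rule surface.borel_measurable_lebesgue_integral)
  then have "g \<in> borel_measurable borel"
    unfolding g_def by measurable
  moreover have "AE t in radial_measure DIM('a). radial_value \<Phi> t = g t"
    using AE_polar[OF eq] AE_radial_measure_pos
  proof eventually_elim
    case (elim t)
    \<comment> \<open>The Borel version \<open>\<Phi>'\<close> need not be radial, but for almost
      every t it equals the constant \<open>radial_value \<Phi> t\<close> almost everywhere on the
      sphere of radius t, and the average recovers that constant.\<close>
    have "AE \<theta> in (surface_measure :: 'a measure). \<Phi>' (t *\<^sub>R \<theta>) = radial_value \<Phi> t"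
    proof -
      have "AE \<theta> in (surface_measure :: 'a measure). norm \<theta> = 1"
        by (rule AE_I2) auto
      with elim(1) show ?thesis
      proof eventually_elim
        case (elim \<theta>)
        then show ?case
          using radial_value_norm[OF radial, of "t *\<^sub>R \<theta>"] \<open>0 < t\<close> by simp
      qed
    qed
    then have "(\<integral>\<theta>. \<Phi>' (t *\<^sub>R \<theta>) \<partial>(surface_measure :: 'a measure)) = (\<integral>\<theta>. radial_value \<Phi> t \<partial>(surface_measure :: 'a measure))"
      by (intro integral_cong_AE) auto
    then show ?case
      using \<sigma> by (simp add: g_def \<sigma>_def)
  qed
  ultimately show ?thesis
    using that by (simp add: AE_radial_measure)
qed

lemma ball_mean_cong_AE:
  fixes b b' :: "'a::euclidean_space \<Rightarrow> complex"
  assumes "AE x in lborel. b x = b' x" "b \<in> borel_measurable lebesgue" "b' \<in> borel_measurable lebesgue"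
  shows "ball_mean b R = ball_mean b' R"
proof -
  have "(LINT x:ball 0 R|lebesgue. b x) = (LINT x:ball 0 R|lebesgue. b' x)"
    unfolding set_lebesgue_integral_def
  proof (rule integral_cong_AE)
    show "AE x in lebesgue. indicator (ball 0 R) x *\<^sub>R b x = indicator (ball 0 R) x *\<^sub>R b' x"
      using AE_completion[OF assms(1)] by eventually_elim simp
  qed (use assms in \<open>auto intro!: borel_measurable_scaleR borel_measurable_indicator\<close>)
  then show ?thesis by (simp add: ball_mean_def)
qed

lemma cmo_norm_cong_AE:
  fixes b b' :: "'a::euclidean_space \<Rightarrow> complex"
  assumes eq: "AE x in lborel. b x = b' x" and "b \<in> borel_measurable lebesgue" "b' \<in> borel_measurable lebesgue"
  shows "cmo_norm s st b = cmo_norm s st b'"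
proof -
  have *: "AE \<rho> in lborel. 0 < \<rho> \<longrightarrow> (AE \<theta> in surface_measure. b (\<rho> *\<^sub>R \<theta>) = b' (\<rho> *\<^sub>R \<theta>))"
    using AE_polar[OF eq] by (simp add: AE_radial_measure)
  have "(\<integral>\<^sup>+\<rho>\<in>{0<..<R}. (\<integral>\<^sup>+\<theta>. ennreal (norm (b (\<rho> *\<^sub>R \<theta>) - ball_mean b R) powr st) \<partial>surface_measure)
         ennpowr (s / st) * ennreal (\<rho> ^ (DIM('a) - 1)) \<partial>lborel)
    = (\<integral>\<^sup>+\<rho>\<in>{0<..<R}. (\<integral>\<^sup>+\<theta>. ennreal (norm (b' (\<rho> *\<^sub>R \<theta>) - ball_mean b' R) powr st) \<partial>surface_measure)
         ennpowr (s / st) * ennreal (\<rho> ^ (DIM('a) - 1)) \<partial>lborel)" for R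
    unfolding ball_mean_cong_AE[OF assms, of R] using *
    by (intro nn_integral_cong_AE)
      (auto elim!: eventually_mono simp: indicator_def intro!: arg_cong[of _ _ "\<lambda>t. t ennpowr (s/st) * _"] nn_integral_cong_AE)
  then show ?thesis by (simp add: cmo_norm_def)
qed

section \<open>Finiteness on compact sets away from the origin\<close>

lemma mixed_lp_sum_finite:
  fixes F :: "'i \<Rightarrow> 'a::euclidean_space \<Rightarrow> ennreal"
  assumes "finite I" "0 < p" "0 < pt" and meas: "\<And>i. i \<in> I \<Longrightarrow> F i \<in> borel_measurable borel"
    and fin: "\<And>i. i \<in> I \<Longrightarrow> mixed_lp p pt (F i) < \<infinity>"
  shows "mixed_lp p pt (\<lambda>x. \<Sum>i\<in>I. F i x) < \<infinity>"
  using assms(1) meas fin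
proof (induction I)
  case empty
  then show ?case by (simp add: mixed_lp_def ang_norm_def[abs_def] lp_norm_def)
next
  case (insert i I)
  have [measurable]: "F i \<in> borel_measurable borel" "\<And>j. j \<in> I \<Longrightarrow> F j \<in> borel_measurable borel"
    using insert.prems by auto
  have "mixed_lp p pt (\<lambda>x. \<Sum>j\<in>insert i I. F j x) = mixed_lp p pt (\<lambda>x. F i x + (\<Sum>j\<in>I. F j x))"
    using insert.hyps by simp
  also have "\<dots> \<le> ennreal (2 powr (1 + 1 / p) * 2 powr (1 + 1 / pt)) * (mixed_lp p pt (F i) + mixed_lp p pt (\<lambda>x. \<Sum>j\<in>I. F j x))"
    using assms(2,3) by (intro mixed_lp_add_le) auto
  also have "\<dots> < \<infinity>"
  proof -
    have "mixed_lp p pt (\<lambda>x. \<Sum>j\<in>I. F j x) < \<infinity>" "mixed_lp p pt (F i) < \<infinity>"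
      using insert by auto
    then show ?thesis by (simp add: ennreal_mult_less_top)
  qed
  finally show ?case .
qed

text \<open>Membership in the Herz space asks for finite norms on compact sets avoiding 0, while the
  Herz norm controls shells. On such a set the norm lies between two positive bounds, so finitely
  many shells cover it.\<close>

lemma compact_subset_shells:
  fixes K :: "'a::euclidean_space set"
  assumes "compact K" "0 \<notin> K"
  obtains I :: "int set" where "finite I" "K \<subseteq> (\<Union>k\<in>I. shell k)"
proof -
  obtain B where B: "\<And>x. x \<in> K \<Longrightarrow> norm x \<le> B"
    using compact_imp_bounded[OF assms(1)] by (auto simp: bounded_iff)
  obtain d where d: "0 < d" "\<And>x. x \<in> K \<Longrightarrow> d \<le> norm x"
    using separate_point_closed[OF compact_imp_closed[OF assms(1)] assms(2)] by (auto simp: dist_norm)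
  show ?thesis
  proof
    \<comment> \<open>The added 1 at the top is due to ceilings: for x in the shell k one has k - 1
      < log 2 |x| \<le> log 2 B, so k may exceed log 2 B by less than 1.\<close>
    show "finite {\<lfloor>log 2 d\<rfloor>..\<lceil>log 2 B\<rceil> + 1}" by simp
    show "K \<subseteq> (\<Union>k\<in>{\<lfloor>log 2 d\<rfloor>..\<lceil>log 2 B\<rceil> + 1}. shell k)"
    proof
      fix x assume x: "x \<in> K"
      have pos: "0 < norm x" using d x by force
      then obtain k where k: "norm x \<in> dyadic k"
        using dyadic_ex1 by blast
      have "log 2 d \<le> log 2 (norm x)" "log 2 (norm x) \<le> log 2 B"
        using d(1) d(2)[OF x] pos B[OF x] less_le_trans[OF pos B[OF x]] by simp_all
      moreover have "real_of_int k - 1 < log 2 (norm x)" "log 2 (norm x) \<le> real_of_int k"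
        using k pos by (auto simp: dyadic_def less_log_iff log_le_iff)
      ultimately have "k \<in> {\<lfloor>log 2 d\<rfloor>..\<lceil>log 2 B\<rceil> + 1}"
        by (auto; linarith)
      with k show "x \<in> (\<Union>k\<in>{\<lfloor>log 2 d\<rfloor>..\<lceil>log 2 B\<rceil> + 1}. shell k)"
        by (auto simp: shell_iff)
    qed
  qed
qed

section \<open>Commutators of Hausdorff operators\<close>

text \<open>For x away from 0 and from the null set where b and its version differ, three null sets
  in y remain: from the profile of \<Phi>, after inversion, from b, and from f.\<close>

lemma comm_integrand_borel_version:
  fixes \<Phi> b f :: "'a::euclidean_space \<Rightarrow> complex"
  assumes radial: "radial \<Phi>" and g: "AE t in lborel. 0 < t \<longrightarrow> radial_value \<Phi> t = g t"
    and b: "AE x in lborel. b x = b' x" and f: "AE x in lborel. f x = f' x"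
  shows "AE x in lborel. x \<noteq> 0 \<and> (AE y in lborel.
    indicator {y. D (norm x) (norm y)} y *\<^sub>R comm_integrand \<Phi> b f x y = radial_integrand D g b' f' x y)"
  using b AE_lborel_singleton[of "0::'a"]
proof eventually_elim
  case (elim x)
  then have x: "b x = b' x" "x \<noteq> 0" by auto
  have "AE y::'a in lborel. radial_value \<Phi> (norm x / norm y) = g (norm x / norm y)"
    using x by (intro AE_inversion_norm[OF g]) auto
  then have "AE y in lborel.
    indicator {y. D (norm x) (norm y)} y *\<^sub>R comm_integrand \<Phi> b f x y = radial_integrand D g b' f' x y"
    using b f
  proof eventually_elim
    case (elim y)
    have "\<Phi> (x /\<^sub>R norm y) = g (norm x / norm y)"
      using radial_value_norm[OF radial, of "x /\<^sub>R norm y"] elim(1) by (simp add: divide_inverse mult.commute)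
    with elim x show ?case
      by (simp add: comm_integrand_def radial_integrand_def)
  qed
  with x show ?case by simp
qed

text \<open>All three parts of the result are instances, obtained by varying \<open>D\<close>. The
  condition m \<le> s is for the oscillation of b inside the integral, p \<le> s for that in the
  outer norm.\<close>

theorem radial_commutator_bounded:
  fixes \<Phi> b :: "'a::euclidean_space \<Rightarrow> complex" and D :: "real \<Rightarrow> real \<Rightarrow> bool" and g :: "real \<Rightarrow> complex"
    and \<alpha> \<epsilon> :: real
  assumes radial: "radial \<Phi>"
    and g[measurable]: "g \<in> borel_measurable borel" and g_eq: "AE t in lborel. 0 < t \<longrightarrow> radial_value \<Phi> t = g t"
    and D[measurable]: "Measurable.pred (borel \<Otimes>\<^sub>M borel) (\<lambda>z. D (fst z) (snd z))"
    and pt: "1 < pt" "1 < pt1" "0 < pt2" "1 / pt = 1 / pt1 + 1 / pt2"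
    and r: "1 < r" "1 < r'" "1 / r + 1 / r' = 1" "0 < p" "0 < m" "1 / r = 1 / p + 1 / m"
    and s: "1 \<le> s" "m \<le> s" "p \<le> s" and q: "0 < q"
    and b: "b \<in> cmo_space s pt1"
    and \<epsilon>: "0 < \<epsilon>" and M: "0 \<le> M"
    and kernel: "\<And>k l \<rho> s. \<rho> \<in> dyadic k \<Longrightarrow> s \<in> dyadic l \<Longrightarrow> D \<rho> s \<Longrightarrow> kernel_decay g DIM('a) r' p m \<alpha> \<epsilon> M k l"
  shows "(\<forall>f\<in>herz_space \<alpha> q p pt2. AE x in lebesgue.
      set_integrable lebesgue {y. D (norm x) (norm y)} (comm_integrand \<Phi> b f x)) \<and>
    bounded_operator (herz_space \<alpha> q p pt2) (herz_norm \<alpha> q p pt2) (herz_space \<alpha> q p pt) (herz_norm \<alpha> q p pt)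
      (\<lambda>f x. LINT y:{y. D (norm x) (norm y)}|lebesgue. comm_integrand \<Phi> b f x y)"
proof -
  define T where "T f x = (LINT y:{y. D (norm x) (norm y)}|lebesgue. comm_integrand \<Phi> b f x y)" for f :: "'a \<Rightarrow> complex" and x
  have b_leb: "b \<in> borel_measurable lebesgue" and b_int: "\<And>R. 0 < R \<Longrightarrow> set_integrable lebesgue (ball 0 R) b"
    and b_cmo: "cmo_norm s pt1 b < \<infinity>"
    using b by (auto simp: cmo_space_def)
  obtain b' where b'[measurable]: "b' \<in> borel_measurable borel" and b_eq: "AE x in lborel. b x = b' x"
    using lebesgue_measurable_borel_version[OF b_leb] .
  have b'_leb: "b' \<in> borel_measurable lebesgue"
    by (rule measurable_completion) simp
  define N where "N = enn2real (cmo_norm s pt1 b')"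
  have N: "cmo_norm s pt1 b' = ennreal N" "0 \<le> N"
    using b_cmo cmo_norm_cong_AE[OF b_eq b_leb b'_leb, of s pt1] by (auto simp: N_def less_top)
  have b'_int: "set_integrable lborel (ball 0 R) b'" if "0 < R" for R
  proof -
    have "set_integrable lebesgue (ball 0 R) b'"
      unfolding set_integrable_def
    proof (rule integrable_cong_AE_imp)
      show "integrable lebesgue (\<lambda>x. indicator (ball 0 R) x *\<^sub>R b x)"
        using b_int[OF that] by (simp add: set_integrable_def)
      show "(\<lambda>x. indicator (ball 0 R) x *\<^sub>R b' x) \<in> borel_measurable lebesgue"
        by (rule measurable_completion) simp
      show "AE x in lebesgue. indicator (ball 0 R) x *\<^sub>R b x = indicator (ball 0 R) x *\<^sub>R b' x"
        using AE_completion[OF b_eq] by eventually_elim simp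
    qed
    then show ?thesis
      unfolding set_integrable_def by (subst (asm) integrable_completion) auto
  qed
  have kernel': "lp_norm (radial_measure DIM('a)) r' (\<lambda>s. indicator (dyadic l) s * (of_bool (D \<rho> s) * ennreal (norm (g (\<rho> / s)) / s ^ DIM('a))))
      \<le> ennreal (M * 2 powr (- (2 * \<epsilon>) * \<bar>real_of_int (k - l)\<bar>) * 2 powr (real_of_int (l - k) * \<alpha>)
          * 2 powr (- (real_of_int k * (DIM('a) / p))) * 2 powr (- (real_of_int l * (DIM('a) / m))))"
    if "\<rho> \<in> dyadic k" for k l \<rho>
    by (rule kernel_decay_restrict[where D=D]) (use kernel r that in auto)
  have "1 / pt1 \<le> 1 / pt" using pt by simp
  then have pt_le: "0 < pt" "pt \<le> pt1" using pt(1,2) by (simp_all add: field_simps)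
  obtain C0 where C0: "0 \<le> C0" and pointwise: "\<forall>f\<in>borel_measurable borel. \<forall>k. \<forall>x\<in>shell k.
    (\<integral>\<^sup>+y. ennreal (norm (radial_integrand D g b' f x y)) \<partial>lborel)
    \<le> ennreal (C0 * 2 powr (- (real_of_int k * (DIM('a) / p))) * (N + norm (b' x - ball_mean b' (2 powr (real_of_int k + 1)))))
      * (\<integral>\<^sup>+l. ennreal (2 powr (- \<epsilon> * \<bar>real_of_int (k - l)\<bar>) * 2 powr (real_of_int (l - k) * \<alpha>))
          * mixed_lp p pt2 (\<lambda>y. indicator (shell l) y * ennreal (norm (f y))) \<partial>count_space UNIV)"
    using commutator_pointwise_bound[OF g b' D pt r s(1,2) b'_int N \<epsilon> M kernel'] by blast
  obtain C where C: "\<forall>(a :: int \<Rightarrow> ennreal) (G :: 'a \<Rightarrow> ennreal).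
    (\<forall>k. \<forall>x\<in>shell k. G x
      \<le> ennreal (C0 * 2 powr (- (real_of_int k * (DIM('a) / p))) * (N + norm (b' x - ball_mean b' (2 powr (real_of_int k + 1)))))
      * (\<integral>\<^sup>+l. ennreal (2 powr (- \<epsilon> * \<bar>real_of_int (k - l)\<bar>) * 2 powr (real_of_int (l - k) * \<alpha>)) * a l \<partial>count_space UNIV))
    \<longrightarrow> lp_norm (count_space UNIV) q (\<lambda>k. ennreal (2 powr (real_of_int k * \<alpha>)) * mixed_lp p pt (\<lambda>x. indicator (shell k) x * G x))
      \<le> ennreal C * lp_norm (count_space UNIV) q (\<lambda>k. ennreal (2 powr (real_of_int k * \<alpha>)) * a k)"
    using herz_bound_of_pointwise[OF b' pt_le r(4) s(3) q \<epsilon> C0 N] by blast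
  obtain C2 where C2: "\<And>a::int \<Rightarrow> ennreal.
    lp_norm (count_space UNIV) q
      (\<lambda>k. \<integral>\<^sup>+l. ennreal (2 powr (- \<epsilon> * \<bar>real_of_int (k - l)\<bar>)) * a l \<partial>count_space UNIV)
    \<le> ennreal C2 * lp_norm (count_space UNIV) q a"
    using lp_norm_int_convolution[OF \<epsilon> q] by blast
  have main: "(AE x in lebesgue. set_integrable lebesgue {y. D (norm x) (norm y)} (comm_integrand \<Phi> b f x))
    \<and> T f \<in> herz_space \<alpha> q p pt \<and> herz_norm \<alpha> q p pt (T f) \<le> ennreal C * herz_norm \<alpha> q p pt2 f"
    if f: "f \<in> herz_space \<alpha> q p pt2" for f
  proof -
    have f_leb: "f \<in> borel_measurable lebesgue" and f_fin: "herz_norm \<alpha> q p pt2 f < \<infinity>"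
      using f by (auto simp: herz_space_def)
    obtain f' where f'[measurable]: "f' \<in> borel_measurable borel" and f_eq: "AE x in lborel. f x = f' x"
      using lebesgue_measurable_borel_version[OF f_leb] .
    define a where "a l = mixed_lp p pt2 (\<lambda>y. indicator (shell l) y * ennreal (norm (f' y)))" for l
    define K where "K x = (\<integral>\<^sup>+y. ennreal (norm (radial_integrand D g b' f' x y)) \<partial>lborel)" for x
    define S where "S k = (\<integral>\<^sup>+l. ennreal (2 powr (- \<epsilon> * \<bar>real_of_int (k - l)\<bar>) * 2 powr (real_of_int (l - k) * \<alpha>)) * a l \<partial>count_space UNIV)" for k
    have mixed_shell: "mixed_norm t tt (\<lambda>x. indicator (shell k) x *\<^sub>R h x)
        = mixed_lp t tt (\<lambda>x. indicator (shell k) x * ennreal (norm (h' x)))"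
      if [measurable]: "h' \<in> borel_measurable borel" and eq: "AE x in lborel. h x = h' x"
      for t tt k and h h' :: "'a \<Rightarrow> complex"
    proof -
      have "mixed_norm t tt (\<lambda>x. indicator (shell k) x *\<^sub>R h x) = mixed_norm t tt (\<lambda>x. indicator (shell k) x *\<^sub>R h' x)"
        by (rule mixed_norm_cong_AE) (use eq in \<open>eventually_elim, simp\<close>)
      also have "\<dots> = mixed_lp t tt (\<lambda>x. ennreal (norm (indicator (shell k) x *\<^sub>R h' x)))"
        by (rule mixed_norm_eq) measurable
      also have "(\<lambda>x. ennreal (norm (indicator (shell k) x *\<^sub>R h' x))) = (\<lambda>x. indicator (shell k) x * ennreal (norm (h' x)))"
        by (auto simp: indicator_def)
      finally show ?thesis .
    qed
    have herz_f: "herz_norm \<alpha> q p pt2 f = lp_norm (count_space UNIV) q (\<lambda>k. ennreal (2 powr (real_of_int k * \<alpha>)) * a k)"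
      by (simp add: herz_norm_eq_lp_norm[OF q] mixed_shell[OF f' f_eq] a_def)
    have K_le: "K x \<le> ennreal (C0 * 2 powr (- (real_of_int k * (DIM('a) / p)))
        * (N + norm (b' x - ball_mean b' (2 powr (real_of_int k + 1))))) * S k" if "x \<in> shell k" for k x
      using pointwise f' that unfolding K_def S_def a_def by blast
    \<comment> \<open>A single weighted term is bounded by the whole sequence norm, hence by the
      Herz norm of f. So the integral of the norm of the Borel integrand is finite at every x
      \<noteq> 0, and absolute convergence follows.\<close>
    have S_fin: "S k < \<infinity>" for k
    proof -
      have "ennreal (2 powr (real_of_int k * \<alpha>)) * S k
        \<le> lp_norm (count_space UNIV) q (\<lambda>k. \<integral>\<^sup>+l. ennreal (2 powr (- \<epsilon> * \<bar>real_of_int (k - l)\<bar>))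
              * (ennreal (2 powr (real_of_int l * \<alpha>)) * a l) \<partial>count_space UNIV)"
        unfolding S_def weighted_sum_scale by (rule lp_norm_count_space_ge[OF q])
      also have "\<dots> \<le> ennreal C2 * herz_norm \<alpha> q p pt2 f"
        unfolding herz_f by (rule C2)
      also have "\<dots> < \<infinity>"
        using f_fin by (simp add: ennreal_mult_less_top)
      finally show ?thesis
        by (auto simp: ennreal_mult_less_top)
    qed
    have K_fin: "K x < \<infinity>" if "x \<noteq> 0" for x
    proof -
      obtain k where "x \<in> shell k"
        using dyadic_ex1[of "norm x"] \<open>x \<noteq> 0\<close> unfolding shell_iff by auto
      note K_le[OF this]
      also have "ennreal (C0 * 2 powr (- (real_of_int k * (DIM('a) / p)))
        * (N + norm (b' x - ball_mean b' (2 powr (real_of_int k + 1))))) * S k < \<infinity>"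
        using S_fin[of k] by (simp add: ennreal_mult_less_top)
      finally show ?thesis .
    qed
    have meas_pair: "(\<lambda>z. radial_integrand D g b' f' (fst z) (snd z)) \<in> borel_measurable (borel \<Otimes>\<^sub>M borel)"
    proof -
      have [measurable]: "Measurable.pred (borel \<Otimes>\<^sub>M borel) (\<lambda>z::'a \<times> 'a. D (norm (fst z)) (norm (snd z)))"
        using measurable_compose[of "\<lambda>z::'a \<times> 'a. (norm (fst z), norm (snd z))" "borel \<Otimes>\<^sub>M borel" "borel \<Otimes>\<^sub>M borel", OF _ D]
        by simp
      show ?thesis
        unfolding radial_integrand_def by measurable
    qed
    have meas: "radial_integrand D g b' f' x \<in> borel_measurable borel" for x
      using measurable_compose[OF measurable_Pair1' meas_pair, of x] by simp
    define T' where "T' x = (\<integral>y. radial_integrand D g b' f' x y \<partial>lborel)" for x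
    have T'_meas[measurable]: "T' \<in> borel_measurable borel"
      unfolding T'_def using meas_pair
      by (intro sigma_finite_measure.borel_measurable_lebesgue_integral)
        (auto simp: split_beta' lborel.sigma_finite_measure_axioms)
    have T'_le: "ennreal (norm (T' x)) \<le> K x" for x
    proof (cases "integrable lborel (radial_integrand D g b' f' x)")
      case True
      then show ?thesis unfolding T'_def K_def by (rule integral_norm_bound_ennreal)
    next
      \<comment> \<open>A Bochner integral that does not converge has the default value 0, so the
        bound also holds in this case.\<close>
      case False
      then show ?thesis by (simp add: T'_def not_integrable_integral_eq)
    qed
    note version = comm_integrand_borel_version[OF radial g_eq b_eq f_eq, of D]
    have T_eq: "AE x in lborel. T f x = T' x"
      using version
    proof eventually_elim
      case (elim x)
      have "T f x = (\<integral>y. radial_integrand D g b' f' x y \<partial>lebesgue)"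
        unfolding T_def set_lebesgue_integral_def
      proof (rule integral_cong_AE)
        show "(\<lambda>y. indicator {y. D (norm x) (norm y)} y *\<^sub>R comm_integrand \<Phi> b f x y) \<in> borel_measurable lebesgue"
          using elim meas by (intro lebesgue_measurable_cong_AE[of "radial_integrand D g b' f' x"]) auto
        show "radial_integrand D g b' f' x \<in> borel_measurable lebesgue"
          using meas by (intro measurable_completion) simp
      qed (use elim AE_completion in blast)
      also have "\<dots> = T' x"
        unfolding T'_def using meas by (intro integral_completion) simp
      finally show ?case .
    qed
    have integrable: "AE x in lebesgue. set_integrable lebesgue {y. D (norm x) (norm y)} (comm_integrand \<Phi> b f x)"
      using AE_completion[OF version]
    proof eventually_elim
      case (elim x)
      have "integrable lborel (radial_integrand D g b' f' x)"
        using K_fin[of x] elim meas by (intro integrableI_bounded) (auto simp: K_def)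
      then have "integrable lebesgue (radial_integrand D g b' f' x)"
        using meas by (subst integrable_completion) auto
      then show ?case
        unfolding set_integrable_def
      proof (rule integrable_cong_AE_imp)
        show "(\<lambda>y. indicator {y. D (norm x) (norm y)} y *\<^sub>R comm_integrand \<Phi> b f x y) \<in> borel_measurable lebesgue"
          using elim meas by (intro lebesgue_measurable_cong_AE[of "radial_integrand D g b' f' x"]) auto
        show "AE y in lebesgue. radial_integrand D g b' f' x y = indicator {y. D (norm x) (norm y)} y *\<^sub>R comm_integrand \<Phi> b f x y"
          using AE_completion[OF conjunct2[OF elim]] by eventually_elim (rule sym)
      qed
    qed
    have bound: "herz_norm \<alpha> q p pt (T f) \<le> ennreal C * herz_norm \<alpha> q p pt2 f"
    proof -
      have "herz_norm \<alpha> q p pt (T f)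
        = lp_norm (count_space UNIV) q (\<lambda>k. ennreal (2 powr (real_of_int k * \<alpha>)) * mixed_lp p pt (\<lambda>x. indicator (shell k) x * ennreal (norm (T' x))))"
        by (simp add: herz_norm_eq_lp_norm[OF q] mixed_shell[OF T'_meas T_eq])
      also have "\<dots> \<le> ennreal C * herz_norm \<alpha> q p pt2 f"
        unfolding herz_f
      proof (rule C[rule_format])
        fix k and x :: 'a assume "x \<in> shell k"
        from order_trans[OF T'_le K_le[OF this]]
        show "ennreal (norm (T' x)) \<le> ennreal (C0 * 2 powr (- (real_of_int k * (DIM('a) / p)))
            * (N + norm (b' x - ball_mean b' (2 powr (real_of_int k + 1)))))
          * (\<integral>\<^sup>+l. ennreal (2 powr (- \<epsilon> * \<bar>real_of_int (k - l)\<bar>) * 2 powr (real_of_int (l - k) * \<alpha>)) * a l \<partial>count_space UNIV)"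
          unfolding S_def .
      qed
      finally show ?thesis .
    qed
    have herz_fin: "herz_norm \<alpha> q p pt (T f) < \<infinity>"
      using bound f_fin by (auto intro: le_less_trans simp: ennreal_mult_less_top)
    have shell_fin: "mixed_lp p pt (\<lambda>x. indicator (shell k) x * ennreal (norm (T' x))) < \<infinity>" for k
    proof -
      have "ennreal (2 powr (real_of_int k * \<alpha>)) * mixed_lp p pt (\<lambda>x. indicator (shell k) x * ennreal (norm (T' x)))
        \<le> herz_norm \<alpha> q p pt (T f)"
        unfolding herz_norm_eq_lp_norm[OF q] mixed_shell[OF T'_meas T_eq]
        by (rule lp_norm_count_space_ge[OF q])
      also note herz_fin
      finally show ?thesis by (auto simp: ennreal_mult_less_top)
    qed
    have compact_fin: "mixed_norm p pt (\<lambda>x. indicator Z x *\<^sub>R T f x) < \<infinity>" if Z: "compact Z" "0 \<notin> Z" for Z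
    proof -
      obtain I :: "int set" where I: "finite I" "Z \<subseteq> (\<Union>k\<in>I. shell k)"
        using compact_subset_shells[OF Z] .
      have [measurable]: "Z \<in> sets borel"
        using Z by (simp add: borel_compact)
      have "mixed_norm p pt (\<lambda>x. indicator Z x *\<^sub>R T f x) = mixed_norm p pt (\<lambda>x. indicator Z x *\<^sub>R T' x)"
        by (rule mixed_norm_cong_AE) (use T_eq in \<open>eventually_elim, simp\<close>)
      also have "\<dots> = mixed_lp p pt (\<lambda>x. ennreal (norm (indicator Z x *\<^sub>R T' x)))"
        by (rule mixed_norm_eq) measurable
      also have "\<dots> \<le> mixed_lp p pt (\<lambda>x. \<Sum>k\<in>I. indicator (shell k) x * ennreal (norm (T' x)))"
      proof (intro mixed_lp_mono r pt_le)
        fix x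
        show "ennreal (norm (indicator Z x *\<^sub>R T' x)) \<le> (\<Sum>k\<in>I. indicator (shell k) x * ennreal (norm (T' x)))"
        proof (cases "x \<in> Z")
          case True
          then obtain k where k: "k \<in> I" "x \<in> shell k" using I by auto
          have "ennreal (norm (T' x)) = indicator (shell k) x * ennreal (norm (T' x))"
            using k by simp
          also have "\<dots> \<le> (\<Sum>k\<in>I. indicator (shell k) x * ennreal (norm (T' x)))"
            using I(1) k(1) by (intro member_le_sum) auto
          finally show ?thesis using True by simp
        qed simp
      qed
      also have "\<dots> < \<infinity>"
        using I shell_fin r pt_le by (intro mixed_lp_sum_finite) auto
      finally show ?thesis .
    qed
    have "T f \<in> borel_measurable lebesgue"
      by (rule lebesgue_measurable_cong_AE[OF T'_meas T_eq])
    with compact_fin herz_fin have "T f \<in> herz_space \<alpha> q p pt"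
      by (simp add: herz_space_def)
    with integrable bound show ?thesis by blast
  qed
  then show ?thesis
    unfolding bounded_operator_def T_def by blast
qed

text \<open>Taken with c = n (r' - 1) for \<open>A\<close> and c = n for \<open>B\<close>; the
  finite quantity passes from \<Phi> to the Borel profile g.\<close>

lemma kernel_moment_finite:
  fixes \<Phi> :: "'a::euclidean_space \<Rightarrow> complex" and c r' :: real
  assumes g: "AE t in lborel. 0 < t \<longrightarrow> radial_value \<Phi> t = g t"
    and fin: "(\<integral>\<^sup>+t\<in>{0<..}. ennreal (norm (radial_value \<Phi> t) powr r' / t powr (1 - c)) \<partial>lborel) ennpowr (1 / r') < \<infinity>"
  shows "(\<integral>\<^sup>+t\<in>{0<..}. ennreal (norm (g t) powr r' * t powr (c - 1)) \<partial>lborel) < \<infinity>"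
proof -
  have "(\<integral>\<^sup>+t\<in>{0<..}. ennreal (norm (g t) powr r' * t powr (c - 1)) \<partial>lborel)
    = (\<integral>\<^sup>+t\<in>{0<..}. ennreal (norm (radial_value \<Phi> t) powr r' / t powr (1 - c)) \<partial>lborel)"
  proof (rule nn_integral_cong_AE)
    have eq: "x * t powr (c - 1) = x / t powr (1 - c)" for x t :: real
      using powr_minus_divide[of t "1 - c"] by simp
    show "AE t in lborel. ennreal (norm (g t) powr r' * t powr (c - 1)) * indicator {0<..} t
      = ennreal (norm (radial_value \<Phi> t) powr r' / t powr (1 - c)) * indicator {0<..} t"
      using g by eventually_elim (auto simp: indicator_def eq)
  qed
  then show ?thesis using fin by simp
qed

text \<open>Each part asserts integrability for almost every x together with boundedness: as a
  divergent Bochner integral counts as 0, the norm inequality alone would not say that the operator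
  is given by a convergent integral.\<close>

theorem theorem6p1:
  fixes \<Phi> b :: "real ^ 'n \<Rightarrow> complex"
    and p pt pt1 pt2 q r r' \<alpha> :: real
    and A B :: ennreal
  defines "A \<equiv> (\<integral>\<^sup>+t\<in>{0<..}. ennreal (norm (radial_value \<Phi> t) powr r'
                   / t powr (1 - real CARD('n) * (r' - 1))) \<partial>lborel) ennpowr (1 / r')"
    and "B \<equiv> (\<integral>\<^sup>+t\<in>{0<..}. ennreal (norm (radial_value \<Phi> t) powr r'
                   / t powr (1 - real CARD('n))) \<partial>lborel) ennpowr (1 / r')"
  assumes "CARD('n) \<ge> 2"
    and "0 < q" and "1 < p" and "1 < pt" and "1 < pt1" and "1 < pt2"
    and "1 < r" and "r < p" and "1 / r + 1 / r' = 1"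
    and "1 / pt = 1 / pt1 + 1 / pt2"
    and "b \<in> cmo_space (max p (p * r / (p - r))) pt1"
    and "\<Phi> \<in> borel_measurable lebesgue" and "radial \<Phi>"
  shows
    "(\<alpha> < real CARD('n) * (1 / r - 1 / p) \<and> A < \<infinity> \<longrightarrow>
        (\<forall>f\<in>herz_space \<alpha> q p pt2. AE x in lebesgue.
           set_integrable lebesgue {y. norm y < norm x} (comm_integrand \<Phi> b f x)) \<and>
        bounded_operator (herz_space \<alpha> q p pt2) (herz_norm \<alpha> q p pt2)
          (herz_space \<alpha> q p pt) (herz_norm \<alpha> q p pt) (hausdorff_comm1 \<Phi> b)) \<and>
     (\<alpha> > - real CARD('n) * (1 / p - 1 / r') \<and> B < \<infinity> \<longrightarrow>
        (\<forall>f\<in>herz_space \<alpha> q p pt2. AE x in lebesgue.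
           set_integrable lebesgue {y. norm x \<le> norm y} (comm_integrand \<Phi> b f x)) \<and>
        bounded_operator (herz_space \<alpha> q p pt2) (herz_norm \<alpha> q p pt2)
          (herz_space \<alpha> q p pt) (herz_norm \<alpha> q p pt) (hausdorff_comm2 \<Phi> b)) \<and>
     (- real CARD('n) * (1 / p - 1 / r') < \<alpha> \<and> \<alpha> < real CARD('n) * (1 / r - 1 / p)
        \<and> A < \<infinity> \<and> B < \<infinity> \<longrightarrow>
        (\<forall>f\<in>herz_space \<alpha> q p pt2. AE x in lebesgue.
           integrable lebesgue (comm_integrand \<Phi> b f x)) \<and>
        bounded_operator (herz_space \<alpha> q p pt2) (herz_norm \<alpha> q p pt2)
          (herz_space \<alpha> q p pt) (herz_norm \<alpha> q p pt) (hausdorff_comm \<Phi> b))"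
proof -
  note hyps = assms(3-)
  define n where "n = CARD('n)"
  have n: "0 < n"
    by (simp add: n_def)
  \<comment> \<open>The exponent left for b when the conjugate of r' is split between f and b: 1 / r
    = 1 / p + 1 / m, positive because r < p.\<close>
  define m where "m = p * r / (p - r)"
  have r': "1 < r'"
  proof -
    have "0 < 1 / r" "1 / r < 1" using hyps(7) by auto
    then have "0 < 1 / r'" "1 / r' < 1" using hyps(9) by linarith+
    then show ?thesis by (simp add: field_simps)
  qed
  have m: "0 < m" "1 / r = 1 / p + 1 / m"
    using hyps(3,7,8) by (simp_all add: m_def divide_simps)
  obtain g where g: "g \<in> borel_measurable borel" and g_eq: "AE t in lborel. 0 < t \<longrightarrow> radial_value \<Phi> t = g t"
    using radial_value_borel_version[OF hyps(12,13)] .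
  have bounded: "(\<forall>f\<in>herz_space \<alpha> q p pt2. AE x in lebesgue.
      set_integrable lebesgue {y. D (norm x) (norm y)} (comm_integrand \<Phi> b f x)) \<and>
    bounded_operator (herz_space \<alpha> q p pt2) (herz_norm \<alpha> q p pt2) (herz_space \<alpha> q p pt) (herz_norm \<alpha> q p pt)
      (\<lambda>f x. LINT y:{y. D (norm x) (norm y)}|lebesgue. comm_integrand \<Phi> b f x y)"
    if "Measurable.pred (borel \<Otimes>\<^sub>M borel) (\<lambda>z. D (fst z) (snd z))" "0 < \<epsilon>" "0 \<le> M"
      "\<And>k l \<rho> s. \<rho> \<in> dyadic k \<Longrightarrow> s \<in> dyadic l \<Longrightarrow> D \<rho> s \<Longrightarrow> kernel_decay g n r' p m \<alpha> \<epsilon> M k l" for D \<epsilon> M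
    using hyps r' m that
    by (intro radial_commutator_bounded[OF hyps(13) g g_eq, where r=r and r'=r' and m=m and s="max p m" and \<epsilon>=\<epsilon> and M=M and ?pt1.0=pt1])
      (auto simp: n_def m_def[symmetric])
  \<comment> \<open>The surplus exponents for \<gamma> = n (r' - 1) and \<gamma> = n. Since (r' - 1)
    / r' = 1 / r, they are n (1 / r - 1 / p) - \<alpha> and n (1 / r' - 1 / p) - \<alpha>; the
    bounds on \<alpha> say that the first is positive and the second negative.\<close>
  define \<delta>1 where "\<delta>1 = real n * (r' - 1) / r' - n / p - \<alpha>"
  define \<delta>2 where "\<delta>2 = real n / r' - n / p - \<alpha>"
  have decay1: "\<exists>M\<ge>0. \<forall>k l. l \<le> k \<longrightarrow> kernel_decay g n r' p m \<alpha> (\<bar>\<delta>1\<bar> / 2) M k l" and \<delta>1: "0 < \<delta>1"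
    if "\<alpha> < real CARD('n) * (1 / r - 1 / p)" "A < \<infinity>"
  proof -
    have "(r' - 1) / r' = 1 / r"
      using hyps(9) r' by (simp add: diff_divide_distrib)
    then have "\<delta>1 = real n * (1 / r) - n / p - \<alpha>"
      unfolding \<delta>1_def by (metis times_divide_eq_right)
    then show pos: "0 < \<delta>1"
      using that(1) by (simp add: n_def algebra_simps)
    have "(\<integral>\<^sup>+t\<in>{0<..}. ennreal (norm (g t) powr r' * t powr (real n * (r' - 1) - 1)) \<partial>lborel) < \<infinity>"
      using that(2) by (intro kernel_moment_finite[OF g_eq]) (simp add: A_def n_def)
    from kernel_decay_of_integrable[OF g n r' hyps(9) m(2) this, of \<alpha>]
    show "\<exists>M\<ge>0. \<forall>k l. l \<le> k \<longrightarrow> kernel_decay g n r' p m \<alpha> (\<bar>\<delta>1\<bar> / 2) M k l"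
      unfolding \<delta>1_def[symmetric] using pos by (auto simp: mult_le_0_iff)
  qed
  have decay2: "\<exists>M\<ge>0. \<forall>k l. k \<le> l \<longrightarrow> kernel_decay g n r' p m \<alpha> (\<bar>\<delta>2\<bar> / 2) M k l" and \<delta>2: "\<delta>2 < 0"
    if "\<alpha> > - real CARD('n) * (1 / p - 1 / r')" "B < \<infinity>"
  proof -
    show neg: "\<delta>2 < 0"
      using that(1) by (simp add: \<delta>2_def n_def algebra_simps)
    have "(\<integral>\<^sup>+t\<in>{0<..}. ennreal (norm (g t) powr r' * t powr (real n - 1)) \<partial>lborel) < \<infinity>"
      using that(2) by (intro kernel_moment_finite[OF g_eq]) (simp add: B_def n_def)
    from kernel_decay_of_integrable[OF g n r' hyps(9) m(2) this, of \<alpha>]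
    show "\<exists>M\<ge>0. \<forall>k l. k \<le> l \<longrightarrow> kernel_decay g n r' p m \<alpha> (\<bar>\<delta>2\<bar> / 2) M k l"
      unfolding \<delta>2_def[symmetric] using neg by (auto simp: mult_le_0_iff)
  qed
  show ?thesis
  proof (intro conjI impI; (elim conjE)?)
    assume a: "\<alpha> < real CARD('n) * (1 / r - 1 / p)" "A < \<infinity>"
    obtain M where M: "0 \<le> M" "\<And>k l. l \<le> k \<Longrightarrow> kernel_decay g n r' p m \<alpha> (\<bar>\<delta>1\<bar> / 2) M k l"
      using decay1[OF a] by blast
    \<comment> \<open>A radius s < \<rho> lies in the dyadic interval of \<rho> or in an earlier
      one, so only l \<le> k occurs, the side on which \<delta>1 > 0 gives decay. For the second
      operator the order is reversed.\<close>
    note res = bounded[of "\<lambda>\<rho> s. s < \<rho>" "\<bar>\<delta>1\<bar> / 2" M]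
    have "(\<forall>f\<in>herz_space \<alpha> q p pt2. AE x in lebesgue.
        set_integrable lebesgue {y. norm y < norm x} (comm_integrand \<Phi> b f x)) \<and>
      bounded_operator (herz_space \<alpha> q p pt2) (herz_norm \<alpha> q p pt2) (herz_space \<alpha> q p pt) (herz_norm \<alpha> q p pt)
        (\<lambda>f x. LINT y:{y. norm y < norm x}|lebesgue. comm_integrand \<Phi> b f x y)"
      by (rule res) (use \<delta>1[OF a] M dyadic_mono in \<open>auto intro: less_imp_le\<close>)
    then show "\<forall>f\<in>herz_space \<alpha> q p pt2. AE x in lebesgue.
        set_integrable lebesgue {y. norm y < norm x} (comm_integrand \<Phi> b f x)"
      "bounded_operator (herz_space \<alpha> q p pt2) (herz_norm \<alpha> q p pt2) (herz_space \<alpha> q p pt) (herz_norm \<alpha> q p pt) (hausdorff_comm1 \<Phi> b)"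
      by (simp_all add: hausdorff_comm1_def[abs_def])
  next
    assume a: "- real CARD('n) * (1 / p - 1 / r') < \<alpha>" "B < \<infinity>"
    obtain M where M: "0 \<le> M" "\<And>k l. k \<le> l \<Longrightarrow> kernel_decay g n r' p m \<alpha> (\<bar>\<delta>2\<bar> / 2) M k l"
      using decay2[OF a] by blast
    note res = bounded[of "\<lambda>\<rho> s. \<rho> \<le> s" "\<bar>\<delta>2\<bar> / 2" M]
    have "(\<forall>f\<in>herz_space \<alpha> q p pt2. AE x in lebesgue.
        set_integrable lebesgue {y. norm x \<le> norm y} (comm_integrand \<Phi> b f x)) \<and>
      bounded_operator (herz_space \<alpha> q p pt2) (herz_norm \<alpha> q p pt2) (herz_space \<alpha> q p pt) (herz_norm \<alpha> q p pt)
        (\<lambda>f x. LINT y:{y. norm x \<le> norm y}|lebesgue. comm_integrand \<Phi> b f x y)"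
      by (rule res) (use \<delta>2[OF a] M dyadic_mono in auto)
    then show "\<forall>f\<in>herz_space \<alpha> q p pt2. AE x in lebesgue.
        set_integrable lebesgue {y. norm x \<le> norm y} (comm_integrand \<Phi> b f x)"
      "bounded_operator (herz_space \<alpha> q p pt2) (herz_norm \<alpha> q p pt2) (herz_space \<alpha> q p pt) (herz_norm \<alpha> q p pt) (hausdorff_comm2 \<Phi> b)"
      by (simp_all add: hausdorff_comm2_def[abs_def])
  next
    assume a: "- real CARD('n) * (1 / p - 1 / r') < \<alpha>" "\<alpha> < real CARD('n) * (1 / r - 1 / p)" "A < \<infinity>" "B < \<infinity>"
    obtain M1 where M1: "0 \<le> M1" "\<And>k l. l \<le> k \<Longrightarrow> kernel_decay g n r' p m \<alpha> (\<bar>\<delta>1\<bar> / 2) M1 k l"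
      using decay1[OF a(2,3)] by blast
    obtain M2 where M2: "0 \<le> M2" "\<And>k l. k \<le> l \<Longrightarrow> kernel_decay g n r' p m \<alpha> (\<bar>\<delta>2\<bar> / 2) M2 k l"
      using decay2[OF a(1,4)] by blast
    \<comment> \<open>The rate that both half-kernels share; together with the larger constant it
      gives decay on both sides of the diagonal, so the full operator is treated directly with
      \<open>D\<close> always true.\<close>
    define \<epsilon> where "\<epsilon> = min (\<bar>\<delta>1\<bar> / 2) (\<bar>\<delta>2\<bar> / 2)"
    have \<epsilon>: "0 < \<epsilon>" "\<epsilon> \<le> \<bar>\<delta>1\<bar> / 2" "\<epsilon> \<le> \<bar>\<delta>2\<bar> / 2"
      using \<delta>1[OF a(2,3)] \<delta>2[OF a(1,4)] by (auto simp: \<epsilon>_def)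
    have decay: "kernel_decay g n r' p m \<alpha> \<epsilon> (max M1 M2) k l" for k l
    proof (cases "l \<le> k")
      case True
      then show ?thesis
        by (intro kernel_decay_mono[OF M1(2) \<epsilon>(2) M1(1)]) auto
    next
      case False
      then show ?thesis
        by (intro kernel_decay_mono[OF M2(2) \<epsilon>(3) M2(1)]) auto
    qed
    note res = bounded[of "\<lambda>_ _. True" \<epsilon> "max M1 M2"]
    have "(\<forall>f\<in>herz_space \<alpha> q p pt2. AE x in lebesgue.
        set_integrable lebesgue {y. True} (comm_integrand \<Phi> b f x)) \<and>
      bounded_operator (herz_space \<alpha> q p pt2) (herz_norm \<alpha> q p pt2) (herz_space \<alpha> q p pt) (herz_norm \<alpha> q p pt)
        (\<lambda>f x. LINT y:{y. True}|lebesgue. comm_integrand \<Phi> b f x y)"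
      by (rule res) (use \<epsilon> M1 decay in auto)
    then show "\<forall>f\<in>herz_space \<alpha> q p pt2. AE x in lebesgue. integrable lebesgue (comm_integrand \<Phi> b f x)"
      "bounded_operator (herz_space \<alpha> q p pt2) (herz_norm \<alpha> q p pt2) (herz_space \<alpha> q p pt) (herz_norm \<alpha> q p pt) (hausdorff_comm \<Phi> b)"
      by (simp_all add: hausdorff_comm_def[abs_def] set_integrable_def set_lebesgue_integral_def)
  qed
qed

end
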